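(* Let $\alpha>0$, let $\{x_i\}_{i=1}^n\subset\mathbb{R}^d$, and let $X=(x_1\ x_2\ \cdots\ x_n)$. The solutions to the minimum mean spatial-spectral quadratic variation program $$\min_{\Phi\in\mathcal{I}(\mathbb{R}^d,\mathcal{H})} \mathrm{MSSQV}(\Phi)$$ are limits (as $N\to\infty$) of isometries of the form $$\Phi_N(x) = \sum_{i=1}^d (u_i^T x)\, \phi_i(N),$$ where $\{u_i\}_{i=1}^d$ is an orthonormal basis of $\mathbb{R}^d$ consisting of left singular vectors of $X$ corresponding to the singular values $\sigma_1(X)\ge\cdots\ge\sigma_d(X)$ in a respective fashion, and where for each $N\ge d$ the collection $\{\widehat{\phi_i(N)}\}_{i=1}^d$ is an orthonormal collection of eigenvectors corresponding, in a respective fashion, to the $d$ lowest (but non-zero) eigenvalues, in non-decreasing order, of the truncated operator $B_\alpha^{(N)}$. Moreover, $\mathrm{MSSQV}(\Phi_N)$ converges to the optimal value of the program as $N\to\infty$.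
   Context: $L^2([0,1])$ is the space of real-valued square-integrable functions on $[0,1]$. For $f\in L^2([0,1])$, $\hat f\in\ell^2(\mathbb{Z})$ denotes its sequence of Fourier coefficients, $f(t)=\sum_{k\in\mathbb{Z}}\hat f[k]e^{2\pi\iota kt}$ with $\iota=\sqrt{-1}$. $\mathcal{H}=\{f\in L^2([0,1]): f'\in L^2([0,1])\}$ is a Sobolev space and $Df=f'$. $\mathcal{I}(\mathbb{R}^d,\mathcal{H})$ is the set of linear isometries from $\mathbb{R}^d$ to $L^2([0,1])$ (with the $L^2$ norm) whose images are contained in $\mathcal{H}$. The mean spatial-spectral quadratic variation is $$\mathrm{MSSQV}(\Phi)=\frac1n\sum_{i=1}^n\left(\frac{\alpha}{4\pi^2}\|D\Phi(x_i)\|_{L^2([0,1])}^2+\sum_{k\in\mathbb{Z}}\left|\widehat{\Phi(x_i)}[k+1]-\widehat{\Phi(x_i)}[k]\right|^2\right).$$ $B_\alpha^{(N)}$ is the infinite truncated tridiagonal matrix with indices in $\mathbb{Z}$, acting on $\ell^2(\mathbb{Z})$, with entries: $(B_\alpha^{(N)})_{j,k}=\alpha k^2+2$ if $j=k$ and $-N\le k\le N$; $(B_\alpha^{(N)})_{j,k}=-1$ if $|j-k|=1$, $-N\le j\le N$ and $-N\le k\le N$; and $0$ otherwise. Eigenvalues are counted with multiplicity. $\sigma_1(X)\ge\cdots\ge\sigma_d(X)\ge 0$ are the singular values of $X$, i.e. the square roots of the $d$ eigenvalues of $XX^T$ with multiplicity; a left singular vector corresponding to $\sigma_i(X)$ is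 an eigenvector of $XX^T$ with eigenvalue $\sigma_i(X)^2$. That $\Phi$ is a limit of $\Phi_N$ means $\Phi_N(x)\to\Phi(x)$ in $L^2([0,1])$ for every $x\in\mathbb{R}^d$.
   Formalization: H is taken as the periodic Sobolev space (derivative on the circle); "every solution is such a limit" is stated for X of rank d, and for general X only on the span of the x_i, since solutions are otherwise arbitrary on the complement; the converse and the "Moreover" hold for all X. *)

theory Defs
  imports "HOL-Analysis.Analysis" "HOL-Library.Function_Algebras" "HOL-Library.Multiset"
begin

text \<open>
  Elements of $L^2([0,1])$ are represented by functions \<open>real \<Rightarrow> real\<close> of which only the
  almost-everywhere class on the unit interval matters; identities between them are therefore
  stated almost everywhere.
\<close>

abbreviation unit_measure :: "real measure" where
  "unit_measure \<equiv> lebesgue_on {0..1}"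

definition L2 :: "(real \<Rightarrow> real) set" where
  "L2 = {f. f \<in> borel_measurable unit_measure \<and> integrable unit_measure (\<lambda>t. (f t)\<^sup>2)}"

definition L2norm :: "(real \<Rightarrow> real) \<Rightarrow> real" where
  "L2norm f = sqrt (\<integral>t. (f t)\<^sup>2 \<partial>unit_measure)"

definition fourier :: "(real \<Rightarrow> real) \<Rightarrow> int \<Rightarrow> complex" where
  "fourier f k =
     (\<integral>t. complex_of_real (f t) * exp (- 2 * of_real pi * \<i> * of_int k * of_real t) \<partial>unit_measure)"

text \<open>
  The derivative is the distributional derivative on the circle $\mathbb{R}/\mathbb{Z}$: functions
  on the unit interval are identified with 1-periodic ones (as the Fourier expansion does), so that
  the test functions are the smooth 1-periodic functions. Testing only against functions compactly
  supported in the open interval would give the non-periodic Sobolev space, on which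
  $\|f'\|^2 = 4\pi^2\sum_k k^2 |\hat f[k]|^2$ fails (take $f(t)=t$).
\<close>

definition periodic_test_function :: "(real \<Rightarrow> real) \<Rightarrow> bool" where
  "periodic_test_function \<psi> \<longleftrightarrow>
     (\<forall>m. (deriv ^^ m) \<psi> differentiable_on UNIV) \<and> (\<forall>t. \<psi> (t + 1) = \<psi> t)"

definition has_weak_deriv :: "(real \<Rightarrow> real) \<Rightarrow> (real \<Rightarrow> real) \<Rightarrow> bool" where
  "has_weak_deriv f g \<longleftrightarrow> f \<in> L2 \<and> g \<in> L2 \<and>
     (\<forall>\<psi>. periodic_test_function \<psi> \<longrightarrow>
        (\<integral>t. f t * deriv \<psi> t \<partial>unit_measure) = - (\<integral>t. g t * \<psi> t \<partial>unit_measure))"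

definition sobolev :: "(real \<Rightarrow> real) set" where
  "sobolev = {f \<in> L2. \<exists>g \<in> L2. has_weak_deriv f g}"

text \<open>Weak derivatives are unique up to null sets, so the choice below is immaterial.\<close>

definition weak_deriv :: "(real \<Rightarrow> real) \<Rightarrow> real \<Rightarrow> real" where
  "weak_deriv f = (SOME g. has_weak_deriv f g)"

definition isometries :: "(real ^ 'd \<Rightarrow> real \<Rightarrow> real) set" where
  "isometries = {\<Phi>.
     (\<forall>y. \<Phi> y \<in> sobolev) \<and>
     (\<forall>y z. AE t in unit_measure. \<Phi> (y + z) t = \<Phi> y t + \<Phi> z t) \<and>
     (\<forall>c y. AE t in unit_measure. \<Phi> (c *\<^sub>R y) t = c * \<Phi> y t) \<and>
     (\<forall>y. L2norm (\<Phi> y) = norm y)}"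

definition MSSQV :: "real \<Rightarrow> ('n::finite \<Rightarrow> real ^ 'd) \<Rightarrow> (real ^ 'd \<Rightarrow> real \<Rightarrow> real) \<Rightarrow> real" where
  "MSSQV \<alpha> x \<Phi> = 1 / real CARD('n) *
     (\<Sum>i\<in>UNIV. \<alpha> / (4 * pi\<^sup>2) * (L2norm (weak_deriv (\<Phi> (x i))))\<^sup>2 +
        (\<Sum>\<^sub>\<infinity>k. (cmod (fourier (\<Phi> (x i)) (k + 1) - fourier (\<Phi> (x i)) k))\<^sup>2))"

definition is_solution :: "real \<Rightarrow> ('n::finite \<Rightarrow> real ^ 'd) \<Rightarrow> (real ^ 'd \<Rightarrow> real \<Rightarrow> real) \<Rightarrow> bool" where
  "is_solution \<alpha> x \<Phi> \<longleftrightarrow> \<Phi> \<in> isometries \<and> (\<forall>\<Psi>\<in>isometries. MSSQV \<alpha> x \<Phi> \<le> MSSQV \<alpha> x \<Psi>)"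

definition is_limit ::
  "(nat \<Rightarrow> real ^ 'd \<Rightarrow> real \<Rightarrow> real) \<Rightarrow> (real ^ 'd \<Rightarrow> real \<Rightarrow> real) \<Rightarrow> bool" where
  "is_limit \<Phi>s \<Phi> \<longleftrightarrow>
     (\<forall>y. \<Phi> y \<in> L2 \<and> (\<lambda>N. L2norm (\<lambda>t. \<Phi>s N y t - \<Phi> y t)) \<longlonglongrightarrow> 0)"


text \<open>
  Eigenvalues repeated according to (geometric) multiplicity, in non-decreasing order; \<open>m c\<close> is
  the dimension of the eigenspace of \<open>c\<close>, and \<open>C\<close> is the set of eigenvalues taken into account,
  which is finite in both uses. All positions of lists and families are counted from 0.
\<close>

definition sorted_eigenvalues :: "real set \<Rightarrow> (real \<Rightarrow> nat) \<Rightarrow> real list" where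
  "sorted_eigenvalues C m = sorted_list_of_multiset (\<Sum>c\<in>C. replicate_mset (m c) c)"

definition data_matrix :: "('n::finite \<Rightarrow> real ^ 'd) \<Rightarrow> real ^ 'n ^ 'd" where
  "data_matrix x = (\<chi> r c. x c $ r)"

definition matrix_eigenspace :: "real ^ 'd ^ 'd \<Rightarrow> real \<Rightarrow> (real ^ 'd) set" where
  "matrix_eigenspace A c = {v. A *v v = c *\<^sub>R v}"

definition singular_value :: "real ^ 'n ^ 'd \<Rightarrow> nat \<Rightarrow> real" where
  "singular_value X i = sqrt (rev (sorted_eigenvalues
       {c. \<exists>v. v \<noteq> 0 \<and> v \<in> matrix_eigenspace (X ** transpose X) c}
       (\<lambda>c. dim (matrix_eigenspace (X ** transpose X) c))) ! i)"

definition left_singular_basis :: "real ^ 'n ^ 'd \<Rightarrow> (nat \<Rightarrow> real ^ 'd) \<Rightarrow> bool" where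
  "left_singular_basis X u \<longleftrightarrow>
     (\<forall>i<CARD('d). \<forall>j<CARD('d). u i \<bullet> u j = (if i = j then 1 else 0)) \<and>
     span (u ` {..<CARD('d)}) = UNIV \<and>
     (\<forall>i<CARD('d). u i \<in> matrix_eigenspace (X ** transpose X) ((singular_value X i)\<^sup>2))"


definition l2Z :: "(int \<Rightarrow> complex) set" where
  "l2Z = {v. (\<lambda>k. (cmod (v k))\<^sup>2) summable_on UNIV}"

definition l2Z_inner :: "(int \<Rightarrow> complex) \<Rightarrow> (int \<Rightarrow> complex) \<Rightarrow> complex" where
  "l2Z_inner v w = (\<Sum>\<^sub>\<infinity>k. cnj (v k) * w k)"

definition seq_scale :: "complex \<Rightarrow> (int \<Rightarrow> complex) \<Rightarrow> int \<Rightarrow> complex" where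
  "seq_scale c v = (\<lambda>k. c * v k)"

interpretation seq: vector_space seq_scale
  by unfold_locales (auto simp: seq_scale_def fun_eq_iff algebra_simps)

definition trunc_B :: "real \<Rightarrow> nat \<Rightarrow> int \<Rightarrow> int \<Rightarrow> real" where
  "trunc_B \<alpha> N j k =
     (if j = k \<and> - int N \<le> k \<and> k \<le> int N then \<alpha> * (of_int k)\<^sup>2 + 2
      else if \<bar>j - k\<bar> = 1 \<and> - int N \<le> j \<and> j \<le> int N \<and> - int N \<le> k \<and> k \<le> int N then - 1
      else 0)"

definition apply_trunc_B :: "real \<Rightarrow> nat \<Rightarrow> (int \<Rightarrow> complex) \<Rightarrow> int \<Rightarrow> complex" where
  "apply_trunc_B \<alpha> N v = (\<lambda>j. \<Sum>\<^sub>\<infinity>k. of_real (trunc_B \<alpha> N j k) * v k)"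

text \<open>The operator is self-adjoint, so only real eigenvalues need to be considered.\<close>

definition B_eigenspace :: "real \<Rightarrow> nat \<Rightarrow> real \<Rightarrow> (int \<Rightarrow> complex) set" where
  "B_eigenspace \<alpha> N c = {v \<in> l2Z. apply_trunc_B \<alpha> N v = seq_scale (of_real c) v}"

definition B_nonzero_eigenvalues :: "real \<Rightarrow> nat \<Rightarrow> real list" where
  "B_nonzero_eigenvalues \<alpha> N = sorted_eigenvalues
     {c. c \<noteq> 0 \<and> (\<exists>v. v \<noteq> 0 \<and> v \<in> B_eigenspace \<alpha> N c)}
     (\<lambda>c. seq.dim (B_eigenspace \<alpha> N c))"

definition B_eigenfamily :: "real \<Rightarrow> nat \<Rightarrow> (nat \<Rightarrow> nat \<Rightarrow> real \<Rightarrow> real) \<Rightarrow> bool" where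
  "B_eigenfamily \<alpha> d \<phi> \<longleftrightarrow> (\<forall>N\<ge>d.
     (\<forall>i<d. \<phi> N i \<in> L2 \<and>
        fourier (\<phi> N i) \<in> B_eigenspace \<alpha> N (B_nonzero_eigenvalues \<alpha> N ! i)) \<and>
     (\<forall>i<d. \<forall>j<d. l2Z_inner (fourier (\<phi> N i)) (fourier (\<phi> N j)) = (if i = j then 1 else 0)))"

definition truncated_isometry ::
  "(nat \<Rightarrow> real ^ 'd) \<Rightarrow> (nat \<Rightarrow> nat \<Rightarrow> real \<Rightarrow> real) \<Rightarrow> nat \<Rightarrow> real ^ 'd \<Rightarrow> real \<Rightarrow> real" where
  "truncated_isometry u \<phi> N y = (\<lambda>t. \<Sum>i<CARD('d). (u i \<bullet> y) * \<phi> N i t)"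

end

theory Submission
  imports Defs
begin

text \<open>
  Sending a real function to the real sequence \<open>Re + Im\<close> of its Fourier coefficients (the Hartley
  transform) is an isometry that commutes with the tridiagonal operator, and turns the objective
  into the quadratic form \<open>Q(v) = \<Sum>k. \<alpha> k\<^sup>2 v(k)\<^sup>2 + (v(k + 1) - v(k))\<^sup>2\<close>. In a left singular basis \<open>u\<close> of
  the data the program becomes the minimisation of \<open>\<Sum>i. \<sigma>(i)\<^sup>2 Q(v(i))\<close> over orthonormal families \<open>v\<close>.

  For the truncation to \<open>[-N, N]\<close>, a Jacobi matrix with simple spectrum, Ky Fan's argument bounds
  \<open>Q(v(1)) + \<dots> + Q(v(m))\<close> from below by the sum of the \<open>m\<close> lowest eigenvalues, up to the mass of the \<open>v(j)\<close>
  outside \<open>[-N, N]\<close>; the defect is at least the spectral gap times the distance of the \<open>v(j)\<close> to the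
  first \<open>m\<close> eigenvectors. Comparing two truncations shows that the eigenvalues converge, and
  compactness yields limit eigenvectors \<open>\<psi>(i)\<close>, whose eigenvalues are distinct because the Casoratian of two
  square-summable solutions vanishes. Applying the bound with defect to the \<open>\<psi>(i)\<close> themselves gives
  convergence of the truncated eigenvectors up to sign; applying it to a minimiser, together with
  summation by parts in \<open>\<sigma>(i)\<^sup>2\<close>, shows that the minimiser maps each singular space with \<open>\<sigma> > 0\<close> onto the
  span of the corresponding \<open>\<psi>(i)\<close>, so that \<open>u\<close> can be rotated to match the \<open>\<psi>(i)\<close>.
\<close>

section \<open>Inner products and symmetric matrices\<close>

text \<open>Real Hartley sequences leave only a sign ambiguity in each eigenvector, where complex
  eigenvectors would carry a phase. The untruncated operator is unbounded; it is reached only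
  through finite symmetric matrices and limits in \<open>N\<close>.

  Ky Fan's bound controls sums of the lowest eigenvalues, not single ones. This is why the objective
  is rewritten by Abel summation with the nonnegative drops of the squared singular values as
  weights, and why a minimiser is pinned down only at indices where a drop occurs: ties are absorbed
  by rotating \<open>u\<close>, and directions with singular value 0 remain free.

  On the analytic side, the variation of a Sobolev function is bounded below by the energy of its
  coefficients, through Bessel's inequality for the weak derivative; equality is shown for
  coefficients in \<open>H2\<close>. This suffices: arbitrary competitors require only the lower
  bound, and the limit eigenvectors inherit decay of second order from their recurrence.\<close>

locale ip_space =
  fixes V :: "('a \<Rightarrow> real) set" and ip :: "('a \<Rightarrow> real) \<Rightarrow> ('a \<Rightarrow> real) \<Rightarrow> real"
  assumes zero_mem: "(\<lambda>_. 0) \<in> V"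
    and lincomb_mem: "f \<in> V \<Longrightarrow> g \<in> V \<Longrightarrow> (\<lambda>x. a * f x + g x) \<in> V"
    and ip_lincomb_left:
      "f \<in> V \<Longrightarrow> g \<in> V \<Longrightarrow> h \<in> V \<Longrightarrow> ip (\<lambda>x. a * f x + g x) h = a * ip f h + ip g h"
    and ip_commute: "ip f g = ip g f"
    and ip_nonneg: "0 \<le> ip f f"
begin

lemma ip_lincomb_right:
  "f \<in> V \<Longrightarrow> g \<in> V \<Longrightarrow> h \<in> V \<Longrightarrow> ip h (\<lambda>x. a * f x + g x) = a * ip h f + ip h g"
  using ip_lincomb_left[of f g h a]
  by (simp only: ip_commute[of h f] ip_commute[of h g] ip_commute[of h "\<lambda>x. a * f x + g x"])

lemma ip_zero_left: "h \<in> V \<Longrightarrow> ip (\<lambda>_. 0) h = 0"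
  using ip_lincomb_left[OF zero_mem zero_mem, of h 1] by simp

lemma sum_mem: "(\<And>j. j \<in> J \<Longrightarrow> f j \<in> V) \<Longrightarrow> (\<lambda>x. \<Sum>j\<in>J. c j * f j x) \<in> V"
proof (induction J rule: infinite_finite_induct)
  case (insert j J)
  have "(\<lambda>x. c j * f j x + (\<Sum>j\<in>J. c j * f j x)) \<in> V"
    by (intro lincomb_mem insert.IH insert.prems) auto
  then show ?case by (simp add: insert.hyps)
qed (simp_all add: zero_mem)

lemma ip_sum_left:
  assumes "\<And>j. j \<in> J \<Longrightarrow> f j \<in> V" "h \<in> V"
  shows "ip (\<lambda>x. \<Sum>j\<in>J. c j * f j x) h = (\<Sum>j\<in>J. c j * ip (f j) h)"
  using assms(1)
proof (induction J rule: infinite_finite_induct)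
  case (insert j J)
  have "ip (\<lambda>x. c j * f j x + (\<Sum>j\<in>J. c j * f j x)) h
      = c j * ip (f j) h + ip (\<lambda>x. \<Sum>j\<in>J. c j * f j x) h"
    by (intro ip_lincomb_left sum_mem insert.prems assms(2)) auto
  then show ?case using insert.IH insert.prems by (simp add: insert.hyps)
qed (simp_all add: ip_zero_left assms(2))

lemma ip_sum_right:
  assumes "\<And>j. j \<in> J \<Longrightarrow> f j \<in> V" "h \<in> V"
  shows "ip h (\<lambda>x. \<Sum>j\<in>J. c j * f j x) = (\<Sum>j\<in>J. c j * ip h (f j))"
  using ip_sum_left[OF assms, where c = c] by (simp only: ip_commute[of h])

lemma diff_mem: "f \<in> V \<Longrightarrow> g \<in> V \<Longrightarrow> (\<lambda>x. f x - g x) \<in> V"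
  using lincomb_mem[of g f "-1"] by simp

lemma scale_mem: "f \<in> V \<Longrightarrow> (\<lambda>x. c * f x) \<in> V"
  using lincomb_mem[OF _ zero_mem, of f c] by simp

lemma ip_scale_left: "f \<in> V \<Longrightarrow> h \<in> V \<Longrightarrow> ip (\<lambda>x. c * f x) h = c * ip f h"
  using ip_lincomb_left[OF _ zero_mem, of f h c] by (simp add: ip_zero_left)

lemma ip_diff_left: "f \<in> V \<Longrightarrow> g \<in> V \<Longrightarrow> h \<in> V \<Longrightarrow> ip (\<lambda>x. f x - g x) h = ip f h - ip g h"
  using ip_lincomb_left[of g f h "-1"] by simp

lemma ip_diff_right: "f \<in> V \<Longrightarrow> g \<in> V \<Longrightarrow> h \<in> V \<Longrightarrow> ip h (\<lambda>x. f x - g x) = ip h f - ip h g"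
  using ip_diff_left[of f g h]
  by (simp only: ip_commute[of h f] ip_commute[of h g] ip_commute[of h "\<lambda>x. f x - g x"])

lemma ip_diff_self:
  assumes "f \<in> V" "g \<in> V"
  shows "ip (\<lambda>x. f x - g x) (\<lambda>x. f x - g x) = ip f f - 2 * ip f g + ip g g"
  using assms by (simp add: ip_diff_left ip_diff_right diff_mem ip_commute[of g f])

definition orthonormal_on :: "'b set \<Rightarrow> ('b \<Rightarrow> 'a \<Rightarrow> real) \<Rightarrow> bool" where
  "orthonormal_on J v \<longleftrightarrow> (\<forall>j\<in>J. v j \<in> V) \<and> (\<forall>i\<in>J. \<forall>j\<in>J. ip (v i) (v j) = (if i = j then 1 else 0))"

lemma orthonormal_combination:
  assumes "finite J" "orthonormal_on J v"
  shows "ip (\<lambda>x. \<Sum>j\<in>J. c j * v j x) (\<lambda>x. \<Sum>j\<in>J. d j * v j x) = (\<Sum>j\<in>J. c j * d j)"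
proof -
  have V: "v j \<in> V" if "j \<in> J" for j using assms(2) that by (auto simp: orthonormal_on_def)
  have "ip (v i) (\<lambda>x. \<Sum>j\<in>J. d j * v j x) = d i" if "i \<in> J" for i
  proof -
    have "ip (v i) (\<lambda>x. \<Sum>j\<in>J. d j * v j x) = (\<Sum>j\<in>J. d j * (if i = j then 1 else 0))"
      using V that assms(2) by (subst ip_sum_right) (auto simp: orthonormal_on_def)
    then show ?thesis using that assms(1) by (simp add: if_distrib[of "\<lambda>x. _ * x"] cong: if_cong)
  qed
  then show ?thesis using V by (subst ip_sum_left) (auto simp: sum_mem)
qed

text \<open>Pythagoras for the projection onto the span. The exact defect is kept because equality
  in Bessel's inequality must later yield that \<open>f\<close> coincides with its
  projection.\<close>

lemma bessel_defect:
  assumes "finite J" "orthonormal_on J v" "f \<in> V"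
  defines "g \<equiv> \<lambda>x. f x - (\<Sum>j\<in>J. ip f (v j) * v j x)"
  shows "ip g g = ip f f - (\<Sum>j\<in>J. (ip f (v j))\<^sup>2)"
proof -
  have V: "v j \<in> V" if "j \<in> J" for j using assms(2) that by (auto simp: orthonormal_on_def)
  have "ip f (\<lambda>x. \<Sum>j\<in>J. ip f (v j) * v j x) = (\<Sum>j\<in>J. (ip f (v j))\<^sup>2)"
    using V assms by (subst ip_sum_right) (auto simp: power2_eq_square)
  then show ?thesis
    unfolding g_def using V assms(3)
    by (subst ip_diff_self) (auto simp: sum_mem orthonormal_combination[OF assms(1,2)] power2_eq_square)
qed

lemma bessel_inequality:
  assumes "finite J" "orthonormal_on J v" "f \<in> V"
  shows "(\<Sum>j\<in>J. (ip f (v j))\<^sup>2) \<le> ip f f"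
  using bessel_defect[OF assms] ip_nonneg[of "\<lambda>x. f x - (\<Sum>j\<in>J. ip f (v j) * v j x)"] by simp

text \<open>The form is only assumed semidefinite, because members of \<open>L2\<close> are
  representatives rather than classes; hence \<open>ip f f = 0\<close> is handled apart from the
  usual choice of the minimising \<open>t\<close>.\<close>

lemma ip_cauchy_schwarz:
  assumes "f \<in> V" "g \<in> V"
  shows "(ip f g)\<^sup>2 \<le> ip f f * ip g g"
proof -
  have *: "0 \<le> t\<^sup>2 * ip f f + 2 * t * ip f g + ip g g" for t
  proof -
    have "ip (\<lambda>x. t * f x + g x) (\<lambda>x. t * f x + g x) = t\<^sup>2 * ip f f + 2 * t * ip f g + ip g g"
      using assms
      by (simp add: ip_lincomb_left ip_lincomb_right lincomb_mem ip_commute[of g f])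
        (simp add: power2_eq_square algebra_simps)
    then show ?thesis using ip_nonneg by metis
  qed
  show ?thesis
  proof (cases "ip f f = 0")
    case True
    have "ip f g = 0"
    proof (rule ccontr)
      assume n: "ip f g \<noteq> 0"
      \<comment> \<open>With \<open>ip f f = 0\<close> the quadratic is affine in \<open>t\<close>;
        this value makes it equal to -1.\<close>
      define t where "t = - (ip g g + 1) / (2 * ip f g)"
      have "2 * t * ip f g = - (ip g g + 1)" using n by (simp add: t_def)
      then show False using *[of t] True by simp
    qed
    then show ?thesis using True by simp
  next
    case False
    then have p: "ip f f > 0" using ip_nonneg[of f] by simp
    have "0 \<le> ip f f * ((- ip f g / ip f f)\<^sup>2 * ip f f + 2 * (- ip f g / ip f f) * ip f g + ip g g)"
      using *[of "- ip f g / ip f f"] p by (intro mult_nonneg_nonneg) auto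
    also have "\<dots> = ip f f * ip g g - (ip f g)\<^sup>2"
      using p by (simp add: field_simps power2_eq_square)
    finally show ?thesis by simp
  qed
qed

lemma ip_scale_right: "f \<in> V \<Longrightarrow> h \<in> V \<Longrightarrow> ip h (\<lambda>x. c * f x) = c * ip h f"
  using ip_scale_left[of f h c] by (simp only: ip_commute[of h f] ip_commute[of h "\<lambda>x. c * f x"])

lemma ip_tendsto_zero:
  assumes "\<And>n. f n \<in> V" "\<And>n. g n \<in> V"
    and f: "(\<lambda>n. ip (f n) (f n)) \<longlonglongrightarrow> 0" and g: "(\<lambda>n. ip (g n) (g n)) \<longlonglongrightarrow> c"
  shows "(\<lambda>n. ip (f n) (g n)) \<longlonglongrightarrow> 0"
proof -
  have "(\<lambda>n. ip (f n) (f n) * ip (g n) (g n)) \<longlonglongrightarrow> 0" using tendsto_mult[OF f g] by simp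
  then have "(\<lambda>n. (ip (f n) (g n))\<^sup>2) \<longlonglongrightarrow> 0"
  proof (rule tendsto_sandwich[of "\<lambda>_. 0", rotated -1])
    show "\<forall>\<^sub>F n in sequentially. (ip (f n) (g n))\<^sup>2 \<le> ip (f n) (f n) * ip (g n) (g n)"
      by (intro always_eventually allI ip_cauchy_schwarz assms(1,2))
  qed simp_all
  then show ?thesis by simp
qed

lemma ip_tendsto:
  assumes V: "\<And>n. f n \<in> V" "\<And>n. g n \<in> V" "f' \<in> V" "g' \<in> V"
    and f: "(\<lambda>n. ip (\<lambda>x. f n x - f' x) (\<lambda>x. f n x - f' x)) \<longlonglongrightarrow> 0"
    and g: "(\<lambda>n. ip (\<lambda>x. g n x - g' x) (\<lambda>x. g n x - g' x)) \<longlonglongrightarrow> 0"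
  shows "(\<lambda>n. ip (f n) (g n)) \<longlonglongrightarrow> ip f' g'"
proof -
  have D: "(\<lambda>x. f n x - f' x) \<in> V" "(\<lambda>x. g n x - g' x) \<in> V" for n using diff_mem V by auto
  have "(\<lambda>n. ip (\<lambda>x. f n x - f' x) (\<lambda>x. g n x - g' x) + ip (\<lambda>x. f n x - f' x) g'
      + ip (\<lambda>x. g n x - g' x) f' + ip f' g') \<longlonglongrightarrow> 0 + 0 + 0 + ip f' g'"
    by (intro tendsto_add tendsto_const ip_tendsto_zero[OF _ _ f g] ip_tendsto_zero[OF _ _ f tendsto_const]
        ip_tendsto_zero[OF _ _ g tendsto_const] D V)
  moreover have "ip (\<lambda>x. f n x - f' x) (\<lambda>x. g n x - g' x) + ip (\<lambda>x. f n x - f' x) g'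
      + ip (\<lambda>x. g n x - g' x) f' + ip f' g' = ip (f n) (g n)" for n
    using V D by (simp add: ip_diff_left ip_diff_right ip_commute[of g' f'] ip_commute[of "g n" f'])
  ultimately show ?thesis by simp
qed

lemma orthonormal_on_sign:
  assumes "orthonormal_on J v" "\<And>j. j \<in> J \<Longrightarrow> s j * s j = (1::real)"
  shows "orthonormal_on J (\<lambda>j k. s j * v j k)"
  unfolding orthonormal_on_def
proof (intro conjI ballI)
  have V: "v j \<in> V" if "j \<in> J" for j using assms(1) that by (simp add: orthonormal_on_def)
  show "(\<lambda>k. s j * v j k) \<in> V" if "j \<in> J" for j by (rule scale_mem[OF V[OF that]])
  fix i j assume ij: "i \<in> J" "j \<in> J"
  have "ip (\<lambda>k. s i * v i k) (\<lambda>k. s j * v j k) = s i * (s j * ip (v i) (v j))"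
    unfolding ip_scale_left[OF V[OF ij(1)] scale_mem[OF V[OF ij(2)]]] ip_scale_right[OF V[OF ij(2)] V[OF ij(1)]] ..
  also have "ip (v i) (v j) = (if i = j then 1 else 0)" using assms(1) ij by (simp add: orthonormal_on_def)
  finally show "ip (\<lambda>k. s i * v i k) (\<lambda>k. s j * v j k) = (if i = j then 1 else 0)"
    using assms(2)[OF ij(1)] by auto
qed

lemma ip_sum_tendsto_zero:
  assumes "\<And>n i. i \<in> I \<Longrightarrow> f n i \<in> V" "\<And>i. i \<in> I \<Longrightarrow> (\<lambda>n. ip (f n i) (f n i)) \<longlonglongrightarrow> 0"
  shows "(\<lambda>n. ip (\<lambda>x. \<Sum>i\<in>I. c i * f n i x) (\<lambda>x. \<Sum>i\<in>I. c i * f n i x)) \<longlonglongrightarrow> 0"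
proof -
  have "(\<lambda>n. ip (f n i) (f n j)) \<longlonglongrightarrow> 0" if "i \<in> I" "j \<in> I" for i j
    by (rule ip_tendsto_zero[OF assms(1)[OF that(1)] assms(1)[OF that(2)] assms(2)[OF that(1)] assms(2)[OF that(2)]])
  then have "(\<lambda>n. \<Sum>i\<in>I. c i * (\<Sum>j\<in>I. c j * ip (f n i) (f n j))) \<longlonglongrightarrow> (\<Sum>i\<in>I. c i * (\<Sum>j\<in>I. c j * 0))"
    by (intro tendsto_sum tendsto_mult[OF tendsto_const])
  moreover have "ip (\<lambda>x. \<Sum>i\<in>I. c i * f n i x) (\<lambda>x. \<Sum>i\<in>I. c i * f n i x)
      = (\<Sum>i\<in>I. c i * (\<Sum>j\<in>I. c j * ip (f n i) (f n j)))" for n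
  proof (rule trans[OF ip_sum_left[OF assms(1) sum_mem[OF assms(1)]]])
    show "(\<Sum>i\<in>I. c i * ip (f n i) (\<lambda>x. \<Sum>i\<in>I. c i * f n i x))
        = (\<Sum>i\<in>I. c i * (\<Sum>j\<in>I. c j * ip (f n i) (f n j)))"
      by (intro sum.cong refl arg_cong2[where f = times] ip_sum_right assms(1))
  qed
  ultimately show ?thesis by simp
qed

end

section \<open>Orthonormal eigenbases of real symmetric matrices\<close>

lemma ip_space_finite:
  assumes "finite S"
  shows "ip_space {v. \<forall>k. k \<notin> S \<longrightarrow> v k = 0} (\<lambda>f g. \<Sum>k\<in>S. f k * g k)"
  by unfold_locales
    (auto simp: sum.distrib sum_distrib_left algebra_simps intro: sum_nonneg)

text \<open>Variational argument: the quadratic form attains its minimum on the unit sphere of the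
  orthogonal complement \<open>W\<close> of the given eigenvectors. Symmetry makes \<open>W\<close>
  invariant, so the residual of the minimiser is an admissible direction, and moving against it
  would lower the Rayleigh quotient unless it is zero.\<close>

lemma symmetric_eigenvector_orthogonal:
  fixes a :: "'i \<Rightarrow> 'i \<Rightarrow> real" and e :: "nat \<Rightarrow> 'i \<Rightarrow> real"
  assumes S: "finite S" and sym: "\<And>j k. j \<in> S \<Longrightarrow> k \<in> S \<Longrightarrow> a j k = a k j"
    and eig: "\<And>i k. i < m \<Longrightarrow> k \<in> S \<Longrightarrow> (\<Sum>j\<in>S. a k j * e i j) = l i * e i k"
    and v: "\<And>k. k \<notin> S \<Longrightarrow> v k = 0" "\<And>i. i < m \<Longrightarrow> (\<Sum>k\<in>S. v k * e i k) = 0" "v \<noteq> (\<lambda>_. 0)"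
  obtains w c where "\<And>k. k \<notin> S \<Longrightarrow> w k = 0" "\<And>i. i < m \<Longrightarrow> (\<Sum>k\<in>S. w k * e i k) = 0"
    "(\<Sum>k\<in>S. w k * w k) = 1" "\<And>k. k \<in> S \<Longrightarrow> (\<Sum>j\<in>S. a k j * w j) = c * w k"
proof -
  define F where "F = (\<lambda>v::'i \<Rightarrow> real. \<Sum>k\<in>S. \<Sum>j\<in>S. a k j * v k * v j)"
  define nn where "nn = (\<lambda>v::'i \<Rightarrow> real. \<Sum>k\<in>S. v k * v k)"
  define W where "W = {v::'i\<Rightarrow>real. (\<forall>k. k \<notin> S \<longrightarrow> v k = 0) \<and> (\<forall>i<m. (\<Sum>k\<in>S. v k * e i k) = 0)}"
  \<comment> \<open>The index type may be infinite: pinning the coordinates outside \<open>S\<close>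
    to 0 keeps the box a product of compact sets.\<close>
  define P where "P = PiE UNIV (\<lambda>k. if k \<in> S then {-1..1::real} else {0})"
  have "compact P"
    unfolding P_def by (subst compactin_euclidean_iff[symmetric], subst euclidean_product_topology[symmetric])
      (simp add: compactin_PiE)
  moreover have ev: "continuous_on UNIV (\<lambda>v::'i\<Rightarrow>real. v k)" for k
    by (rule continuous_on_product_coordinates)
  have cnn: "continuous_on UNIV nn" and cF: "continuous_on UNIV F"
    unfolding nn_def F_def by (intro continuous_intros ev)+
  have "closed (\<Inter>i\<in>{..<m}. {v::'i\<Rightarrow>real. (\<Sum>k\<in>S. v k * e i k) = 0})"
    by (intro closed_INT ballI closed_Collect_eq continuous_intros ev)
  moreover have "closed {v. nn v = 1}"
    by (intro closed_Collect_eq cnn continuous_intros)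
  ultimately have "compact (P \<inter> ((\<Inter>i\<in>{..<m}. {v::'i\<Rightarrow>real. (\<Sum>k\<in>S. v k * e i k) = 0}) \<inter> {v. nn v = 1}))"
    by (intro compact_Int_closed closed_Int)
  also have "P \<inter> ((\<Inter>i\<in>{..<m}. {v::'i\<Rightarrow>real. (\<Sum>k\<in>S. v k * e i k) = 0}) \<inter> {v. nn v = 1}) = W \<inter> {v. nn v = 1}"
  proof -
    have "\<bar>v k\<bar> \<le> 1" if "nn v = 1" "k \<in> S" for v k
    proof -
      have "v k * v k \<le> nn v" unfolding nn_def using S that by (intro member_le_sum) auto
      then show ?thesis using that abs_square_le_1[of "v k"] by (simp add: power2_eq_square)
    qed
    then have "v \<in> P \<longleftrightarrow> (\<forall>k. k \<notin> S \<longrightarrow> v k = 0)" if "nn v = 1" for v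
      unfolding P_def PiE_iff using that by (force split: if_splits simp: abs_le_iff)
    then show ?thesis unfolding W_def by auto
  qed
  finally have comp: "compact (W \<inter> {v. nn v = 1})" .
  have nn0: "nn w > 0" if "w \<in> W" "w \<noteq> (\<lambda>_. 0)" for w
  proof -
    have "nn w = 0 \<longleftrightarrow> (\<forall>k\<in>S. w k * w k = 0)" unfolding nn_def using S by (subst sum_nonneg_eq_0_iff) auto
    moreover have "nn w \<ge> 0" unfolding nn_def by (intro sum_nonneg) auto
    moreover have "\<exists>k\<in>S. w k \<noteq> 0" using that unfolding W_def by (metis (mono_tags, lifting) ext mem_Collect_eq)
    ultimately show ?thesis by (metis less_eq_real_def mult_eq_0_iff)
  qed
  have Wscale: "(\<lambda>k. c * w k) \<in> W" if "w \<in> W" for w c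
    using that unfolding W_def by (auto simp: mult.assoc sum_distrib_left[symmetric])
  have Wadd: "(\<lambda>k. w k + w' k) \<in> W" if "w \<in> W" "w' \<in> W" for w w'
    using that unfolding W_def by (auto simp: distrib_right sum.distrib)
  have nnscale: "nn (\<lambda>k. c * w k) = c\<^sup>2 * nn w" for c w
    unfolding nn_def by (simp add: sum_distrib_left power2_eq_square ac_simps)
  have Fscale: "F (\<lambda>k. c * w k) = c\<^sup>2 * F w" for c w
    unfolding F_def by (simp add: sum_distrib_left power2_eq_square ac_simps)
  have vW: "v \<in> W" using v unfolding W_def by auto
  have "(\<lambda>k. (1 / sqrt (nn v)) * v k) \<in> W \<inter> {v. nn v = 1}"
  proof -
    have "(1 / sqrt (nn v))\<^sup>2 * nn v = 1" using nn0[OF vW v(3)] by (simp add: power_divide)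
    then show ?thesis using Wscale[OF vW, of "1 / sqrt (nn v)"] nnscale[of "1 / sqrt (nn v)" v] by simp
  qed
  then have "W \<inter> {v. nn v = 1} \<noteq> {}" by blast
  from continuous_attains_inf[OF comp this continuous_on_subset[OF cF]]
  obtain w where w: "w \<in> W" "nn w = 1" and min: "\<And>y. y \<in> W \<Longrightarrow> nn y = 1 \<Longrightarrow> F w \<le> F y" by auto
  define c where "c = F w"
  have min': "c * nn y \<le> F y" if "y \<in> W" for y
  proof (cases "y = (\<lambda>_. 0)")
    case True
    then show ?thesis by (simp add: nn_def F_def)
  next
    case False
    note p = nn0[OF that False]
    have "c \<le> F (\<lambda>k. (1 / sqrt (nn y)) * y k)"
      unfolding c_def using p by (intro min Wscale that, subst nnscale) (auto simp: power_divide)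
    then show ?thesis using p by (subst (asm) Fscale) (simp add: power_divide field_simps)
  qed
  define r where "r = (\<lambda>k. if k \<in> S then (\<Sum>j\<in>S. a k j * w j) - c * w k else 0)"
  have rW: "r \<in> W"
  proof -
    have "(\<Sum>k\<in>S. r k * e i k) = 0" if i: "i < m" for i
    proof -
      have "(\<Sum>k\<in>S. r k * e i k) = (\<Sum>k\<in>S. \<Sum>j\<in>S. a k j * w j * e i k) - c * (\<Sum>k\<in>S. w k * e i k)"
        unfolding r_def by (simp add: sum_distrib_left sum_distrib_right sum_subtractf left_diff_distrib mult.assoc)
      also have "(\<Sum>k\<in>S. \<Sum>j\<in>S. a k j * w j * e i k) = (\<Sum>j\<in>S. \<Sum>k\<in>S. a k j * w j * e i k)"
        by (rule sum.swap)
      also have "\<dots> = (\<Sum>j\<in>S. w j * (\<Sum>k\<in>S. a j k * e i k))"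
        using sym by (intro sum.cong refl) (auto simp: sum_distrib_left ac_simps intro!: sum.cong)
      also have "\<dots> = l i * (\<Sum>j\<in>S. w j * e i j)"
        using eig[OF i] by (simp add: sum_distrib_left ac_simps)
      finally show ?thesis using w(1) i unfolding W_def by auto
    qed
    then show ?thesis unfolding W_def r_def by auto
  qed
  \<comment> \<open>The constant term vanishes since \<open>nn w = 1\<close> and
    \<open>c = F w\<close>; the linear coefficient is twice the product of \<open>r\<close> with the
    residual of \<open>w\<close>, which is \<open>r\<close> itself.\<close>
  have expand: "F (\<lambda>k. w k + t * r k) - c * nn (\<lambda>k. w k + t * r k) = 2 * t * nn r + t\<^sup>2 * (F r - c * nn r)" for t
  proof -
    have "(\<Sum>k\<in>S. \<Sum>j\<in>S. a k j * r k * w j) = (\<Sum>k\<in>S. \<Sum>j\<in>S. a k j * w k * r j)"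
      by (subst sum.swap) (auto intro!: sum.cong simp: sym)
    moreover have "F (\<lambda>k. w k + t * r k) = F w + t * (\<Sum>k\<in>S. \<Sum>j\<in>S. a k j * r k * w j)
        + t * (\<Sum>k\<in>S. \<Sum>j\<in>S. a k j * w k * r j) + t\<^sup>2 * F r"
      unfolding F_def by (simp add: algebra_simps sum.distrib sum_distrib_left power2_eq_square)
    ultimately have "F (\<lambda>k. w k + t * r k) = F w + 2 * t * (\<Sum>k\<in>S. \<Sum>j\<in>S. a k j * r k * w j) + t\<^sup>2 * F r"
      by simp
    moreover have "nn (\<lambda>k. w k + t * r k) = 1 + 2 * t * (\<Sum>k\<in>S. r k * w k) + t\<^sup>2 * nn r"
      unfolding w(2)[symmetric] nn_def by (simp add: algebra_simps sum.distrib sum_distrib_left power2_eq_square)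
    moreover have "(\<Sum>k\<in>S. \<Sum>j\<in>S. a k j * r k * w j) - c * (\<Sum>k\<in>S. r k * w k) = nn r"
    proof -
      have "(\<Sum>j\<in>S. a k j * r k * w j) - c * (r k * w k) = r k * r k" if "k \<in> S" for k
      proof -
        have "(\<Sum>j\<in>S. a k j * r k * w j) = r k * (\<Sum>j\<in>S. a k j * w j)"
          by (simp add: sum_distrib_left ac_simps)
        moreover have "(\<Sum>j\<in>S. a k j * w j) = r k + c * w k" using that by (simp add: r_def)
        ultimately show ?thesis by (simp add: algebra_simps)
      qed
      then show ?thesis
        unfolding nn_def sum_distrib_left sum_subtractf[symmetric] by (intro sum.cong refl)
    qed
    ultimately show ?thesis by (simp add: c_def algebra_simps)
  qed
  have "nn r = 0"
  proof (rule ccontr)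
    assume "nn r \<noteq> 0"
    moreover have "nn r \<ge> 0" unfolding nn_def by (intro sum_nonneg) auto
    ultimately have p: "nn r > 0" by simp
    define G where "G = F r - c * nn r"
    have G: "G \<ge> 0" using min'[OF rW] by (simp add: G_def)
    have *: "0 \<le> 2 * t * nn r + t\<^sup>2 * G" for t
      using min'[of "\<lambda>k. w k + t * r k"] Wadd[OF w(1) Wscale[OF rW, of t]] expand[of t] by (simp add: G_def)
    \<comment> \<open>Negative, and small enough that \<open>t * G > - nn r\<close>, so the linear
      term dominates; the 1 in the denominator covers \<open>G = 0\<close>.\<close>
    define t where "t = - nn r / (G + 1)"
    have t: "t < 0" using p G by (simp add: t_def)
    have "2 * t * nn r + t\<^sup>2 * G = t * (2 * nn r + t * G)" by (simp add: power2_eq_square algebra_simps)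
    moreover have "2 * nn r + t * G > 0"
    proof -
      have "t * G = - nn r * (G / (G + 1))" by (simp add: t_def)
      moreover have "nn r * (G / (G + 1)) \<le> nn r * 1" using p G by (intro mult_left_mono) auto
      ultimately show ?thesis using p by simp
    qed
    ultimately show False using *[of t] mult_neg_pos[OF t] by (metis not_le)
  qed
  then have "r = (\<lambda>_. 0)" using nn0[OF rW] by fastforce
  then have "(\<Sum>j\<in>S. a k j * w j) = c * w k" if "k \<in> S" for k
    using that unfolding r_def by (metis eq_iff_diff_eq_0)
  then show thesis
    using w that[of w c] by (auto simp: W_def nn_def)
qed

text \<open>Take a maximal orthonormal family of eigenvectors: its size is bounded by Bessel's
  inequality for coordinate vectors, maximality leaves no nonzero vector orthogonal to it, and this
  gives the completeness relation, whose trace forces the size \<open>card S\<close>. The lemma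
  serves both the truncated operator and the Gram matrix of the data.\<close>

lemma symmetric_eigenbasis:
  fixes a :: "'i \<Rightarrow> 'i \<Rightarrow> real"
  assumes S: "finite S" and sym: "\<And>j k. j \<in> S \<Longrightarrow> k \<in> S \<Longrightarrow> a j k = a k j"
  obtains e :: "nat \<Rightarrow> 'i \<Rightarrow> real" and l
  where "\<And>i k. i < card S \<Longrightarrow> k \<notin> S \<Longrightarrow> e i k = 0"
    "\<And>i k. i < card S \<Longrightarrow> k \<in> S \<Longrightarrow> (\<Sum>j\<in>S. a k j * e i j) = l i * e i k"
    "\<And>i j. i < card S \<Longrightarrow> j < card S \<Longrightarrow> (\<Sum>k\<in>S. e i k * e j k) = (if i = j then 1 else 0)"
    "\<And>j k. j \<in> S \<Longrightarrow> k \<in> S \<Longrightarrow> (\<Sum>i<card S. e i j * e i k) = (if j = k then 1 else 0)"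
proof -
  interpret ip_space "{v. \<forall>k. k \<notin> S \<longrightarrow> v k = 0}" "\<lambda>f g. \<Sum>k\<in>S. f k * g k"
    by (rule ip_space_finite[OF S])
  define fam where "fam = (\<lambda>m (e :: nat \<Rightarrow> 'i \<Rightarrow> real) l. orthonormal_on {..<m} e \<and>
     (\<forall>i<m. \<forall>k\<in>S. (\<Sum>j\<in>S. a k j * e i j) = l i * e i k))"
  define \<delta> where "\<delta> = (\<lambda>k j::'i. if j = k then 1 else 0 :: real)"
  have \<delta>: "\<delta> k \<in> {v. \<forall>k. k \<notin> S \<longrightarrow> v k = 0}" "(\<Sum>j\<in>S. \<delta> k j * g j) = g k" if "k \<in> S" for k g
    using that S unfolding \<delta>_def by (auto simp: if_distrib[of "\<lambda>x. x * _"] cong: if_cong)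
  have norm: "(\<Sum>k\<in>S. \<Sum>i<m. (e i k)\<^sup>2) = m" if "fam m e l" for m e l
  proof -
    have "(\<Sum>k\<in>S. \<Sum>i<m. (e i k)\<^sup>2) = (\<Sum>i<m. \<Sum>k\<in>S. (e i k)\<^sup>2)" by (rule sum.swap)
    also have "\<dots> = (\<Sum>i<m. 1)" using that
      by (intro sum.cong) (auto simp: fam_def orthonormal_on_def power2_eq_square)
    finally show ?thesis by simp
  qed
  have bound: "m \<le> card S" if f: "fam m e l" for m e l
  proof -
    have "(\<Sum>k\<in>S. \<Sum>i<m. (e i k)\<^sup>2) \<le> (\<Sum>k\<in>S. 1)"
    proof (rule sum_mono)
      fix k assume k: "k \<in> S"
      show "(\<Sum>i<m. (e i k)\<^sup>2) \<le> 1"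
        using bessel_inequality[of "{..<m}" e "\<delta> k"] f \<delta>[OF k] by (auto simp: fam_def \<delta>_def)
    qed
    then show ?thesis using norm[OF f] by simp
  qed
  have "\<exists>e l. fam 0 e l" by (simp add: fam_def orthonormal_on_def)
  then have "\<exists>m. (\<exists>e l. fam m e l) \<and> (\<forall>m'. (\<exists>e l. fam m' e l) \<longrightarrow> m' \<le> m)"
    using bound by (intro ex_has_greatest_nat[of "\<lambda>m. \<exists>e l. fam m e l" 0 "\<lambda>m. m" "card S + 1"]) fastforce+
  then obtain m e l where f: "fam m e l" and max: "\<And>m' e l. fam m' e l \<Longrightarrow> m' \<le> m" by blast
  have es: "e i k = 0" if "i < m" "k \<notin> S" for i k using f that by (auto simp: fam_def orthonormal_on_def)
  have eig: "(\<Sum>j\<in>S. a k j * e i j) = l i * e i k" if "i < m" "k \<in> S" for i k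
    using f that by (auto simp: fam_def)
  have orth: "(\<Sum>k\<in>S. e i k * e j k) = (if i = j then 1 else 0)" if "i < m" "j < m" for i j
    using f that by (auto simp: fam_def orthonormal_on_def)
  have zero: "v = (\<lambda>_. 0)" if v: "\<And>k. k \<notin> S \<Longrightarrow> v k = 0" "\<And>i. i < m \<Longrightarrow> (\<Sum>k\<in>S. v k * e i k) = 0" for v
  proof (rule ccontr)
    assume "v \<noteq> (\<lambda>_. 0)"
    from symmetric_eigenvector_orthogonal[where a = a and e = e and l = l, OF S sym eig v this]
    obtain w c where w: "\<And>k. k \<notin> S \<Longrightarrow> w k = 0" "\<And>i. i < m \<Longrightarrow> (\<Sum>k\<in>S. w k * e i k) = 0"
      "(\<Sum>k\<in>S. w k * w k) = 1" "\<And>k. k \<in> S \<Longrightarrow> (\<Sum>j\<in>S. a k j * w j) = c * w k" by blast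
    have "(\<Sum>k\<in>S. e i k * w k) = 0" if "i < m" for i using w(2)[OF that] by (simp add: mult.commute)
    then have "fam (Suc m) (e(m := w)) (l(m := c))"
      using w es eig orth unfolding fam_def orthonormal_on_def
      by (auto simp: less_Suc_eq)
    then show False using max by fastforce
  qed
  have complete: "(\<Sum>i<m. e i j * e i k) = (if j = k then 1 else 0)" if jk: "j \<in> S" "k \<in> S" for j k
  proof -
    \<comment> \<open>The part of the coordinate vector at \<open>j\<close> that is orthogonal to
      the family.\<close>
    define g where "g = (\<lambda>x. \<delta> j x - (\<Sum>i<m. e i j * e i x))"
    have "(\<Sum>x\<in>S. g x * e i x) = 0" if "i < m" for i
    proof -
      have "(\<Sum>x\<in>S. g x * e i x) = e i j - (\<Sum>x\<in>S. (\<Sum>i'<m. e i' j * e i' x) * e i x)"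
        unfolding g_def by (simp add: left_diff_distrib sum_subtractf \<delta>(2)[OF jk(1)])
      also have "(\<Sum>x\<in>S. (\<Sum>i'<m. e i' j * e i' x) * e i x) = (\<Sum>i'<m. e i' j * (\<Sum>x\<in>S. e i' x * e i x))"
        by (simp add: sum_distrib_right sum_distrib_left mult.assoc) (rule sum.swap)
      also have "\<dots> = (\<Sum>i'<m. e i' j * (if i' = i then 1 else 0))"
        using orth that by (intro sum.cong) auto
      also have "\<dots> = e i j" using that by (simp add: if_distrib[of "\<lambda>x. _ * x"] cong: if_cong)
      finally show ?thesis by simp
    qed
    then have "g = (\<lambda>_. 0)" using jk es by (intro zero) (auto simp: g_def \<delta>_def)
    then have "g k = 0" by simp
    then show ?thesis unfolding g_def \<delta>_def by (auto split: if_splits)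
  qed
  have "real m = real (card S)"
  proof -
    have "real m = (\<Sum>k\<in>S. \<Sum>i<m. (e i k)\<^sup>2)" using norm[OF f] by simp
    also have "\<dots> = (\<Sum>k\<in>S. 1)" using complete by (intro sum.cong) (auto simp: power2_eq_square)
    finally show ?thesis by simp
  qed
  then have m: "m = card S" by simp
  show thesis using that[of e l] es eig orth complete unfolding m by blast
qed

section \<open>Square-summable sequences and the truncated operator\<close>

definition l2 :: "(int \<Rightarrow> real) set" where
  "l2 = {v. (\<lambda>k. (v k)\<^sup>2) summable_on UNIV}"

definition ip2 :: "(int \<Rightarrow> real) \<Rightarrow> (int \<Rightarrow> real) \<Rightarrow> real" where
  "ip2 f g = (\<Sum>\<^sub>\<infinity>k. f k * g k)"

lemma l2_mult_summable:
  assumes "f \<in> l2" "g \<in> l2"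
  shows "(\<lambda>k. f k * g k) summable_on UNIV"
proof -
  have "(\<lambda>k. (f k)\<^sup>2 + (g k)\<^sup>2) summable_on UNIV"
    using assms by (intro summable_on_add) (auto simp: l2_def)
  then have "(\<lambda>k. norm (f k * g k)) summable_on UNIV"
  proof (rule summable_on_comparison_test)
    fix k
    have "0 \<le> (\<bar>f k\<bar> - \<bar>g k\<bar>)\<^sup>2" by simp
    then have "2 * \<bar>f k * g k\<bar> \<le> (f k)\<^sup>2 + (g k)\<^sup>2"
      by (simp add: power2_diff abs_mult)
    then show "norm (f k * g k) \<le> (f k)\<^sup>2 + (g k)\<^sup>2" by simp
  qed auto
  then show ?thesis by (rule abs_summable_summable)
qed

lemma l2_add:
  assumes "f \<in> l2" "g \<in> l2"
  shows "(\<lambda>k. a * f k + g k) \<in> l2"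
proof -
  have "(\<lambda>k. a\<^sup>2 * (f k)\<^sup>2 + (2 * a) * (f k * g k) + (g k)\<^sup>2) summable_on UNIV"
    using assms l2_mult_summable[OF assms]
    by (intro summable_on_add summable_on_cmult_right) (auto simp: l2_def)
  moreover have "a\<^sup>2 * (f k)\<^sup>2 + (2 * a) * (f k * g k) + (g k)\<^sup>2 = (a * f k + g k)\<^sup>2" for k
    by (simp add: power2_eq_square algebra_simps)
  ultimately show ?thesis by (simp add: l2_def)
qed

interpretation l2: ip_space l2 ip2
proof
  show "(\<lambda>_. 0) \<in> l2" by (simp add: l2_def)
  show "ip2 (\<lambda>x. a * f x + g x) h = a * ip2 f h + ip2 g h"
    if "f \<in> l2" "g \<in> l2" "h \<in> l2" for f g h a
    using l2_mult_summable[OF that(1,3)] l2_mult_summable[OF that(2,3)]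
    unfolding ip2_def
    by (simp add: distrib_right mult.assoc infsum_add summable_on_cmult_right infsum_cmult_right)
  show "ip2 f g = ip2 g f" for f g unfolding ip2_def by (simp add: mult.commute)
  show "0 \<le> ip2 f f" for f unfolding ip2_def by (intro infsum_nonneg) simp
qed (rule l2_add)

lemma l2_reindex:
  assumes "v \<in> l2" "bij h"
  shows "(\<lambda>k. v (h k)) \<in> l2"
  using summable_on_reindex_bij_betw[of h UNIV UNIV "\<lambda>k. (v k)\<^sup>2"] assms by (simp add: l2_def)

lemma ip2_reindex: "bij h \<Longrightarrow> ip2 (\<lambda>k. f (h k)) (\<lambda>k. g (h k)) = ip2 f g"
  unfolding ip2_def by (rule infsum_reindex_bij_betw[of h UNIV UNIV "\<lambda>k. f k * g k"])

lemma bij_int_shift: "bij (\<lambda>k::int. k + c)"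
  by (rule bijI') (auto intro: exI[of _ "_ - c"])

lemma bij_int_uminus: "bij (uminus :: int \<Rightarrow> int)"
  by (rule bijI') (auto intro: exI[of _ "- _"])

lemma l2_square_le_ip2:
  assumes "v \<in> l2"
  shows "(v k)\<^sup>2 \<le> ip2 v v"
proof -
  have "infsum (\<lambda>k. v k * v k) {k} \<le> infsum (\<lambda>k. v k * v k) UNIV"
    using l2_mult_summable[OF assms assms] by (intro infsum_mono_neutral) auto
  then show ?thesis by (simp add: ip2_def power2_eq_square)
qed

lemma ip2_self_zero:
  assumes "v \<in> l2" "ip2 v v = 0"
  shows "v = (\<lambda>_. 0)"
  using l2_square_le_ip2[OF assms(1)] assms(2) by auto

lemma ip2_finite_support:
  assumes "finite S" "\<And>k. k \<notin> S \<Longrightarrow> f k = 0"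
  shows "ip2 f g = (\<Sum>k\<in>S. f k * g k)"
  unfolding ip2_def using assms
  by (subst infsum_cong_neutral[where T = S and g = "\<lambda>k. f k * g k"]) auto

lemma finite_support_l2:
  assumes "finite S" "\<And>k. k \<notin> S \<Longrightarrow> f k = 0"
  shows "f \<in> l2"
proof -
  have "(\<lambda>k. (f k)\<^sup>2) summable_on UNIV \<longleftrightarrow> (\<lambda>k. (f k)\<^sup>2) summable_on S"
    using assms by (intro summable_on_cong_neutral) auto
  then show ?thesis using assms(1) by (simp add: l2_def)
qed

text \<open>\<open>infsum\<close> is a limit along all finite sets, here specialised to growing
  intervals. The offset \<open>c\<close> is 1 for the products \<open>v k * v (k + 1)\<close> of a
  truncation, which live on \<open>[-N, N - 1]\<close>.\<close>

lemma symmetric_intervals_at_top: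
  fixes c :: int
  shows "filterlim (\<lambda>N. {- int N..int N - c}) (finite_subsets_at_top UNIV) sequentially"
  unfolding filterlim_finite_subsets_at_top
proof (intro allI impI)
  fix X :: "int set"
  assume "finite X \<and> X \<subseteq> UNIV"
  then have b: "\<bar>x\<bar> \<le> Max (abs ` X)" if "x \<in> X" for x using that by (intro Max_ge) auto
  show "\<forall>\<^sub>F N in sequentially. finite {- int N..int N - c} \<and> X \<subseteq> {- int N..int N - c} \<and> {- int N..int N - c} \<subseteq> UNIV"
    using eventually_ge_at_top[of "nat (Max (abs ` X) + \<bar>c\<bar>)"]
  proof eventually_elim
    case (elim N)
    then have "\<bar>x\<bar> + \<bar>c\<bar> \<le> int N" if "x \<in> X" for x using b[OF that] by linarith
    then show ?case by fastforce
  qed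
qed

lemma sum_symmetric_intervals_tendsto:
  fixes f :: "int \<Rightarrow> 'a :: {comm_monoid_add, t2_space}"
  assumes "f summable_on UNIV"
  shows "(\<lambda>N. \<Sum>k\<in>{- int N..int N - c}. f k) \<longlonglongrightarrow> infsum f UNIV"
  using filterlim_compose[OF has_sum_infsum[OF assms, unfolded has_sum_def] symmetric_intervals_at_top] .

section \<open>Truncations and the quadratic form\<close>

definition trunc :: "nat \<Rightarrow> (int \<Rightarrow> real) \<Rightarrow> int \<Rightarrow> real" where
  "trunc N v = (\<lambda>k. if k \<in> {- int N..int N} then v k else 0)"

definition H1 :: "(int \<Rightarrow> real) set" where
  "H1 = {v \<in> l2. (\<lambda>k. of_int k * v k) \<in> l2}"

definition energy :: "real \<Rightarrow> (int \<Rightarrow> real) \<Rightarrow> real" where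
  "energy \<alpha> v = (\<Sum>\<^sub>\<infinity>k. \<alpha> * (of_int k * v k)\<^sup>2 + (v (k + 1) - v k)\<^sup>2)"

lemma shift_diff_l2:
  assumes "v \<in> l2"
  shows "(\<lambda>k. v (k + 1) - v k) \<in> l2"
  using l2.diff_mem[OF l2_reindex[OF assms bij_int_shift[of 1]] assms] .

lemma energy_summable:
  assumes "v \<in> H1"
  shows "(\<lambda>k. \<alpha> * (of_int k * v k)\<^sup>2) summable_on UNIV" "(\<lambda>k. (v (k + 1) - v k)\<^sup>2) summable_on UNIV"
    "(\<lambda>k. \<alpha> * (of_int k * v k)\<^sup>2 + (v (k + 1) - v k)\<^sup>2) summable_on UNIV"
proof -
  show 1: "(\<lambda>k. \<alpha> * (of_int k * v k)\<^sup>2) summable_on UNIV" and 2: "(\<lambda>k. (v (k + 1) - v k)\<^sup>2) summable_on UNIV"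
    using assms shift_diff_l2[of v] by (auto simp: H1_def l2_def intro!: summable_on_cmult_right)
  from summable_on_add[OF this]
  show "(\<lambda>k. \<alpha> * (of_int k * v k)\<^sup>2 + (v (k + 1) - v k)\<^sup>2) summable_on UNIV" .
qed

text \<open>Shift invariance of the norm turns the squared differences into
  \<open>2 * ip2 v v\<close> minus twice the correlation of neighbours: the diagonal entry 2 and the
  off-diagonal entries -1 of the operator.\<close>

lemma energy_eq_ip2:
  assumes "v \<in> H1"
  shows "energy \<alpha> v = \<alpha> * ip2 (\<lambda>k. of_int k * v k) (\<lambda>k. of_int k * v k) + 2 * ip2 v v - 2 * ip2 v (\<lambda>k. v (k + 1))"
proof -
  have v: "v \<in> l2" and sv: "(\<lambda>k. v (k + 1)) \<in> l2"
    using assms l2_reindex[OF _ bij_int_shift[of 1]] by (auto simp: H1_def)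
  have "energy \<alpha> v = \<alpha> * ip2 (\<lambda>k. of_int k * v k) (\<lambda>k. of_int k * v k) + ip2 (\<lambda>k. v (k + 1) - v k) (\<lambda>k. v (k + 1) - v k)"
    using energy_summable(1)[OF assms, of \<alpha>] energy_summable(2)[OF assms] energy_summable(1)[OF assms, of 1] unfolding energy_def ip2_def
    by (subst infsum_add) (auto simp: power2_eq_square infsum_cmult_right)
  then show ?thesis
    using ip2_reindex[OF bij_int_shift[of 1], of v v] by (simp add: l2.ip_diff_self[OF sv v] l2.ip_commute[of "\<lambda>k. v (k + 1)" v])
qed

lemma energy_nonneg: "\<alpha> \<ge> 0 \<Longrightarrow> energy \<alpha> v \<ge> 0"
  unfolding energy_def by (intro infsum_nonneg) auto

lemma finite_support_H1:
  assumes "finite S" "\<And>k. k \<notin> S \<Longrightarrow> f k = 0"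
  shows "f \<in> H1"
  unfolding H1_def using finite_support_l2[OF assms(1)] assms(2) by auto

lemma trunc_outside: "k \<notin> {- int N..int N} \<Longrightarrow> trunc N v k = 0"
  by (auto simp: trunc_def)

lemma trunc_mem: "trunc N v \<in> H1" "trunc N v \<in> l2"
  using finite_support_H1[of "{- int N..int N}" "trunc N v"] trunc_outside by (auto simp: H1_def)

text \<open>A truncation may jump at both ends of the window, so its energy is not a partial sum of
  the energy series. After \<open>energy_eq_ip2\<close> it is a combination of three partial sums
  that converge separately.\<close>

lemma energy_trunc_tendsto:
  assumes "v \<in> H1"
  shows "(\<lambda>N. energy \<alpha> (trunc N v)) \<longlonglongrightarrow> energy \<alpha> v"
proof -
  have v: "v \<in> l2" and kv: "(\<lambda>k. of_int k * v k) \<in> l2" and sv: "(\<lambda>k. v (k + 1)) \<in> l2"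
    using assms l2_reindex[OF _ bij_int_shift[of 1]] by (auto simp: H1_def)
  have 1: "ip2 (\<lambda>k. of_int k * trunc N v k) (\<lambda>k. of_int k * trunc N v k)
      = (\<Sum>k\<in>{- int N..int N - 0}. (of_int k * v k) * (of_int k * v k))" for N
    by (subst ip2_finite_support[of "{- int N..int N}"]) (auto simp: trunc_def)
  have 2: "ip2 (trunc N v) (trunc N v) = (\<Sum>k\<in>{- int N..int N - 0}. v k * v k)" for N
    by (subst ip2_finite_support[of "{- int N..int N}"]) (auto simp: trunc_def)
  have 3: "ip2 (trunc N v) (\<lambda>k. trunc N v (k + 1)) = (\<Sum>k\<in>{- int N..int N - 1}. v k * v (k + 1))" for N
    by (subst ip2_finite_support[of "{- int N..int N}"])
      (auto simp: trunc_def intro!: sum.mono_neutral_cong_right)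
  show ?thesis
    unfolding energy_eq_ip2[OF assms] energy_eq_ip2[OF trunc_mem(1)] 1 2 3 unfolding ip2_def
    by (intro tendsto_intros sum_symmetric_intervals_tendsto l2_mult_summable v kv sv)
qed

definition jacobi :: "real \<Rightarrow> (int \<Rightarrow> real) \<Rightarrow> int \<Rightarrow> real" where
  "jacobi \<alpha> v k = (\<alpha> * (of_int k)\<^sup>2 + 2) * v k - v (k - 1) - v (k + 1)"

text \<open>Eigenvectors of the window block, extended by zero. Since the neighbours outside the
  window vanish, the untruncated recurrence \<open>jacobi\<close> reproduces the rows of the
  truncated matrix, including those at both ends.\<close>

definition jacobi_eigen :: "real \<Rightarrow> nat \<Rightarrow> real \<Rightarrow> (int \<Rightarrow> real) \<Rightarrow> bool" where
  "jacobi_eigen \<alpha> N c v \<longleftrightarrow> (\<forall>k. k \<notin> {- int N..int N} \<longrightarrow> v k = 0) \<and>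
     (\<forall>k\<in>{- int N..int N}. jacobi \<alpha> v k = c * v k)"

lemma sum_trunc_B:
  assumes "\<And>k. k \<notin> {- int N..int N} \<Longrightarrow> v k = 0" "j \<in> {- int N..int N}"
  shows "(\<Sum>k\<in>{- int N..int N}. trunc_B \<alpha> N j k * v k) = jacobi \<alpha> v j"
proof -
  have "(\<Sum>k\<in>{- int N..int N}. trunc_B \<alpha> N j k * v k)
      = (\<Sum>k\<in>{j - 1, j, j + 1}. (if j = k then \<alpha> * (of_int k)\<^sup>2 + 2 else - 1) * v k)"
    using assms by (intro sum.mono_neutral_cong) (auto simp: trunc_B_def)
  then show ?thesis by (simp add: jacobi_def)
qed

lemma jacobi_eigen_iff:
  "jacobi_eigen \<alpha> N c v \<longleftrightarrow> (\<forall>k. k \<notin> {- int N..int N} \<longrightarrow> v k = 0) \<and>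
     (\<forall>j\<in>{- int N..int N}. (\<Sum>k\<in>{- int N..int N}. trunc_B \<alpha> N j k * v k) = c * v j)"
  unfolding jacobi_eigen_def using sum_trunc_B[of N v] by auto

lemma jacobi_lincomb: "jacobi \<alpha> (\<lambda>k. a * v k + b * w k) k = a * jacobi \<alpha> v k + b * jacobi \<alpha> w k"
  by (simp add: jacobi_def algebra_simps)

lemma jacobi_eigen_lincomb:
  "jacobi_eigen \<alpha> N c v \<Longrightarrow> jacobi_eigen \<alpha> N c w \<Longrightarrow> jacobi_eigen \<alpha> N c (\<lambda>k. a * v k + b * w k)"
  unfolding jacobi_eigen_def jacobi_lincomb by (auto simp: algebra_simps)

lemma jacobi_eigen_scale: "jacobi_eigen \<alpha> N c v \<Longrightarrow> jacobi_eigen \<alpha> N c (\<lambda>k. a * v k)"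
  using jacobi_eigen_lincomb[of \<alpha> N c v v a 0] by simp

lemma jacobi_eigen_uminus:
  assumes "jacobi_eigen \<alpha> N c v"
  shows "jacobi_eigen \<alpha> N c (\<lambda>k. v (- k))"
proof -
  have "jacobi \<alpha> (\<lambda>k. v (- k)) k = jacobi \<alpha> v (- k)" for k
  proof -
    have "- (k - 1) = - k + 1" "- (k + 1) = - k - 1" by simp_all
    then show ?thesis unfolding jacobi_def by simp
  qed
  then show ?thesis using assms by (auto simp: jacobi_eigen_def)
qed

text \<open>The off-diagonal entries are nonzero, so each row determines the next entry from the two
  before it. Next to the zero entry left of the window, one further zero propagates through the
  window; this is the source of the simple spectrum.\<close>

lemma jacobi_eigen_initial_zero:
  assumes "jacobi_eigen \<alpha> N c v" "v (- int N) = 0"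
  shows "v = (\<lambda>_. 0)"
proof -
  have "n \<le> 2 * N \<longrightarrow> v (int n - int N) = 0 \<and> v (int n - int N - 1) = 0" for n
  proof (induction n)
    case 0
    have "v (- int N - 1) = 0" using assms(1) by (simp add: jacobi_eigen_def)
    then show ?case using assms(2) by simp
  next
    case (Suc n)
    show ?case
    proof
      assume n: "Suc n \<le> 2 * N"
      then have "jacobi \<alpha> v (int n - int N) = c * v (int n - int N)"
        using assms(1) by (simp add: jacobi_eigen_def)
      then show "v (int (Suc n) - int N) = 0 \<and> v (int (Suc n) - int N - 1) = 0"
        using Suc n by (simp add: jacobi_def algebra_simps)
    qed
  qed
  then have "v k = 0" if "k \<in> {- int N..int N}" for k
  proof -
    have "nat (k + int N) \<le> 2 * N" "int (nat (k + int N)) - int N = k" using that by auto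
    then show ?thesis using \<open>\<And>n. n \<le> 2 * N \<longrightarrow> v (int n - int N) = 0 \<and> v (int n - int N - 1) = 0\<close> by metis
  qed
  then show ?thesis using assms(1) by (auto simp: jacobi_eigen_def)
qed

lemma jacobi_eigen_proportional:
  assumes "jacobi_eigen \<alpha> N c v" "jacobi_eigen \<alpha> N c w" "v \<noteq> (\<lambda>_. 0)"
  obtains a where "w = (\<lambda>k. a * v k)"
proof -
  have v: "v (- int N) \<noteq> 0" using assms jacobi_eigen_initial_zero by blast
  define a where "a = w (- int N) / v (- int N)"
  have "(\<lambda>k. 1 * w k + (- a) * v k) = (\<lambda>_. 0)"
    using v by (intro jacobi_eigen_initial_zero[OF jacobi_eigen_lincomb[OF assms(2,1)]]) (simp add: a_def)
  then have "w k = a * v k" for k by (auto dest!: fun_cong[of _ _ k])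
  then show thesis using that by blast
qed

lemma jacobi_symmetric:
  assumes "\<And>k. k \<notin> {- int N..int N} \<Longrightarrow> v k = 0" "\<And>k. k \<notin> {- int N..int N} \<Longrightarrow> w k = 0"
  shows "(\<Sum>k\<in>{- int N..int N}. jacobi \<alpha> v k * w k) = (\<Sum>k\<in>{- int N..int N}. v k * jacobi \<alpha> w k)"
proof -
  let ?S = "{- int N..int N}"
  have "(\<Sum>j\<in>?S. jacobi \<alpha> v j * w j) = (\<Sum>j\<in>?S. \<Sum>k\<in>?S. trunc_B \<alpha> N j k * v k * w j)"
    using sum_trunc_B[OF assms(1), where \<alpha> = \<alpha>] by (intro sum.cong refl) (simp add: sum_distrib_right[symmetric])
  also have "\<dots> = (\<Sum>k\<in>?S. \<Sum>j\<in>?S. trunc_B \<alpha> N j k * v k * w j)" by (rule sum.swap)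
  also have "\<dots> = (\<Sum>k\<in>?S. v k * (\<Sum>j\<in>?S. trunc_B \<alpha> N k j * w j))"
    by (auto simp: sum_distrib_left trunc_B_def abs_minus_commute intro!: sum.cong)
  also have "\<dots> = (\<Sum>k\<in>?S. v k * jacobi \<alpha> w k)"
    using sum_trunc_B[OF assms(2), where \<alpha> = \<alpha>] by (intro sum.cong refl) simp
  finally show ?thesis .
qed

lemma energy_eq_jacobi:
  assumes "\<And>k. k \<notin> {- int N..int N} \<Longrightarrow> v k = 0"
  shows "energy \<alpha> v = (\<Sum>k\<in>{- int N..int N}. v k * jacobi \<alpha> v k)"
proof -
  let ?S = "{- int N..int N}"
  have v: "v \<in> H1" "v \<in> l2" using finite_support_H1[of ?S v] assms by (auto simp: H1_def)
  have vv: "ip2 v g = (\<Sum>k\<in>?S. v k * g k)" for g using assms by (intro ip2_finite_support) auto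
  have "ip2 v (\<lambda>k. v (k - 1)) = ip2 (\<lambda>k. v (k + 1)) v"
    using ip2_reindex[OF bij_int_shift[of 1], of v "\<lambda>k. v (k - 1)"] by simp
  then have "2 * ip2 v (\<lambda>k. v (k + 1)) = ip2 v (\<lambda>k. v (k - 1)) + ip2 v (\<lambda>k. v (k + 1))"
    by (simp add: l2.ip_commute[of "\<lambda>k. v (k + 1)" v])
  moreover have "ip2 (\<lambda>k. of_int k * v k) (\<lambda>k. of_int k * v k) = (\<Sum>k\<in>?S. (of_int k * v k) * (of_int k * v k))"
    using assms by (intro ip2_finite_support) auto
  ultimately show ?thesis
    unfolding energy_eq_ip2[OF v(1)] vv
    by (simp add: jacobi_def algebra_simps sum.distrib sum_subtractf sum_distrib_left power2_eq_square)
qed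

lemma jacobi_eigen_energy:
  assumes "jacobi_eigen \<alpha> N c v"
  shows "energy \<alpha> v = c * ip2 v v"
proof -
  have "ip2 v v = (\<Sum>k\<in>{- int N..int N}. v k * v k)"
    using assms by (intro ip2_finite_support) (auto simp: jacobi_eigen_def)
  moreover have "energy \<alpha> v = (\<Sum>k\<in>{- int N..int N}. v k * jacobi \<alpha> v k)"
    using assms by (intro energy_eq_jacobi) (auto simp: jacobi_eigen_def)
  ultimately show ?thesis using assms by (simp add: jacobi_eigen_def sum_distrib_left ac_simps)
qed

text \<open>Zero energy forces \<open>v k = 0\<close> for \<open>k \<noteq> 0\<close> through the
  factor \<alpha>, and equality of neighbours then gives \<open>v 0 = 0\<close>. The window block is
  thus positive definite, and the zero eigenvalue of the truncated operator comes only from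
  sequences supported outside the window.\<close>

lemma jacobi_eigenvalue_pos:
  assumes "jacobi_eigen \<alpha> N c v" "v \<noteq> (\<lambda>_. 0)" "\<alpha> > 0"
  shows "c > 0"
proof -
  have v: "v \<in> H1" "v \<in> l2"
    using finite_support_H1[of "{- int N..int N}" v] assms(1) by (auto simp: H1_def jacobi_eigen_def)
  have p: "ip2 v v > 0" using ip2_self_zero[OF v(2)] assms(2) l2.ip_nonneg[of v] by force
  have "energy \<alpha> v \<noteq> 0"
  proof
    assume "energy \<alpha> v = 0"
    then have z: "\<alpha> * (of_int k * v k)\<^sup>2 + (v (k + 1) - v k)\<^sup>2 = 0" for k
      using energy_summable(3)[OF v(1), of \<alpha>] assms(3)
      by (intro nonneg_infsum_le_0D[of "\<lambda>k. \<alpha> * (of_int k * v k)\<^sup>2 + (v (k + 1) - v k)\<^sup>2" UNIV]) (auto simp: energy_def)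
    have "v k = 0 \<and> v (k + 1) = v k" if "k \<noteq> 0" for k
      using z[of k] assms(3) that
        add_nonneg_eq_0_iff[of "\<alpha> * (of_int k * v k)\<^sup>2" "(v (k + 1) - v k)\<^sup>2"] by auto
    from this[of "-1"] this have "v k = 0" for k by (cases "k = 0") auto
    then show False using assms(2) by auto
  qed
  then have "c * ip2 v v > 0" using jacobi_eigen_energy[OF assms(1)] energy_nonneg[of \<alpha> v] assms(3) by linarith
  then show ?thesis using p by (simp add: zero_less_mult_iff)
qed

text \<open>Rows outside the window are zero, so a nonzero eigenvalue forces \<open>v\<close> to
  vanish there, which also makes \<open>v\<close> square-summable. Since the matrix is real, real
  and imaginary parts separate.\<close>

lemma B_eigenspace_iff:
  assumes "c \<noteq> 0"
  shows "v \<in> B_eigenspace \<alpha> N c \<longleftrightarrow>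
    jacobi_eigen \<alpha> N c (\<lambda>k. Re (v k)) \<and> jacobi_eigen \<alpha> N c (\<lambda>k. Im (v k))"
proof -
  let ?S = "{- int N..int N}"
  have ap: "apply_trunc_B \<alpha> N v j = (\<Sum>k\<in>?S. of_real (trunc_B \<alpha> N j k) * v k)" for j
    unfolding apply_trunc_B_def
    by (subst infsum_cong_neutral[where T = ?S and g = "\<lambda>k. of_real (trunc_B \<alpha> N j k) * v k"])
      (auto simp: trunc_B_def)
  have z: "trunc_B \<alpha> N j k = 0" if "j \<notin> ?S" for j k using that by (auto simp: trunc_B_def)
  have "apply_trunc_B \<alpha> N v = seq_scale (of_real c) v \<longleftrightarrow>
    (\<forall>j. (\<Sum>k\<in>?S. trunc_B \<alpha> N j k * Re (v k)) = c * Re (v j) \<and> (\<Sum>k\<in>?S. trunc_B \<alpha> N j k * Im (v k)) = c * Im (v j))"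
    by (auto simp: fun_eq_iff ap seq_scale_def complex_eq_iff)
  also have "\<dots> \<longleftrightarrow> jacobi_eigen \<alpha> N c (\<lambda>k. Re (v k)) \<and> jacobi_eigen \<alpha> N c (\<lambda>k. Im (v k))"
    (is "?A \<longleftrightarrow> ?B")
  proof
    assume A: ?A
    have "v j = 0" if "j \<notin> ?S" for j
      using A[rule_format, of j] z[OF that] assms by (simp add: complex_eq_iff)
    then show ?B unfolding jacobi_eigen_iff using A by auto
  next
    assume B: ?B
    show ?A
    proof
      fix j show "(\<Sum>k\<in>?S. trunc_B \<alpha> N j k * Re (v k)) = c * Re (v j) \<and> (\<Sum>k\<in>?S. trunc_B \<alpha> N j k * Im (v k)) = c * Im (v j)"
        using B z[of j] unfolding jacobi_eigen_iff by (cases "j \<in> ?S") auto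
    qed
  qed
  finally have 1: "apply_trunc_B \<alpha> N v = seq_scale (of_real c) v \<longleftrightarrow> ?B" .
  moreover have "v \<in> l2Z" if ?B
  proof -
    have "(\<lambda>k. (cmod (v k))\<^sup>2) summable_on UNIV \<longleftrightarrow> (\<lambda>k. (cmod (v k))\<^sup>2) summable_on ?S"
      using that by (intro summable_on_cong_neutral) (auto simp: jacobi_eigen_def cmod_def)
    then show ?thesis by (simp add: l2Z_def)
  qed
  ultimately show ?thesis by (auto simp: B_eigenspace_def)
qed

text \<open>By the recurrence, real and imaginary part are real multiples \<open>a\<close> and
  \<open>b\<close> of the same \<open>e\<close>, so the eigenvector is \<open>e\<close> times the
  complex number with these parts.\<close>

lemma B_eigenspace_dim:
  assumes "jacobi_eigen \<alpha> N c e" "e \<noteq> (\<lambda>_. 0)" "c \<noteq> 0"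
  shows "seq.dim (B_eigenspace \<alpha> N c) = 1"
proof -
  define e' where "e' = (\<lambda>k. complex_of_real (e k))"
  have "e' \<noteq> 0" using assms(2) by (auto simp: e'_def fun_eq_iff)
  have "B_eigenspace \<alpha> N c = seq.span {e'}"
  proof (intro equalityI subsetI)
    fix v assume "v \<in> B_eigenspace \<alpha> N c"
    then have v: "jacobi_eigen \<alpha> N c (\<lambda>k. Re (v k))" "jacobi_eigen \<alpha> N c (\<lambda>k. Im (v k))"
      using B_eigenspace_iff[OF assms(3)] by auto
    obtain a where a: "(\<lambda>k. Re (v k)) = (\<lambda>k. a * e k)" using jacobi_eigen_proportional[OF assms(1) v(1) assms(2)] by blast
    obtain b where b: "(\<lambda>k. Im (v k)) = (\<lambda>k. b * e k)" using jacobi_eigen_proportional[OF assms(1) v(2) assms(2)] by blast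
    have "v = seq_scale (Complex a b) e'"
      using a b by (auto simp: fun_eq_iff seq_scale_def e'_def complex_eq_iff)
    then show "v \<in> seq.span {e'}" by (auto simp: seq.span_singleton)
  next
    fix v assume "v \<in> seq.span {e'}"
    then obtain z where "v = seq_scale z e'" by (auto simp: seq.span_singleton)
    then show "v \<in> B_eigenspace \<alpha> N c"
      using jacobi_eigen_scale[OF assms(1)] by (simp add: B_eigenspace_iff[OF assms(3)] seq_scale_def e'_def)
  qed
  moreover have "seq.independent {e'}" using \<open>e' \<noteq> 0\<close> by (simp add: seq.dependent_single)
  ultimately show ?thesis using seq.dim_span_eq_card_independent[of "{e'}"] by simp
qed

lemma sorted_eigenvalues_simple:
  assumes "finite C" "\<And>c. c \<in> C \<Longrightarrow> m c = 1"
  shows "sorted_eigenvalues C m = sorted_list_of_set C"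
proof -
  have "(\<Sum>c\<in>C. replicate_mset (m c) c) = mset_set C"
    using assms by (induction C rule: finite_induct) auto
  then show ?thesis by (simp add: sorted_eigenvalues_def)
qed

text \<open>Links the sorted list \<open>B_nonzero_eigenvalues\<close> with an actual eigenbasis.
  Simplicity makes the eigenvalues \<open>l i\<close> of an orthonormal eigenbasis distinct,
  completeness excludes any other nonzero eigenvalue, and multiplicity one turns the list into their
  strictly increasing enumeration.\<close>

lemma jacobi_eigenbasis:
  fixes \<alpha> :: real and N :: nat
  assumes "\<alpha> > 0"
  defines "lam \<equiv> \<lambda>i. B_nonzero_eigenvalues \<alpha> N ! i"
  obtains e where "\<And>i. i < 2 * N + 1 \<Longrightarrow> jacobi_eigen \<alpha> N (lam i) (e i)"
    "\<And>i j. i < j \<Longrightarrow> j < 2 * N + 1 \<Longrightarrow> lam i < lam j"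
    "\<And>i. i < 2 * N + 1 \<Longrightarrow> lam i > 0"
    "\<And>i j. i < 2 * N + 1 \<Longrightarrow> j < 2 * N + 1 \<Longrightarrow> ip2 (e i) (e j) = (if i = j then 1 else 0)"
    "\<And>j k. j \<in> {- int N..int N} \<Longrightarrow> k \<in> {- int N..int N} \<Longrightarrow>
       (\<Sum>i<2 * N + 1. e i j * e i k) = (if j = k then 1 else 0)"
proof -
  let ?S = "{- int N..int N}"
  have card: "card ?S = 2 * N + 1" by simp
  have sym: "trunc_B \<alpha> N j k = trunc_B \<alpha> N k j" for j k
    by (auto simp: trunc_B_def abs_minus_commute)
  obtain e l where e: "\<And>i k. i < 2 * N + 1 \<Longrightarrow> k \<notin> ?S \<Longrightarrow> e i k = 0"
    "\<And>i k. i < 2 * N + 1 \<Longrightarrow> k \<in> ?S \<Longrightarrow> (\<Sum>j\<in>?S. trunc_B \<alpha> N k j * e i j) = l i * e i k"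
    "\<And>i j. i < 2 * N + 1 \<Longrightarrow> j < 2 * N + 1 \<Longrightarrow> (\<Sum>k\<in>?S. e i k * e j k) = (if i = j then 1 else 0)"
    "\<And>j k. j \<in> ?S \<Longrightarrow> k \<in> ?S \<Longrightarrow> (\<Sum>i<2 * N + 1. e i j * e i k) = (if j = k then 1 else 0)"
    using symmetric_eigenbasis[of ?S "trunc_B \<alpha> N", OF _ sym] unfolding card by blast
  have eig: "jacobi_eigen \<alpha> N (l i) (e i)" if "i < 2 * N + 1" for i
    unfolding jacobi_eigen_iff using e that by auto
  have orth: "ip2 (e i) (e j) = (if i = j then 1 else 0)" if "i < 2 * N + 1" "j < 2 * N + 1" for i j
    using e(1,3) that by (subst ip2_finite_support[of ?S]) auto
  have nz: "e i \<noteq> (\<lambda>_. 0)" if "i < 2 * N + 1" for i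
    using orth[OF that that] by (auto simp: ip2_def)
  have pos: "l i > 0" if "i < 2 * N + 1" for i
    using jacobi_eigenvalue_pos[OF eig nz assms(1)] that by blast
  have inj: "inj_on l {..<2 * N + 1}"
  proof (rule inj_onI)
    fix i j assume ij: "i \<in> {..<2 * N + 1}" "j \<in> {..<2 * N + 1}" "l i = l j"
    obtain a where a: "e j = (\<lambda>k. a * e i k)"
      using jacobi_eigen_proportional[of \<alpha> N "l i" "e i" "e j"] eig nz ij by (metis lessThan_iff)
    show "i = j"
    proof (rule ccontr)
      assume "i \<noteq> j"
      then have "ip2 (e j) (e i) = 0" "ip2 (e i) (e i) = 1" using orth ij by auto
      then have "a = 0" unfolding a ip2_def by (simp add: mult.assoc infsum_cmult_right')
      then show False using nz[of j] ij a by auto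
    qed
  qed
  have nz_iff: "(\<exists>v. v \<noteq> 0 \<and> v \<in> B_eigenspace \<alpha> N c) \<longleftrightarrow> (\<exists>w. w \<noteq> (\<lambda>_. 0) \<and> jacobi_eigen \<alpha> N c w)"
    if "c \<noteq> 0" for c
  proof safe
    fix v :: "int \<Rightarrow> complex" assume "v \<noteq> 0" "v \<in> B_eigenspace \<alpha> N c"
    then show "\<exists>w. w \<noteq> (\<lambda>_. 0) \<and> jacobi_eigen \<alpha> N c w"
      by (cases "(\<lambda>k. Re (v k)) = (\<lambda>_. 0)") (auto simp: B_eigenspace_iff[OF that] fun_eq_iff complex_eq_iff)
  next
    fix w assume w: "w \<noteq> (\<lambda>_. 0)" "jacobi_eigen \<alpha> N c w"
    then have "(\<lambda>k. complex_of_real (w k)) \<in> B_eigenspace \<alpha> N c"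
      using jacobi_eigen_scale[OF w(2), of 0] by (simp add: B_eigenspace_iff[OF that])
    moreover have "(\<lambda>k. complex_of_real (w k)) \<noteq> 0" using w(1) by (auto simp: fun_eq_iff)
    ultimately show "\<exists>v. v \<noteq> 0 \<and> v \<in> B_eigenspace \<alpha> N c" by blast
  qed
  have mem: "c \<in> l ` {..<2 * N + 1}" if w: "w \<noteq> (\<lambda>_. 0)" "jacobi_eigen \<alpha> N c w" for c w
  proof (rule ccontr)
    assume c: "c \<notin> l ` {..<2 * N + 1}"
    have w0: "w k = 0" if "k \<notin> ?S" for k using w(2) that by (auto simp: jacobi_eigen_def)
    \<comment> \<open>Eigenvectors for different eigenvalues are orthogonal; completeness then makes
      \<open>w\<close> vanish.\<close>
    have "(\<Sum>k\<in>?S. e i k * w k) = 0" if i: "i < 2 * N + 1" for i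
    proof -
      have "(\<Sum>k\<in>?S. jacobi \<alpha> (e i) k * w k) = (\<Sum>k\<in>?S. e i k * jacobi \<alpha> w k)"
        using e(1)[OF i] w0 by (intro jacobi_symmetric) auto
      moreover have "(\<Sum>k\<in>?S. jacobi \<alpha> (e i) k * w k) = l i * (\<Sum>k\<in>?S. e i k * w k)"
        using eig[OF i] by (simp add: jacobi_eigen_def sum_distrib_left ac_simps)
      moreover have "(\<Sum>k\<in>?S. e i k * jacobi \<alpha> w k) = c * (\<Sum>k\<in>?S. e i k * w k)"
        using w(2) by (simp add: jacobi_eigen_def sum_distrib_left ac_simps)
      ultimately have "(l i - c) * (\<Sum>k\<in>?S. e i k * w k) = 0" by (simp add: left_diff_distrib)
      then show ?thesis using c i by auto
    qed
    then have "(\<Sum>i<2 * N + 1. e i j * (\<Sum>k\<in>?S. e i k * w k)) = 0" for j by simp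
    moreover have "(\<Sum>i<2 * N + 1. e i j * (\<Sum>k\<in>?S. e i k * w k)) = w j" if j: "j \<in> ?S" for j
    proof -
      have "(\<Sum>i<2 * N + 1. e i j * (\<Sum>k\<in>?S. e i k * w k)) = (\<Sum>k\<in>?S. (\<Sum>i<2 * N + 1. e i j * e i k) * w k)"
        unfolding sum_distrib_left sum_distrib_right by (subst sum.swap) (simp add: mult.assoc)
      also have "\<dots> = (\<Sum>k\<in>?S. (if j = k then 1 else 0) * w k)" using e(4)[OF j] by (intro sum.cong) auto
      also have "\<dots> = w j" using j by (simp add: if_distrib[of "\<lambda>x. x * _"] cong: if_cong)
      finally show ?thesis .
    qed
    ultimately have "w j = 0" for j using w0 by (cases "j \<in> ?S") auto
    then show False using w(1) by auto
  qed
  have C: "{c. c \<noteq> 0 \<and> (\<exists>v. v \<noteq> 0 \<and> v \<in> B_eigenspace \<alpha> N c)} = l ` {..<2 * N + 1}" (is "?C = _")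
  proof (intro equalityI subsetI)
    fix c assume "c \<in> ?C" then show "c \<in> l ` {..<2 * N + 1}" using nz_iff mem by auto
  next
    fix c assume "c \<in> l ` {..<2 * N + 1}"
    then obtain i where i: "i < 2 * N + 1" "c = l i" by auto
    moreover have "c \<noteq> 0" using pos[OF i(1)] i by simp
    ultimately show "c \<in> ?C" using nz_iff[of c] nz[OF i(1)] eig[OF i(1)] by blast
  qed
  have B: "B_nonzero_eigenvalues \<alpha> N = sorted_list_of_set (l ` {..<2 * N + 1})"
    unfolding B_nonzero_eigenvalues_def C
  proof (rule sorted_eigenvalues_simple)
    fix c assume "c \<in> l ` {..<2 * N + 1}"
    then obtain i where i: "i < 2 * N + 1" "c = l i" by auto
    show "seq.dim (B_eigenspace \<alpha> N c) = 1"
      using B_eigenspace_dim[OF eig nz] pos[OF i(1)] i by auto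
  qed simp
  have len: "length (sorted_list_of_set (l ` {..<2 * N + 1})) = 2 * N + 1"
    using inj by (simp add: card_image)
  have lam_mem: "lam i \<in> l ` {..<2 * N + 1}" if "i < 2 * N + 1" for i
    using nth_mem[of i "sorted_list_of_set (l ` {..<2 * N + 1})"] len that unfolding lam_def B by simp
  have lam_less: "lam i < lam j" if "i < j" "j < 2 * N + 1" for i j
    unfolding lam_def B using that len
    by (intro sorted_wrt_nth_less[OF strict_sorted_list_of_set]) auto
  \<comment> \<open>The permutation that brings the eigenbasis, obtained in arbitrary order, into
    the order of the list.\<close>
  define p where "p = (\<lambda>i. inv_into {..<2 * N + 1} l (lam i))"
  have p: "p i < 2 * N + 1" "l (p i) = lam i" if "i < 2 * N + 1" for i
    using inv_into_into[OF lam_mem[OF that]] f_inv_into_f[OF lam_mem[OF that]] by (auto simp: p_def)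
  have p_inj: "inj_on p {..<2 * N + 1}"
  proof (rule inj_onI)
    fix i j assume ij: "i \<in> {..<2 * N + 1}" "j \<in> {..<2 * N + 1}" "p i = p j"
    then have "lam i = lam j" using p(2)[of i] p(2)[of j] by simp
    then show "i = j" using lam_less[of i j] lam_less[of j i] ij by (cases i j rule: linorder_cases) auto
  qed
  have p_im: "p ` {..<2 * N + 1} = {..<2 * N + 1}"
    using p(1) card_image[OF p_inj] by (intro card_subset_eq) auto
  show thesis
  proof (rule that[of "\<lambda>i. e (p i)"])
    show "jacobi_eigen \<alpha> N (lam i) (e (p i))" if "i < 2 * N + 1" for i
      using eig[OF p(1)[OF that]] p(2)[OF that] by simp
    show "lam i > 0" if "i < 2 * N + 1" for i using lam_mem[OF that] pos by auto
    show "ip2 (e (p i)) (e (p j)) = (if i = j then 1 else 0)" if "i < 2 * N + 1" "j < 2 * N + 1" for i j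
      using orth[OF p(1)[OF that(1)] p(1)[OF that(2)]] inj_onD[OF p_inj, of i j] that by auto
    show "(\<Sum>i<2 * N + 1. e (p i) j * e (p i) k) = (if j = k then 1 else 0)" if "j \<in> ?S" "k \<in> ?S" for j k
      using e(4)[OF that] sum.reindex[OF p_inj, of "\<lambda>i. e i j * e i k"] p_im by simp
  qed (use lam_less in auto)
qed

section \<open>Ky Fan's inequality\<close>

text \<open>Compactness of the embedding of \<open>H1\<close> into \<open>l2\<close>: the bound on
  \<open>of_int k * d n k\<close> leaves at most \<open>M / K^2\<close> of the mass outside
  \<open>[-K, K]\<close>, and inside only finitely many coordinates have to converge.\<close>

lemma l2_tendsto_zero:
  assumes "\<And>n. d n \<in> H1" "\<And>n. ip2 (\<lambda>k. of_int k * d n k) (\<lambda>k. of_int k * d n k) \<le> M"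
    and "\<And>k. (\<lambda>n. d n k) \<longlonglongrightarrow> 0"
  shows "(\<lambda>n. ip2 (d n) (d n)) \<longlonglongrightarrow> 0"
proof (rule LIMSEQ_I)
  fix r :: real assume r: "r > 0"
  have "0 \<le> M" using assms(2)[of 0] l2.ip_nonneg order_trans by blast
  \<comment> \<open>Makes \<open>M / K\<close> at most \<open>r / 2\<close>; the added 1 ensures
    \<open>K \<ge> 1\<close>, so that \<open>M / K^2\<close> is no larger.\<close>
  define K where "K = nat \<lceil>2 * M / r\<rceil> + 1"
  have K: "real K > 0" "2 * M / r \<le> real K" unfolding K_def by linarith+
  have split: "ip2 (d n) (d n) \<le> (\<Sum>k\<in>{- int K..int K}. (d n k)\<^sup>2) + M / (real K)\<^sup>2" for n
  proof -
    have m: "d n \<in> l2" "(\<lambda>k. of_int k * d n k) \<in> l2" using assms(1)[of n] by (auto simp: H1_def)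
    have t: "(\<lambda>k. trunc K (d n) k * trunc K (d n) k) summable_on UNIV"
      by (intro l2_mult_summable trunc_mem)
    have *: "(\<lambda>k. 1 / (real K)\<^sup>2 * (of_int k * d n k * (of_int k * d n k))) summable_on UNIV"
      by (intro summable_on_cmult_right l2_mult_summable m)
    have "ip2 (d n) (d n) \<le> ip2 (trunc K (d n)) (trunc K (d n))
        + 1 / (real K)\<^sup>2 * ip2 (\<lambda>k. of_int k * d n k) (\<lambda>k. of_int k * d n k)"
      unfolding ip2_def infsum_cmult_right'[symmetric] infsum_add[OF t *, symmetric]
    proof -
      show "(\<Sum>\<^sub>\<infinity>k. d n k * d n k) \<le> (\<Sum>\<^sub>\<infinity>k. trunc K (d n) k * trunc K (d n) k
          + 1 / (real K)\<^sup>2 * (of_int k * d n k * (of_int k * d n k)))"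
      proof (intro infsum_mono summable_on_add * l2_mult_summable trunc_mem m)
        fix k :: int
        show "d n k * d n k \<le> trunc K (d n) k * trunc K (d n) k + 1 / (real K)\<^sup>2 * (of_int k * d n k * (of_int k * d n k))"
        proof (cases "k \<in> {- int K..int K}")
          case True
          then show ?thesis by (auto simp: trunc_def)
        next
          case False
          then have "int K \<le> \<bar>k\<bar>" by auto
          then have "real K \<le> \<bar>real_of_int k\<bar>" by linarith
          then have "(real K)\<^sup>2 \<le> (real_of_int k)\<^sup>2" using K by (metis abs_of_pos abs_le_square_iff)
          then have "1 * (d n k)\<^sup>2 \<le> ((real_of_int k)\<^sup>2 / (real K)\<^sup>2) * (d n k)\<^sup>2"
            using K by (intro mult_right_mono) auto
          then show ?thesis unfolding trunc_outside[OF False] by (simp add: power2_eq_square field_simps)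
        qed
      qed
    qed
    also have "ip2 (trunc K (d n)) (trunc K (d n)) = (\<Sum>k\<in>{- int K..int K}. (d n k)\<^sup>2)"
      by (subst ip2_finite_support[of "{- int K..int K}"]) (auto simp: trunc_def power2_eq_square)
    also have "1 / (real K)\<^sup>2 * ip2 (\<lambda>k. of_int k * d n k) (\<lambda>k. of_int k * d n k) \<le> 1 / (real K)\<^sup>2 * M"
      by (intro mult_left_mono assms(2)) auto
    finally show ?thesis by simp
  qed
  have "M / (real K)\<^sup>2 \<le> M / real K"
  proof -
    have "real K \<ge> 1" by (simp add: K_def)
    then have "real K \<le> (real K)\<^sup>2" by (simp add: power2_eq_square)
    then show ?thesis using \<open>0 \<le> M\<close> K by (intro divide_left_mono) auto
  qed
  also have "M / real K \<le> r / 2" using K r by (simp add: field_simps)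
  finally have tail: "M / (real K)\<^sup>2 \<le> r / 2" .
  have "(\<lambda>n. \<Sum>k\<in>{- int K..int K}. (d n k)\<^sup>2) \<longlonglongrightarrow> (\<Sum>k\<in>{- int K..int K}. 0\<^sup>2)"
    by (intro tendsto_intros assms(3))
  then have "\<forall>\<^sub>F n in sequentially. (\<Sum>k\<in>{- int K..int K}. (d n k)\<^sup>2) < r / 2"
    using r by (intro order_tendstoD(2)[where a = "r / 2"]) auto
  then obtain n0 where n0: "\<And>n. n \<ge> n0 \<Longrightarrow> (\<Sum>k\<in>{- int K..int K}. (d n k)\<^sup>2) < r / 2"
    by (auto simp: eventually_sequentially)
  have "norm (ip2 (d n) (d n) - 0) < r" if "n \<ge> n0" for n
    unfolding real_norm_def diff_zero abs_of_nonneg[OF l2.ip_nonneg]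
    using split[of n] tail n0[OF that] by linarith
  then show "\<exists>n0. \<forall>n\<ge>n0. norm (ip2 (d n) (d n) - 0) < r" by blast
qed

text \<open>The sums of squares over \<open>[-N, N]\<close> and \<open>[-N, N - 1]\<close> have the
  same limit and differ by the square of \<open>v N\<close>.\<close>

lemma l2_at_infinity:
  assumes "v \<in> l2"
  shows "(\<lambda>n. v (int n)) \<longlonglongrightarrow> 0"
proof -
  have s: "(\<lambda>k. (v k)\<^sup>2) summable_on UNIV" using assms by (simp add: l2_def)
  have "(\<lambda>N. (\<Sum>k\<in>{- int N..int N - 0}. (v k)\<^sup>2) - (\<Sum>k\<in>{- int N..int N - 1}. (v k)\<^sup>2)) \<longlonglongrightarrow> 0"
    using tendsto_diff[OF sum_symmetric_intervals_tendsto[OF s, of 0] sum_symmetric_intervals_tendsto[OF s, of 1]] by simp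
  moreover have "(\<Sum>k\<in>{- int N..int N - 0}. (v k)\<^sup>2) - (\<Sum>k\<in>{- int N..int N - 1}. (v k)\<^sup>2) = (v (int N))\<^sup>2" for N
  proof -
    have "{- int N..int N - 0} = insert (int N) {- int N..int N - 1}" by auto
    then show ?thesis by simp
  qed
  ultimately show ?thesis by simp
qed

text \<open>Coercivity: a bound on the energy is a bound on the weighted norm, which is what makes
  tails uniformly small.\<close>

lemma l2_energy_bound:
  assumes "v \<in> H1" "\<alpha> > 0"
  shows "\<alpha> * ip2 (\<lambda>k. of_int k * v k) (\<lambda>k. of_int k * v k) \<le> energy \<alpha> v"
proof -
  have "(\<Sum>\<^sub>\<infinity>k. \<alpha> * (of_int k * v k)\<^sup>2) \<le> energy \<alpha> v"
    unfolding energy_def using energy_summable[OF assms(1)] by (intro infsum_mono) auto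
  moreover have "(\<Sum>\<^sub>\<infinity>k. \<alpha> * (of_int k * v k)\<^sup>2) = \<alpha> * ip2 (\<lambda>k. of_int k * v k) (\<lambda>k. of_int k * v k)"
    unfolding ip2_def using energy_summable(1)[OF assms(1), of 1]
    by (simp add: infsum_cmult_right power2_eq_square)
  ultimately show ?thesis by simp
qed

lemma energy_scale: "energy \<alpha> (\<lambda>k. c * v k) = c\<^sup>2 * energy \<alpha> v"
proof -
  have "\<alpha> * (of_int k * (c * v k))\<^sup>2 + (c * v (k + 1) - c * v k)\<^sup>2
      = c\<^sup>2 * (\<alpha> * (of_int k * v k)\<^sup>2 + (v (k + 1) - v k)\<^sup>2)" for k
    by (simp add: power2_eq_square algebra_simps)
  then show ?thesis by (simp add: energy_def infsum_cmult_right')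
qed

section \<open>Coordinates in the eigenbasis of a truncation\<close>

abbreviation lam :: "real \<Rightarrow> nat \<Rightarrow> nat \<Rightarrow> real" where
  "lam \<alpha> N i \<equiv> B_nonzero_eigenvalues \<alpha> N ! i"

definition eigenbasis :: "real \<Rightarrow> nat \<Rightarrow> (nat \<Rightarrow> int \<Rightarrow> real) \<Rightarrow> bool" where
  "eigenbasis \<alpha> N e \<longleftrightarrow> (\<forall>i<2 * N + 1. jacobi_eigen \<alpha> N (lam \<alpha> N i) (e i)) \<and>
     (\<forall>i<2 * N + 1. \<forall>j<2 * N + 1. ip2 (e i) (e j) = (if i = j then 1 else 0)) \<and>
     (\<forall>j\<in>{- int N..int N}. \<forall>k\<in>{- int N..int N}. (\<Sum>i<2 * N + 1. e i j * e i k) = (if j = k then 1 else 0))"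

lemma lam_less: "\<alpha> > 0 \<Longrightarrow> i < j \<Longrightarrow> j < 2 * N + 1 \<Longrightarrow> lam \<alpha> N i < lam \<alpha> N j"
  using jacobi_eigenbasis[of \<alpha> N] by blast

lemma lam_pos: "\<alpha> > 0 \<Longrightarrow> i < 2 * N + 1 \<Longrightarrow> 0 < lam \<alpha> N i"
  using jacobi_eigenbasis[of \<alpha> N] by blast

lemma lam_le: "\<alpha> > 0 \<Longrightarrow> i \<le> j \<Longrightarrow> j < 2 * N + 1 \<Longrightarrow> lam \<alpha> N i \<le> lam \<alpha> N j"
  using lam_less[of \<alpha> i j N] by (cases "i = j") auto

context
  fixes \<alpha> :: real and N :: nat and e :: "nat \<Rightarrow> int \<Rightarrow> real"
  assumes \<alpha>: "\<alpha> > 0" and e: "eigenbasis \<alpha> N e"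
begin

lemma eigenbasis_outside: "i < 2 * N + 1 \<Longrightarrow> k \<notin> {- int N..int N} \<Longrightarrow> e i k = 0"
  using e by (auto simp: eigenbasis_def jacobi_eigen_def)

lemma eigenbasis_mem: "i < 2 * N + 1 \<Longrightarrow> e i \<in> H1" "i < 2 * N + 1 \<Longrightarrow> e i \<in> l2"
  using finite_support_H1[of "{- int N..int N}" "e i"] eigenbasis_outside by (auto simp: H1_def)

lemma eigenbasis_orthonormal: "m \<le> 2 * N + 1 \<Longrightarrow> l2.orthonormal_on {..<m} e"
  using e eigenbasis_mem by (auto simp: l2.orthonormal_on_def eigenbasis_def)

lemma eigenbasis_energy: "i < 2 * N + 1 \<Longrightarrow> energy \<alpha> (e i) = lam \<alpha> N i"
  using e jacobi_eigen_energy by (auto simp: eigenbasis_def)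

lemma ip2_eigenbasis: "i < 2 * N + 1 \<Longrightarrow> ip2 (e i) v = (\<Sum>k\<in>{- int N..int N}. e i k * v k)"
  using eigenbasis_outside by (intro ip2_finite_support) auto

lemma trunc_expansion: "trunc N v = (\<lambda>k. \<Sum>i<2 * N + 1. ip2 (e i) v * e i k)"
proof
  fix k
  show "trunc N v k = (\<Sum>i<2 * N + 1. ip2 (e i) v * e i k)"
  proof (cases "k \<in> {- int N..int N}")
    case True
    have "(\<Sum>i<2 * N + 1. ip2 (e i) v * e i k) = (\<Sum>i<2 * N + 1. \<Sum>j\<in>{- int N..int N}. e i j * v j * e i k)"
      by (intro sum.cong) (auto simp: ip2_eigenbasis sum_distrib_right)
    also have "\<dots> = (\<Sum>j\<in>{- int N..int N}. v j * (\<Sum>i<2 * N + 1. e i j * e i k))"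
      by (subst sum.swap) (simp add: sum_distrib_left ac_simps del: sum.lessThan_Suc)
    also have "\<dots> = (\<Sum>j\<in>{- int N..int N}. v j * (if j = k then 1 else 0))"
      using e True by (intro sum.cong) (auto simp: eigenbasis_def)
    also have "\<dots> = v k" using True by (simp add: if_distrib[of "\<lambda>x. _ * x"] cong: if_cong)
    finally show ?thesis using True by (simp add: trunc_def)
  qed (auto simp: trunc_outside eigenbasis_outside)
qed

lemma trunc_norm: "ip2 (trunc N v) (trunc N v) = (\<Sum>i<2 * N + 1. (ip2 (e i) v)\<^sup>2)"
  unfolding trunc_expansion
  using l2.orthonormal_combination[OF _ eigenbasis_orthonormal[OF order_refl]] by (simp add: power2_eq_square)

lemma trunc_energy: "energy \<alpha> (trunc N v) = (\<Sum>i<2 * N + 1. lam \<alpha> N i * (ip2 (e i) v)\<^sup>2)"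
proof -
  let ?S = "{- int N..int N}"
  let ?t = "trunc N v"
  have j: "jacobi \<alpha> ?t k = (\<Sum>i<2 * N + 1. ip2 (e i) v * (lam \<alpha> N i * e i k))" if "k \<in> ?S" for k
  proof -
    have "jacobi \<alpha> ?t k = (\<Sum>i<2 * N + 1. ip2 (e i) v * jacobi \<alpha> (e i) k)"
      unfolding jacobi_def trunc_expansion
      by (simp only: sum_distrib_left sum_subtractf[symmetric] right_diff_distrib mult.left_commute)
    also have "\<dots> = (\<Sum>i<2 * N + 1. ip2 (e i) v * (lam \<alpha> N i * e i k))"
      using e that by (intro sum.cong) (auto simp: eigenbasis_def jacobi_eigen_def)
    finally show ?thesis .
  qed
  have "energy \<alpha> ?t = (\<Sum>k\<in>?S. ?t k * (\<Sum>i<2 * N + 1. ip2 (e i) v * (lam \<alpha> N i * e i k)))"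
    using energy_eq_jacobi[of N ?t \<alpha>] j by (simp add: trunc_outside)
  also have "\<dots> = (\<Sum>k\<in>?S. v k * (\<Sum>i<2 * N + 1. ip2 (e i) v * (lam \<alpha> N i * e i k)))"
    by (intro sum.cong) (auto simp: trunc_def)
  also have "\<dots> = (\<Sum>i<2 * N + 1. lam \<alpha> N i * ip2 (e i) v * (\<Sum>k\<in>?S. e i k * v k))"
    unfolding sum_distrib_left by (subst sum.swap) (simp add: ac_simps)
  also have "\<dots> = (\<Sum>i<2 * N + 1. lam \<alpha> N i * (ip2 (e i) v)\<^sup>2)"
    by (intro sum.cong) (auto simp: ip2_eigenbasis power2_eq_square)
  finally show ?thesis .
qed

text \<open>Let \<open>w i\<close> be the total squared weight of the \<open>v j\<close> on
  \<open>e i\<close>; it lies between 0 and 1, and the total energy is the sum of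
  \<open>lam \<alpha> N i * w i\<close>. Measuring all eigenvalues from the pivot
  \<open>lam \<alpha> N m\<close> writes the right-hand side as the sum of
  \<open>(lam \<alpha> N i - lam \<alpha> N m) * w i\<close> over \<open>i > m\<close> plus the sum
  of \<open>(lam \<alpha> N m - lam \<alpha> N i) * (1 - w i)\<close> over \<open>i \<le> m\<close>.
  The second sum is nonnegative, and the first is at least the gap times \<open>D\<close>, the
  weight above \<open>m\<close>. The mass term with factor \<open>lam \<alpha> N m\<close>
  compensates for truncated vectors being shorter than unit vectors.\<close>

lemma fan_inequality:
  assumes v: "l2.orthonormal_on {..<Suc m} v" and m: "Suc m < 2 * N + 1"
  defines "D \<equiv> (\<Sum>j<Suc m. ip2 (trunc N (v j)) (trunc N (v j)) - (\<Sum>i<Suc m. (ip2 (e i) (v j))\<^sup>2))"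
  shows "(lam \<alpha> N (Suc m) - lam \<alpha> N m) * D
      \<le> (\<Sum>j<Suc m. energy \<alpha> (trunc N (v j))) - (\<Sum>i<Suc m. lam \<alpha> N i)
         + lam \<alpha> N m * (\<Sum>j<Suc m. 1 - ip2 (trunc N (v j)) (trunc N (v j)))"
    and "D \<ge> 0"
proof -
  let ?l = "lam \<alpha> N"
  let ?M = "{..<2 * N + 1}"
  define w where "w = (\<lambda>i. \<Sum>j<Suc m. (ip2 (e i) (v j))\<^sup>2)"
  have w1: "w i \<le> 1" if "i < 2 * N + 1" for i
  proof -
    have "w i \<le> ip2 (e i) (e i)"
      unfolding w_def using l2.bessel_inequality[OF _ v eigenbasis_mem(2)[OF that]] by simp
    then show ?thesis using e that by (simp add: eigenbasis_def)
  qed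
  have w0: "w i \<ge> 0" for i unfolding w_def by (intro sum_nonneg) auto
  have split: "(\<Sum>i\<in>?M. f i) = (\<Sum>i<Suc m. f i) + (\<Sum>i\<in>{Suc m..<2 * N + 1}. f i)" for f :: "nat \<Rightarrow> real"
    using sum.atLeastLessThan_concat[of 0 "Suc m" "2 * N + 1" f] m by (simp add: atLeast0LessThan)
  have n: "(\<Sum>j<Suc m. ip2 (trunc N (v j)) (trunc N (v j))) = (\<Sum>i\<in>?M. w i)"
    unfolding w_def trunc_norm by (rule sum.swap)
  have E: "(\<Sum>j<Suc m. energy \<alpha> (trunc N (v j))) = (\<Sum>i\<in>?M. ?l i * w i)"
    unfolding w_def trunc_energy sum_distrib_left by (rule sum.swap)
  have "(\<Sum>j<Suc m. \<Sum>i<Suc m. (ip2 (e i) (v j))\<^sup>2) = (\<Sum>i<Suc m. w i)"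
    unfolding w_def by (rule sum.swap)
  then have D: "D = (\<Sum>i\<in>{Suc m..<2 * N + 1}. w i)"
    unfolding D_def sum_subtractf n split by simp
  then show "D \<ge> 0" using w0 by (simp add: sum_nonneg)
  have "(?l (Suc m) - ?l m) * D \<le> (\<Sum>i\<in>{Suc m..<2 * N + 1}. (?l i - ?l m) * w i)"
    unfolding D sum_distrib_left
    using w0 lam_le[OF \<alpha>, of "Suc m" _ N] by (intro sum_mono mult_right_mono) auto
  also have "\<dots> \<le> (\<Sum>i\<in>{Suc m..<2 * N + 1}. (?l i - ?l m) * w i) + (\<Sum>i<Suc m. (?l m - ?l i) * (1 - w i))"
  proof -
    have "0 \<le> (?l m - ?l i) * (1 - w i)" if "i < Suc m" for i
      using w1[of i] lam_le[OF \<alpha>, of i m N] that m by (intro mult_nonneg_nonneg) auto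
    then have "0 \<le> (\<Sum>i<Suc m. (?l m - ?l i) * (1 - w i))" by (intro sum_nonneg) auto
    then show ?thesis by simp
  qed
  also have "\<dots> = (\<Sum>i\<in>?M. ?l i * w i) - (\<Sum>i<Suc m. ?l i) + ?l m * (Suc m - (\<Sum>i\<in>?M. w i))"
    unfolding split
    by (simp add: algebra_simps sum.distrib sum_subtractf sum_distrib_left sum_distrib_right del: sum.lessThan_Suc)
  finally show "(?l (Suc m) - ?l m) * D \<le> (\<Sum>j<Suc m. energy \<alpha> (trunc N (v j))) - (\<Sum>i<Suc m. ?l i)
         + ?l m * (\<Sum>j<Suc m. 1 - ip2 (trunc N (v j)) (trunc N (v j)))"
    unfolding sum_subtractf n E by simp
qed

end

lemma eigenbasis_ex:
  assumes "\<alpha> > 0"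
  shows "\<exists>e. eigenbasis \<alpha> N e"
  by (rule jacobi_eigenbasis[OF assms, of N]) (auto simp: eigenbasis_def intro!: exI)

text \<open>The first \<open>m\<close> eigenvectors of one truncation serve as test family for the
  next. They are unchanged by the larger window, so the mass correction in Ky Fan's bound is
  zero.\<close>

lemma eigenvalue_sum_antimono:
  assumes \<alpha>: "\<alpha> > 0" and m: "m \<le> N"
  shows "(\<Sum>i<m. lam \<alpha> (Suc N) i) \<le> (\<Sum>i<m. lam \<alpha> N i)"
proof (cases m)
  case (Suc m')
  obtain e where e: "eigenbasis \<alpha> N e" using eigenbasis_ex[OF \<alpha>] by blast
  obtain e' where e': "eigenbasis \<alpha> (Suc N) e'" using eigenbasis_ex[OF \<alpha>] by blast
  have t: "trunc (Suc N) (e j) = e j" if "j < m" for j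
    using eigenbasis_outside[OF \<alpha> e, of j] that m by (fastforce simp: trunc_def)
  have o: "l2.orthonormal_on {..<Suc m'} e"
    using eigenbasis_orthonormal[OF \<alpha> e, of m] m Suc by simp
  have n: "ip2 (e j) (e j) = 1" if "j < m" for j
    using e that m by (simp add: eigenbasis_def)
  have E: "(\<Sum>j<m. energy \<alpha> (e j)) = (\<Sum>i<m. lam \<alpha> N i)"
    using m by (intro sum.cong) (auto simp: eigenbasis_energy[OF \<alpha> e])
  have "0 \<le> (\<Sum>j<m. energy \<alpha> (trunc (Suc N) (e j))) - (\<Sum>i<m. lam \<alpha> (Suc N) i)
         + lam \<alpha> (Suc N) m' * (\<Sum>j<m. 1 - ip2 (trunc (Suc N) (e j)) (trunc (Suc N) (e j)))"
  proof -
    have lt: "Suc m' < 2 * Suc N + 1" using m Suc by simp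
    show ?thesis
      unfolding Suc using lam_le[OF \<alpha> _ lt, of m']
      by (intro order_trans[OF mult_nonneg_nonneg fan_inequality(1)[OF \<alpha> e' o lt]] fan_inequality(2)[OF \<alpha> e' o lt]) simp
  qed
  also have "\<dots> = (\<Sum>i<m. lam \<alpha> N i) - (\<Sum>i<m. lam \<alpha> (Suc N) i)"
    unfolding E[symmetric] using t n by simp
  finally show ?thesis by simp
qed simp

text \<open>A single eigenvalue is the difference of two consecutive partial sums. Each partial sum
  is decreasing and nonnegative once \<open>N \<ge> m\<close>, where all its indices are valid
  positions of the list.\<close>

lemma lam_convergent:
  assumes \<alpha>: "\<alpha> > 0"
  shows "convergent (\<lambda>N. lam \<alpha> N i)"
proof -
  have S: "convergent (\<lambda>N. \<Sum>i<m. lam \<alpha> N i)" for m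
  proof -
    have "decseq (\<lambda>n. \<Sum>i<m. lam \<alpha> (n + m) i)"
      using eigenvalue_sum_antimono[OF \<alpha>, of m] by (intro decseq_SucI) simp
    moreover have "0 \<le> (\<Sum>i<m. lam \<alpha> (n + m) i)" for n
      using lam_pos[OF \<alpha>, of _ "n + m"] by (intro sum_nonneg) (simp add: less_imp_le)
    ultimately have "convergent (\<lambda>n. \<Sum>i<m. lam \<alpha> (n + m) i)"
      by (intro Bseq_monoseq_convergent decseq_imp_monoseq decseq_bounded[where B = 0]) auto
    then show ?thesis using convergent_ignore_initial_segment[of "\<lambda>N. \<Sum>i<m. lam \<alpha> N i" m] by simp
  qed
  have "convergent (\<lambda>N. (\<Sum>i<Suc i. lam \<alpha> N i) - (\<Sum>i<i. lam \<alpha> N i))"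
    by (intro convergent_diff S)
  then show ?thesis by simp
qed

section \<open>Limits of the truncated eigenvectors\<close>

lemma trunc_norm_tendsto:
  assumes "v \<in> l2"
  shows "(\<lambda>N. ip2 (trunc N v) (trunc N v)) \<longlonglongrightarrow> ip2 v v"
proof -
  have "ip2 (trunc N v) (trunc N v) = (\<Sum>k\<in>{- int N..int N - 0}. v k * v k)" for N
    by (subst ip2_finite_support[of "{- int N..int N}"]) (auto simp: trunc_def)
  then show ?thesis
    unfolding ip2_def using sum_symmetric_intervals_tendsto[OF l2_mult_summable[OF assms assms], of 0] by simp
qed

text \<open>As \<open>N\<close> grows the truncated vectors regain unit mass, so the remainder
  \<open>R\<close> tends to the excess energy. If the excess is zero, the defect is squeezed to zero
  by \<open>R\<close> divided by the gap; the strict inequality \<open>L m < L (Suc m)\<close> keeps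
  this quotient under control.\<close>

lemma fan_limit:
  assumes \<alpha>: "\<alpha> > 0" and e: "\<And>N. eigenbasis \<alpha> N (e N)"
    and L: "\<And>i. (\<lambda>N. lam \<alpha> N i) \<longlonglongrightarrow> L i" and gap: "L m < L (Suc m)"
    and v: "l2.orthonormal_on {..<Suc m} v" "\<And>j. j < Suc m \<Longrightarrow> v j \<in> H1"
  shows "(\<Sum>i<Suc m. L i) \<le> (\<Sum>j<Suc m. energy \<alpha> (v j))"
    and "(\<Sum>j<Suc m. energy \<alpha> (v j)) = (\<Sum>i<Suc m. L i) \<Longrightarrow>
      (\<lambda>N. \<Sum>j<Suc m. \<Sum>i<Suc m. (ip2 (e N i) (v j))\<^sup>2) \<longlonglongrightarrow> Suc m"
proof -
  define n where "n = (\<lambda>N j. ip2 (trunc N (v j)) (trunc N (v j)))"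
  define D where "D = (\<lambda>N. \<Sum>j<Suc m. n N j - (\<Sum>i<Suc m. (ip2 (e N i) (v j))\<^sup>2))"
  define R where "R = (\<lambda>N. (\<Sum>j<Suc m. energy \<alpha> (trunc N (v j))) - (\<Sum>i<Suc m. lam \<alpha> N i)
         + lam \<alpha> N m * (\<Sum>j<Suc m. 1 - n N j))"
  have n: "(\<lambda>N. n N j) \<longlonglongrightarrow> 1" if "j < Suc m" for j
    using trunc_norm_tendsto[of "v j"] v(1) that by (simp add: n_def l2.orthonormal_on_def)
  have "R \<longlonglongrightarrow> (\<Sum>j<Suc m. energy \<alpha> (v j)) - (\<Sum>i<Suc m. L i) + L m * (\<Sum>j<Suc m. 1 - 1)"
    unfolding R_def
    by (intro tendsto_add tendsto_diff tendsto_mult tendsto_sum L tendsto_const n energy_trunc_tendsto v) auto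
  then have R: "R \<longlonglongrightarrow> (\<Sum>j<Suc m. energy \<alpha> (v j)) - (\<Sum>i<Suc m. L i)" by simp
  have fan: "(lam \<alpha> N (Suc m) - lam \<alpha> N m) * D N \<le> R N" "D N \<ge> 0" if "N \<ge> Suc m" for N
    using fan_inequality[OF \<alpha> e v(1)] that unfolding D_def R_def n_def by auto
  have R0: "0 \<le> R N" if "N \<ge> Suc m" for N
    using fan[OF that] lam_le[OF \<alpha>, of m "Suc m" N] that
    by (intro order_trans[OF mult_nonneg_nonneg fan(1)]) auto
  then have "0 \<le> (\<Sum>j<Suc m. energy \<alpha> (v j)) - (\<Sum>i<Suc m. L i)"
    by (intro tendsto_lowerbound[OF R] eventually_sequentiallyI[of "Suc m"]) auto
  then show "(\<Sum>i<Suc m. L i) \<le> (\<Sum>j<Suc m. energy \<alpha> (v j))" by simp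
  assume eq: "(\<Sum>j<Suc m. energy \<alpha> (v j)) = (\<Sum>i<Suc m. L i)"
  have g: "(\<lambda>N. lam \<alpha> N (Suc m) - lam \<alpha> N m) \<longlonglongrightarrow> L (Suc m) - L m"
    by (intro tendsto_diff L)
  have "(\<lambda>N. R N / (lam \<alpha> N (Suc m) - lam \<alpha> N m)) \<longlonglongrightarrow> 0 / (L (Suc m) - L m)"
    using R gap unfolding eq by (intro tendsto_divide g) auto
  then have Rg: "(\<lambda>N. R N / (lam \<alpha> N (Suc m) - lam \<alpha> N m)) \<longlonglongrightarrow> 0" by simp
  have ev: "\<forall>\<^sub>F N in sequentially. N \<ge> Suc m \<and> lam \<alpha> N (Suc m) - lam \<alpha> N m > 0"
    using order_tendstoD(1)[OF g, of 0] gap by (auto intro: eventually_conj eventually_ge_at_top)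
  have "D \<longlonglongrightarrow> 0"
  proof (rule tendsto_sandwich[OF _ _ tendsto_const Rg])
    show "\<forall>\<^sub>F N in sequentially. 0 \<le> D N" using ev by eventually_elim (use fan in auto)
    show "\<forall>\<^sub>F N in sequentially. D N \<le> R N / (lam \<alpha> N (Suc m) - lam \<alpha> N m)"
      using ev by eventually_elim (use fan(1) in \<open>auto simp: pos_le_divide_eq mult.commute\<close>)
  qed
  then have "(\<lambda>N. (\<Sum>j<Suc m. n N j) - D N) \<longlonglongrightarrow> (\<Sum>j<Suc m. 1) - 0"
    by (intro tendsto_diff tendsto_sum n) auto
  moreover have "(\<Sum>j<Suc m. n N j) - D N = (\<Sum>j<Suc m. \<Sum>i<Suc m. (ip2 (e N i) (v j))\<^sup>2)" for N
    unfolding D_def sum_subtractf by simp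
  ultimately show "(\<lambda>N. \<Sum>j<Suc m. \<Sum>i<Suc m. (ip2 (e N i) (v j))\<^sup>2) \<longlonglongrightarrow> Suc m"
    by (simp del: sum.lessThan_Suc)
qed

text \<open>The cube over a countable index set is compact by Tychonoff and first countable, hence
  sequentially compact; this takes the place of a diagonal argument.\<close>

lemma countable_family_convergent_subsequence:
  fixes f :: "nat \<Rightarrow> 'i :: countable \<Rightarrow> real"
  assumes "\<And>n i. \<bar>f n i\<bar> \<le> 1"
  obtains r g where "strict_mono r" "\<And>i. (\<lambda>n. f (r n) i) \<longlonglongrightarrow> g i"
proof -
  have "compact (PiE UNIV (\<lambda>_. {-1..1}) :: ('i \<Rightarrow> real) set)"
    by (subst compactin_euclidean_iff[symmetric], subst euclidean_product_topology[symmetric])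
      (simp add: compactin_PiE)
  then have "seq_compact (PiE UNIV (\<lambda>_. {-1..1}) :: ('i \<Rightarrow> real) set)"
    by (rule compact_imp_seq_compact)
  moreover have "\<forall>n. f n \<in> PiE UNIV (\<lambda>_. {-1..1})"
    using assms by (auto simp: PiE_iff abs_le_iff minus_le_iff)
  ultimately obtain g r where r: "strict_mono r" "(f \<circ> r) \<longlonglongrightarrow> g"
    unfolding seq_compact_def by blast
  have "(\<lambda>n. f (r n) i) \<longlonglongrightarrow> g i" for i
    using continuous_on_tendsto_compose[OF continuous_on_product_coordinates[of i] r(2)]
    by (simp add: o_def)
  then show thesis using that r(1) by blast
qed

text \<open>Fatou's lemma for sums: finite partial sums pass to the limit and stay below
  \<open>M\<close>.\<close>

lemma pointwise_limit_ip2_bound: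
  assumes "\<And>n. d n \<in> l2" "\<And>n. ip2 (d n) (d n) \<le> M" "\<And>k. (\<lambda>n. d n k) \<longlonglongrightarrow> w k"
  shows "w \<in> l2" "ip2 w w \<le> M"
proof -
  have b: "(\<Sum>k\<in>F. (w k)\<^sup>2) \<le> M" if "finite F" for F
  proof (rule tendsto_upperbound)
    show "(\<lambda>n. \<Sum>k\<in>F. (d n k)\<^sup>2) \<longlonglongrightarrow> (\<Sum>k\<in>F. (w k)\<^sup>2)" by (intro tendsto_intros assms(3))
    show "\<forall>\<^sub>F n in sequentially. (\<Sum>k\<in>F. (d n k)\<^sup>2) \<le> M"
    proof (intro always_eventually allI)
      fix n
      have "(\<Sum>k\<in>F. (d n k)\<^sup>2) \<le> (\<Sum>\<^sub>\<infinity>k. (d n k)\<^sup>2)"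
        using assms(1)[of n] that by (intro finite_sum_le_infsum) (auto simp: l2_def)
      then show "(\<Sum>k\<in>F. (d n k)\<^sup>2) \<le> M" using assms(2)[of n] by (simp add: ip2_def power2_eq_square)
    qed
  qed simp
  have s: "(\<lambda>k. (w k)\<^sup>2) summable_on UNIV"
    using b by (intro nonneg_bdd_above_summable_on bdd_aboveI2) auto
  then show "w \<in> l2" by (simp add: l2_def)
  have "infsum (\<lambda>k. (w k)\<^sup>2) UNIV \<le> M" using b s by (intro infsum_le_finite_sums) auto
  then show "ip2 w w \<le> M" by (simp add: ip2_def power2_eq_square)
qed

lemma H1_pointwise_limit:
  assumes d: "\<And>n. d n \<in> H1" "\<And>n. ip2 (d n) (d n) \<le> M" "\<And>k. (\<lambda>n. d n k) \<longlonglongrightarrow> w k"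
    and b: "\<And>n. ip2 (\<lambda>k. of_int k * d n k) (\<lambda>k. of_int k * d n k) \<le> M"
  shows "w \<in> H1" "(\<lambda>n. ip2 (\<lambda>k. d n k - w k) (\<lambda>k. d n k - w k)) \<longlonglongrightarrow> 0"
proof -
  have m: "d n \<in> l2" "(\<lambda>k. of_int k * d n k) \<in> l2" for n using d(1)[of n] by (auto simp: H1_def)
  have w: "w \<in> l2" using pointwise_limit_ip2_bound(1)[OF m(1) d(2,3)] .
  have kw: "(\<lambda>k. of_int k * w k) \<in> l2" "ip2 (\<lambda>k. of_int k * w k) (\<lambda>k. of_int k * w k) \<le> M"
    using pointwise_limit_ip2_bound[OF m(2) b tendsto_mult[OF tendsto_const d(3)]] by auto
  show H: "w \<in> H1" using w kw by (simp add: H1_def)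
  show "(\<lambda>n. ip2 (\<lambda>k. d n k - w k) (\<lambda>k. d n k - w k)) \<longlonglongrightarrow> 0"
  \<comment> \<open>The square of the norm of a difference is at most twice the sum of the squared
    norms, and both of these are at most \<open>M\<close>.\<close>
  proof (rule l2_tendsto_zero[where M = "4 * M"])
    show "(\<lambda>k. d n k - w k) \<in> H1" for n
      using l2.diff_mem[OF m(1) w] l2.diff_mem[OF m(2) kw(1)] by (simp add: H1_def right_diff_distrib)
    show "(\<lambda>n. d n k - w k) \<longlonglongrightarrow> 0" for k using LIM_zero[OF d(3)] .
    fix n
    let ?f = "\<lambda>k. of_int k * d n k" and ?g = "\<lambda>k. of_int k * w k"
    have "ip2 (\<lambda>k. ?f k + ?g k) (\<lambda>k. ?f k + ?g k) \<ge> 0" by (rule l2.ip_nonneg)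
    then have "- 2 * ip2 ?f ?g \<le> ip2 ?f ?f + ip2 ?g ?g"
      using l2.ip_lincomb_left[OF m(2)[of n] kw(1), of _ 1] l2.ip_lincomb_right[OF m(2)[of n] kw(1), of _ 1]
        l2.lincomb_mem[OF m(2)[of n] kw(1), of 1] m(2)[of n] kw(1)
      by (simp add: l2.ip_commute[of ?g ?f])
    then show "ip2 (\<lambda>k. of_int k * (d n k - w k)) (\<lambda>k. of_int k * (d n k - w k)) \<le> 4 * M"
      using l2.ip_diff_self[OF m(2)[of n] kw(1)] b[of n] kw(2) by (simp add: right_diff_distrib)
  qed
qed

text \<open>Solved for the diagonal term, the recurrence expresses \<open>k^2 * v k\<close> by
  \<open>v\<close> and its two shifts, all square-summable. This gain of regularity later provides
  genuine weak derivatives; pairing the same identity with \<open>v\<close> gives the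
  energy.\<close>

lemma jacobi_l2_energy:
  assumes v: "v \<in> H1" and j: "\<And>k. jacobi \<alpha> v k = c * v k" and \<alpha>: "\<alpha> > 0"
  shows "energy \<alpha> v = c * ip2 v v" "(\<lambda>k. (of_int k)\<^sup>2 * v k) \<in> l2"
proof -
  have m: "v \<in> l2" "(\<lambda>k. v (k + 1)) \<in> l2" "(\<lambda>k. v (k - 1)) \<in> l2"
    using v l2_reindex[OF _ bij_int_shift[of 1]] l2_reindex[OF _ bij_int_shift[of "-1"]] by (auto simp: H1_def)
  have eq: "(of_int k)\<^sup>2 * v k = (1 / \<alpha>) * ((c - 2) * v k + ((1 * v (k - 1)) + v (k + 1)))" for k
    using j[of k] \<alpha> by (simp add: jacobi_def field_simps)
  show k2: "(\<lambda>k. (of_int k)\<^sup>2 * v k) \<in> l2"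
    unfolding eq by (intro l2.scale_mem l2.lincomb_mem m)
  have "ip2 (\<lambda>k. of_int k * v k) (\<lambda>k. of_int k * v k) = ip2 (\<lambda>k. (of_int k)\<^sup>2 * v k) v"
    unfolding ip2_def by (simp add: power2_eq_square ac_simps)
  also have "\<dots> = (1 / \<alpha>) * ((c - 2) * ip2 v v + (ip2 (\<lambda>k. v (k - 1)) v + ip2 (\<lambda>k. v (k + 1)) v))"
    unfolding eq
    using m by (simp only: l2.ip_scale_left l2.ip_lincomb_left l2.lincomb_mem) simp
  finally have "\<alpha> * ip2 (\<lambda>k. of_int k * v k) (\<lambda>k. of_int k * v k)
      = (c - 2) * ip2 v v + (ip2 (\<lambda>k. v (k - 1)) v + ip2 (\<lambda>k. v (k + 1)) v)"
    using \<alpha> by simp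
  moreover have "ip2 (\<lambda>k. v (k - 1)) v = ip2 v (\<lambda>k. v (k + 1))"
    using ip2_reindex[OF bij_int_shift[of 1], of "\<lambda>k. v (k - 1)" v] by simp
  ultimately show "energy \<alpha> v = c * ip2 v v"
    unfolding energy_eq_ip2[OF v] by (simp add: l2.ip_commute[of "\<lambda>k. v (k + 1)" v] left_diff_distrib)
qed

text \<open>The recurrence can be solved for either neighbour, so two adjacent zeros spread in both
  directions.\<close>

lemma jacobi_solution_zero:
  assumes j: "\<And>k. jacobi \<alpha> v k = c * v k" and z: "v 0 = 0" "v 1 = 0"
  shows "v k = 0"
proof -
  have r: "v (k + 1) = (\<alpha> * (of_int k)\<^sup>2 + 2 - c) * v k - v (k - 1)"
    "v (k - 1) = (\<alpha> * (of_int k)\<^sup>2 + 2 - c) * v k - v (k + 1)" for k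
    using j[of k] by (auto simp: jacobi_def algebra_simps)
  have "v (int n) = 0 \<and> v (int n + 1) = 0" for n
  proof (induction n)
    case (Suc n)
    then show ?case using r(1)[of "int n + 1"] by (simp add: add.commute)
  qed (use z in auto)
  moreover have "v (- int n) = 0 \<and> v (- int n + 1) = 0" for n
  proof (induction n)
    case (Suc n)
    have *: "- int (Suc n) = - int n - 1" "- int (Suc n) + 1 = - int n" by simp_all
    show ?case unfolding * using Suc r(2)[of "- int n"] by simp
  qed (use z in auto)
  ultimately show ?thesis by (metis int_cases2)
qed

text \<open>The Casoratian of two solutions is constant and, for square-summable ones, vanishes at infinity.\<close>

lemma jacobi_l2_simple:
  assumes v: "v \<in> l2" "\<And>k. jacobi \<alpha> v k = c * v k" and w: "w \<in> l2" "\<And>k. jacobi \<alpha> w k = c * w k"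
    and orth: "ip2 v v = 1" "ip2 w w = 1"
  shows "ip2 v w \<noteq> 0"
proof
  assume z: "ip2 v w = 0"
  define W where "W = (\<lambda>k. v (k + 1) * w k - v k * w (k + 1))"
  have step: "W k = W (k - 1)" for k
  proof -
    define A where "A = \<alpha> * (of_int k)\<^sup>2 + 2 - c"
    have "v (k + 1) = A * v k - v (k - 1)" "w (k + 1) = A * w k - w (k - 1)"
      using v(2)[of k] w(2)[of k] by (auto simp: A_def jacobi_def algebra_simps)
    then show ?thesis unfolding W_def by (simp add: left_diff_distrib right_diff_distrib)
  qed
  have const: "W (int n) = W 0" for n
  proof (induction n)
    case (Suc n)
    then show ?case using step[of "int (Suc n)"] by simp
  qed simp
  have "(\<lambda>n. W (int n)) \<longlonglongrightarrow> 0 * 0 - 0 * 0"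
    unfolding W_def
    using l2_at_infinity[OF v(1)] l2_at_infinity[OF w(1)]
      l2_at_infinity[OF l2_reindex[OF v(1) bij_int_shift[of 1]]] l2_at_infinity[OF l2_reindex[OF w(1) bij_int_shift[of 1]]]
    by (intro tendsto_diff tendsto_mult)
  then have "W 0 = 0" unfolding const by (simp add: LIMSEQ_const_iff)
  then have W: "v 1 * w 0 = v 0 * w 1" by (simp add: W_def)
  have "\<exists>p\<in>{0, 1}. v p \<noteq> 0"
  proof (rule ccontr)
    assume "\<not> (\<exists>p\<in>{0, 1}. v p \<noteq> 0)"
    then have "v = (\<lambda>_. 0)" using jacobi_solution_zero[OF v(2)] by auto
    then show False using orth(1) by (simp add: ip2_def)
  qed
  then obtain p where p: "p = 0 \<or> p = 1" "v p \<noteq> 0" by auto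
  \<comment> \<open>A combination that vanishes at \<open>p\<close> by construction and at the other
    of the indices 0 and 1 because the Casoratian is zero.\<close>
  define g where "g = (\<lambda>k. w p * v k + (- v p) * w k)"
  have "g k = 0" for k
  proof (rule jacobi_solution_zero)
    show "jacobi \<alpha> g k = c * g k" for k
      unfolding g_def jacobi_lincomb v(2) w(2) by (simp add: algebra_simps)
  qed (use p W in \<open>auto simp: g_def ac_simps\<close>)
  then have "w p * v k = v p * w k" for k using g_def by (simp add: eq_iff_diff_eq_0[of "w p * v k"])
  then have "ip2 (\<lambda>k. w p * v k) w = ip2 (\<lambda>k. v p * w k) w" by simp
  then show False using v(1) w(1) z p orth by (simp add: l2.ip_scale_left)
qed

lemma eigenbasis_sign:
  assumes "eigenbasis \<alpha> N e" "\<And>i. s i * s i = (1::real)"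
  shows "eigenbasis \<alpha> N (\<lambda>i k. s i * e i k)"
proof -
  have "ip2 (\<lambda>k. s i * e i k) (\<lambda>k. s j * e j k) = s i * s j * ip2 (e i) (e j)" for i j
    unfolding ip2_def infsum_cmult_right'[symmetric] by (simp add: ac_simps)
  moreover have h: "s i * e i j * (s i * e i k) = e i j * e i k" for i j k
    using assms(2)[of i] by (simp add: mult.assoc mult.left_commute[of "e i j" "s i"])
  moreover have "(\<Sum>i<n. s i * e i j * (s i * e i k)) = (\<Sum>i<n. e i j * e i k)" for n j k
    by (simp only: h)
  ultimately show ?thesis
    using assms jacobi_eigen_scale by (auto simp: eigenbasis_def simp del: sum.lessThan_Suc)
qed

text \<open>Collects the outcome of the limit. \<open>ev\<close> is a choice of truncated eigenbases
  whose signs are fixed so that the full sequence, not just a subsequence, converges to \<psi>; the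
  recurrence of \<psi> is recorded through its consequences \<open>limit_energy\<close> and
  \<open>limit_H2\<close>.\<close>

locale limiting_eigenbasis =
  fixes \<alpha> :: real and L :: "nat \<Rightarrow> real" and \<psi> :: "nat \<Rightarrow> int \<Rightarrow> real" and ev :: "nat \<Rightarrow> nat \<Rightarrow> int \<Rightarrow> real"
  assumes alpha_pos: "\<alpha> > 0"
    and eigenbasis: "eigenbasis \<alpha> N (ev N)"
    and lam_tendsto: "(\<lambda>N. lam \<alpha> N i) \<longlonglongrightarrow> L i"
    and L_less: "i < j \<Longrightarrow> L i < L j"
    and limit_H1: "\<psi> i \<in> H1"
    and limit_H2: "(\<lambda>k. (of_int k)\<^sup>2 * \<psi> i k) \<in> l2"
    and limit_orthonormal: "ip2 (\<psi> i) (\<psi> j) = (if i = j then 1 else 0)"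
    and limit_energy: "energy \<alpha> (\<psi> i) = L i"
    and ev_tendsto: "(\<lambda>N. ip2 (\<lambda>k. ev N i k - \<psi> i k) (\<lambda>k. ev N i k - \<psi> i k)) \<longlonglongrightarrow> 0"

text \<open>Convergent eigenvalues are bounded, so coercivity bounds the eigenvectors in
  \<open>H1\<close>. A pointwise convergent subsequence therefore converges in norm, which preserves
  orthonormality, while each row of the recurrence involves only three coordinates and passes to the
  limit pointwise.\<close>

lemma limit_eigenvectors:
  assumes \<alpha>: "\<alpha> > 0" and e: "\<And>N. eigenbasis \<alpha> N (e N)"
    and L: "\<And>i. (\<lambda>N. lam \<alpha> N i) \<longlonglongrightarrow> L i"
  obtains \<psi> where "\<And>i. \<psi> i \<in> H1" "\<And>i k. jacobi \<alpha> (\<psi> i) k = L i * \<psi> i k"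
    "\<And>i j. ip2 (\<psi> i) (\<psi> j) = (if i = j then 1 else 0)"
proof -
  \<comment> \<open>Padding by zero: \<open>eigenbasis\<close> constrains \<open>e N i\<close> only
    for \<open>i < 2 * N + 1\<close>, whereas the compactness argument needs bounds for all
    indices.\<close>
  define f where "f = (\<lambda>N i k. if i < 2 * N + 1 then e N i k else 0)"
  have f_eq: "f N i = e N i" if "i < 2 * N + 1" for N i using that by (auto simp: f_def)
  have f_0: "f N i = (\<lambda>_. 0)" if "\<not> i < 2 * N + 1" for N i using that by (auto simp: f_def)
  have z: "(\<lambda>_. 0) \<in> H1" "ip2 (\<lambda>_. 0) (\<lambda>_. 0) = 0" using l2.zero_mem by (auto simp: H1_def ip2_def)
  have f_H1: "f N i \<in> H1" for N i
    using eigenbasis_mem(1)[OF \<alpha> e] z f_eq f_0 by (cases "i < 2 * N + 1") auto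
  then have f_l2: "f N i \<in> l2" for N i by (auto simp: H1_def)
  have f_norm: "ip2 (f N i) (f N i) \<le> 1" for N i
    using e[of N] z f_eq[of i N] f_0[of i N] by (cases "i < 2 * N + 1") (auto simp: eigenbasis_def)
  have "\<bar>f N i k\<bar> \<le> 1" for N i k
    using order_trans[OF l2_square_le_ip2[OF f_l2] f_norm] by (simp add: abs_square_le_1)
  then obtain r g where r: "strict_mono r" and g: "\<And>p. (\<lambda>n. f (r n) (fst p) (snd p)) \<longlonglongrightarrow> g p"
    using countable_family_convergent_subsequence[of "\<lambda>n p. f n (fst p) (snd p)"] by blast
  define \<psi> where "\<psi> = (\<lambda>i k. g (i, k))"
  have lim: "(\<lambda>n. f (r n) i k) \<longlonglongrightarrow> \<psi> i k" for i k
    using g[of "(i, k)"] by (simp add: \<psi>_def)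
  have large: "\<forall>\<^sub>F n in sequentially. i < 2 * r n + 1 \<and> k \<in> {- int (r n)..int (r n)}" for i k
    using eventually_ge_at_top[of "i + nat \<bar>k\<bar>"]
  proof eventually_elim
    case (elim n)
    then have "i + nat \<bar>k\<bar> \<le> r n" using seq_suble[OF r, of n] by simp
    then show ?case by auto
  qed
  have conv: "\<psi> i \<in> H1 \<and> (\<lambda>n. ip2 (\<lambda>k. f (r n) i k - \<psi> i k) (\<lambda>k. f (r n) i k - \<psi> i k)) \<longlonglongrightarrow> 0" for i
  proof -
    have "Bseq (\<lambda>N. lam \<alpha> N i)" using L[of i] by (intro convergent_imp_Bseq) (auto simp: convergent_def)
    then obtain C where C: "C > 0" "\<And>N. \<bar>lam \<alpha> N i\<bar> \<le> C" by (auto simp: Bseq_def)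
    have "ip2 (\<lambda>k. of_int k * f N i k) (\<lambda>k. of_int k * f N i k) \<le> 1 + C / \<alpha>" for N
    proof (cases "i < 2 * N + 1")
      case True
      have "\<alpha> * ip2 (\<lambda>k. of_int k * f N i k) (\<lambda>k. of_int k * f N i k) \<le> lam \<alpha> N i"
        using l2_energy_bound[OF f_H1 \<alpha>, of N i] eigenbasis_energy[OF \<alpha> e True] f_eq[OF True] by simp
      then have "\<alpha> * ip2 (\<lambda>k. of_int k * f N i k) (\<lambda>k. of_int k * f N i k) \<le> C" using C(2)[of N] by simp
      then have "ip2 (\<lambda>k. of_int k * f N i k) (\<lambda>k. of_int k * f N i k) \<le> C / \<alpha>"
        using \<alpha> by (simp add: pos_le_divide_eq mult.commute)
      then show ?thesis by simp
    next
      case False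
      then show ?thesis using f_0[of i N] z C \<alpha> by (simp add: add_nonneg_nonneg)
    qed
    moreover have "ip2 (f N i) (f N i) \<le> 1 + C / \<alpha>" for N
      using f_norm[of N i] C(1) \<alpha> by (simp add: add_increasing2)
    ultimately show ?thesis
      using H1_pointwise_limit[of "\<lambda>n. f (r n) i" "1 + C / \<alpha>" "\<psi> i"] f_H1 lim by auto
  qed
  show thesis
  proof (rule that[of \<psi>])
    show "\<psi> i \<in> H1" for i using conv by blast
    then have l2: "\<psi> i \<in> l2" for i by (auto simp: H1_def)
    show "ip2 (\<psi> i) (\<psi> j) = (if i = j then 1 else 0)" for i j
    proof (rule LIMSEQ_unique)
      show "(\<lambda>n. ip2 (f (r n) i) (f (r n) j)) \<longlonglongrightarrow> ip2 (\<psi> i) (\<psi> j)"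
        using conv by (intro l2.ip_tendsto f_l2 l2) auto
      have "\<forall>\<^sub>F n in sequentially. ip2 (f (r n) i) (f (r n) j) = (if i = j then 1 else 0)"
        using large[of i 0] large[of j 0]
        by eventually_elim (use e in \<open>auto simp: f_eq eigenbasis_def\<close>)
      then show "(\<lambda>n. ip2 (f (r n) i) (f (r n) j)) \<longlonglongrightarrow> (if i = j then 1 else 0)"
        by (rule tendsto_eventually)
    qed
    show "jacobi \<alpha> (\<psi> i) k = L i * \<psi> i k" for i k
    proof (rule LIMSEQ_unique)
      show "(\<lambda>n. jacobi \<alpha> (f (r n) i) k) \<longlonglongrightarrow> jacobi \<alpha> (\<psi> i) k"
        unfolding jacobi_def by (intro tendsto_intros lim)
      have "(\<lambda>n. lam \<alpha> (r n) i * f (r n) i k) \<longlonglongrightarrow> L i * \<psi> i k"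
        using LIMSEQ_subseq_LIMSEQ[OF L r] by (intro tendsto_mult lim) (simp add: o_def)
      moreover have "\<forall>\<^sub>F n in sequentially. jacobi \<alpha> (f (r n) i) k = lam \<alpha> (r n) i * f (r n) i k"
        using large[of i k] by eventually_elim (use e in \<open>auto simp: f_eq eigenbasis_def jacobi_eigen_def\<close>)
      ultimately show "(\<lambda>n. jacobi \<alpha> (f (r n) i) k) \<longlonglongrightarrow> L i * \<psi> i k"
        by (simp add: tendsto_cong)
    qed
  qed
qed

text \<open>Two equal limits would give two orthonormal square-summable solutions of one recurrence,
  so the limits are distinct and all gaps are open. Applied to \<psi> itself,
  \<open>fan_limit\<close> then shows that for every \<open>m\<close> the leading block of squared
  products between \<open>e N\<close> and \<psi> has total weight tending to \<open>m\<close>;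
  comparing consecutive blocks isolates the diagonal entries. Thus the vectors extracted along a
  subsequence control the whole sequence.\<close>

lemma limiting_eigenbasis_exists:
  assumes \<alpha>: "\<alpha> > 0"
  shows "\<exists>L \<psi> ev. limiting_eigenbasis \<alpha> L \<psi> ev"
proof -
  define L where "L = (\<lambda>i. lim (\<lambda>N. lam \<alpha> N i))"
  have L: "(\<lambda>N. lam \<alpha> N i) \<longlonglongrightarrow> L i" for i
    using lam_convergent[OF \<alpha>, of i] by (simp add: L_def convergent_LIMSEQ_iff)
  define e where "e = (\<lambda>N. SOME e. eigenbasis \<alpha> N e)"
  have e: "eigenbasis \<alpha> N (e N)" for N unfolding e_def by (rule someI_ex[OF eigenbasis_ex[OF \<alpha>]])
  obtain \<psi> where \<psi>: "\<And>i. \<psi> i \<in> H1" "\<And>i k. jacobi \<alpha> (\<psi> i) k = L i * \<psi> i k"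
    "\<And>i j. ip2 (\<psi> i) (\<psi> j) = (if i = j then 1 else 0)"
    using limit_eigenvectors[OF \<alpha> e L] by blast
  have l2: "\<psi> i \<in> l2" for i using \<psi>(1) by (auto simp: H1_def)
  have energy: "energy \<alpha> (\<psi> i) = L i" for i
    using jacobi_l2_energy(1)[OF \<psi>(1,2) \<alpha>] \<psi>(3)[of i i] by simp
  have L_less: "L i < L j" if "i < j" for i j
  proof -
    have "L i \<le> L j"
    proof (rule tendsto_le[OF _ L L])
      show "\<forall>\<^sub>F N in sequentially. lam \<alpha> N i \<le> lam \<alpha> N j"
        using eventually_ge_at_top[of j] by eventually_elim (use lam_le[OF \<alpha>] that in auto)
    qed simp
    moreover have "L i \<noteq> L j"
    proof
      assume eq: "L i = L j"
      have "ip2 (\<psi> i) (\<psi> j) \<noteq> 0"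
        by (rule jacobi_l2_simple[where \<alpha> = \<alpha> and c = "L i"]) (use l2 \<psi> eq in auto)
      then show False using \<psi>(3) that by simp
    qed
    ultimately show ?thesis by simp
  qed
  have orth: "l2.orthonormal_on {..<m} \<psi>" for m
    using \<psi>(3) l2 by (auto simp: l2.orthonormal_on_def)
  define A where "A = (\<lambda>N i j. (ip2 (e N i) (\<psi> j))\<^sup>2)"
  define T where "T = (\<lambda>m N. \<Sum>j<m. \<Sum>i<m. A N i j)"
  have T: "T m \<longlonglongrightarrow> m" for m
  proof (cases m)
    case (Suc m')
    then show ?thesis
      using fan_limit(2)[OF \<alpha> e L L_less[OF lessI], where m = m' and v = \<psi>] orth[of m] \<psi>(1) energy unfolding T_def A_def
      by (simp del: sum.lessThan_Suc)
  qed (simp add: T_def)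
  \<comment> \<open>Enlarging the block adds a row, a column and the corner \<open>A N m m\<close>.
    Since all row and column sums are at most 1, the added row and column each weigh at most
    \<open>m - T m N\<close>.\<close>
  have A1: "A N m m \<ge> T (Suc m) N - T m N - 2 * (m - T m N)" if N: "N \<ge> m" for N m
  proof -
    have row: "(\<Sum>j<Suc m. A N i j) \<le> 1" if "i < 2 * N + 1" for i
      using l2.bessel_inequality[OF _ orth, of "Suc m" "e N i"] eigenbasis_mem(2)[OF \<alpha> e that] e[of N] that
      unfolding A_def by (simp add: eigenbasis_def)
    have col: "(\<Sum>i<Suc m. A N i j) \<le> 1" for j
    proof -
      have "l2.orthonormal_on {..<Suc m} (e N)" using N by (intro eigenbasis_orthonormal[OF \<alpha> e]) simp
      then show ?thesis
        using l2.bessel_inequality[of "{..<Suc m}" "e N" "\<psi> j"] l2 \<psi>(3)[of j j]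
        unfolding A_def by (simp add: l2.ip_commute[of "\<psi> j" "e N _"] del: sum.lessThan_Suc)
    qed
    have "(\<Sum>j<m. A N m j) \<le> (\<Sum>j<m. 1 - (\<Sum>i<m. A N i j))"
      using col by (intro sum_mono) (simp add: le_diff_eq add.commute)
    then have 1: "(\<Sum>j<m. A N m j) \<le> m - T m N" by (simp add: T_def sum_subtractf)
    have "(\<Sum>i<m. A N i m) \<le> (\<Sum>i<m. 1 - (\<Sum>j<m. A N i j))"
      using row N by (intro sum_mono) (simp add: le_diff_eq add.commute)
    then have 2: "(\<Sum>i<m. A N i m) \<le> m - T m N"
      using sum.swap[of "\<lambda>i j. A N i j" "{..<m}" "{..<m}"] by (simp add: T_def sum_subtractf)
    have "T (Suc m) N = T m N + (\<Sum>j<m. A N m j) + (\<Sum>i<m. A N i m) + A N m m"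
      by (simp add: T_def sum.distrib)
    then show ?thesis using 1 2 by simp
  qed
  have A_le: "A N m m \<le> 1" if "N \<ge> m" for N m
    using l2.ip_cauchy_schwarz[OF eigenbasis_mem(2)[OF \<alpha> e] l2, of m N m] e[of N] \<psi>(3)[of m m] that
    by (simp add: A_def eigenbasis_def)
  have A_lim: "(\<lambda>N. A N m m) \<longlonglongrightarrow> 1" for m
  proof (rule tendsto_sandwich)
    show "\<forall>\<^sub>F N in sequentially. T (Suc m) N - T m N - 2 * (m - T m N) \<le> A N m m"
      using eventually_ge_at_top[of m] by eventually_elim (rule A1)
    show "\<forall>\<^sub>F N in sequentially. A N m m \<le> 1"
      using eventually_ge_at_top[of m] by eventually_elim (rule A_le)
    have "(\<lambda>N. T (Suc m) N - T m N - 2 * (m - T m N)) \<longlonglongrightarrow> real (Suc m) - real m - 2 * (real m - real m)"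
      by (intro tendsto_intros T)
    then show "(\<lambda>N. T (Suc m) N - T m N - 2 * (m - T m N)) \<longlonglongrightarrow> 1" by simp
  qed simp
  \<comment> \<open>The sign that makes the product with \<open>\<psi> i\<close> nonnegative; the
    squared distance is then \<open>2 - 2 * sqrt (A N i i)\<close>.\<close>
  define s where "s = (\<lambda>N i. if ip2 (e N i) (\<psi> i) \<ge> 0 then 1 else - 1 :: real)"
  define ev where "ev = (\<lambda>N i k. s N i * e N i k)"
  have s: "s N i * s N i = 1" "s N i * ip2 (e N i) (\<psi> i) = \<bar>ip2 (e N i) (\<psi> i)\<bar>" for N i
    by (auto simp: s_def)
  have ev: "eigenbasis \<alpha> N (ev N)" for N unfolding ev_def by (intro eigenbasis_sign e s)
  have "(\<lambda>N. ip2 (\<lambda>k. ev N i k - \<psi> i k) (\<lambda>k. ev N i k - \<psi> i k)) \<longlonglongrightarrow> 0" for i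
  proof -
    have "(\<lambda>N. 2 - 2 * sqrt (A N i i)) \<longlonglongrightarrow> 2 - 2 * sqrt 1"
      by (intro tendsto_intros A_lim)
    moreover have "\<forall>\<^sub>F N in sequentially. ip2 (\<lambda>k. ev N i k - \<psi> i k) (\<lambda>k. ev N i k - \<psi> i k) = 2 - 2 * sqrt (A N i i)"
      using eventually_ge_at_top[of i]
    proof eventually_elim
      case (elim N)
      then have i: "i < 2 * N + 1" by simp
      have "ip2 (ev N i) (ev N i) = 1" using ev[of N] i by (simp add: eigenbasis_def)
      moreover have "ip2 (ev N i) (\<psi> i) = sqrt (A N i i)"
        using eigenbasis_mem(2)[OF \<alpha> e i] l2 s(2) by (simp add: ev_def A_def l2.ip_scale_left)
      ultimately show ?case
        using l2.ip_diff_self[OF eigenbasis_mem(2)[OF \<alpha> ev i] l2, of i] \<psi>(3)[of i i] by simp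
    qed
    ultimately show ?thesis by (simp add: tendsto_cong)
  qed
  then have "limiting_eigenbasis \<alpha> L \<psi> ev"
    using \<alpha> ev L L_less \<psi> energy jacobi_l2_energy(2)[OF \<psi>(1,2) \<alpha>] by unfold_locales auto
  then show ?thesis by blast
qed

context limiting_eigenbasis
begin

lemma limit_l2: "\<psi> i \<in> l2"
  using limit_H1 by (auto simp: H1_def)

lemma limit_orthonormal_on: "l2.orthonormal_on J \<psi>"
  using limit_orthonormal limit_l2 by (auto simp: l2.orthonormal_on_def)

lemma sum_limit_eigenvalues_le:
  assumes v: "l2.orthonormal_on {..<m} v" "\<And>j. j < m \<Longrightarrow> v j \<in> H1"
  shows "(\<Sum>i<m. L i) \<le> (\<Sum>j<m. energy \<alpha> (v j))"
proof (cases m)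
  case (Suc m')
  show ?thesis
    using v unfolding Suc
    by (intro fan_limit(1)[OF alpha_pos, where e = ev and L = L] eigenbasis lam_tendsto L_less) auto
qed simp

text \<open>Equality in Ky Fan's bound makes the weights of the \<open>v j\<close> on the truncated
  eigenvectors sum to \<open>m\<close> in the limit, and norm convergence transfers this to \<psi>.
  As each of the \<open>m\<close> summands is at most 1 by Bessel, each equals 1.\<close>

lemma minimizers_in_limit_span:
  assumes v: "l2.orthonormal_on {..<m} v" "\<And>j. j < m \<Longrightarrow> v j \<in> H1"
    and eq: "(\<Sum>j<m. energy \<alpha> (v j)) = (\<Sum>i<m. L i)" and j: "j < m"
  shows "(\<Sum>i<m. (ip2 (\<psi> i) (v j))\<^sup>2) = 1"
proof -
  obtain m' where m: "m = Suc m'" using j by (cases m) auto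
  have vl2: "v j \<in> l2" if "j < m" for j using v that by (auto simp: H1_def)
  have "(\<lambda>N. ip2 (ev N i) (v j)) \<longlonglongrightarrow> ip2 (\<psi> i) (v j)" if "j < m" for i j
  proof -
    \<comment> \<open>The shift by \<open>i\<close> keeps the index below \<open>2 * N + 1\<close>,
      so every member of the sequence is a genuine eigenvector.\<close>
    have "(\<lambda>N. ip2 (ev (N + i) i) (v j)) \<longlonglongrightarrow> ip2 (\<psi> i) (v j)"
    proof (rule l2.ip_tendsto)
      show "ev (N + i) i \<in> l2" for N by (rule eigenbasis_mem(2)[OF alpha_pos eigenbasis]) simp
      show "(\<lambda>N. ip2 (\<lambda>k. ev (N + i) i k - \<psi> i k) (\<lambda>k. ev (N + i) i k - \<psi> i k)) \<longlonglongrightarrow> 0"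
        using LIMSEQ_ignore_initial_segment[OF ev_tendsto[of i], of i] .
    qed (use limit_l2 vl2[OF that] in \<open>auto simp: ip2_def\<close>)
    then show ?thesis by (rule LIMSEQ_offset)
  qed
  then have "(\<lambda>N. \<Sum>j<m. \<Sum>i<m. (ip2 (ev N i) (v j))\<^sup>2) \<longlonglongrightarrow> (\<Sum>j<m. \<Sum>i<m. (ip2 (\<psi> i) (v j))\<^sup>2)"
    by (intro tendsto_sum tendsto_power) auto
  moreover have "(\<lambda>N. \<Sum>j<m. \<Sum>i<m. (ip2 (ev N i) (v j))\<^sup>2) \<longlonglongrightarrow> m"
    using v eq unfolding m
    by (intro fan_limit(2)[OF alpha_pos, where e = ev and L = L] eigenbasis lam_tendsto L_less) auto
  ultimately have tot: "(\<Sum>j<m. \<Sum>i<m. (ip2 (\<psi> i) (v j))\<^sup>2) = m" by (rule LIMSEQ_unique)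
  have le: "(\<Sum>i<m. (ip2 (\<psi> i) (v j))\<^sup>2) \<le> 1" if "j < m" for j
    using l2.bessel_inequality[OF _ limit_orthonormal_on vl2[OF that], of "{..<m}"] v(1) that
    by (simp add: l2.orthonormal_on_def l2.ip_commute[of "v j" "\<psi> _"])
  have "(\<Sum>j<m. 1 - (\<Sum>i<m. (ip2 (\<psi> i) (v j))\<^sup>2)) = 0" using tot by (simp add: sum_subtractf)
  then have "1 - (\<Sum>i<m. (ip2 (\<psi> i) (v j))\<^sup>2) = 0"
    using le j by (subst (asm) sum_nonneg_eq_0_iff) auto
  then show ?thesis by simp
qed

end

section \<open>Left singular bases\<close>

definition orthonormal_family :: "(nat \<Rightarrow> real ^ 'd) \<Rightarrow> bool" where
  "orthonormal_family u \<longleftrightarrow> (\<forall>i<CARD('d). \<forall>j<CARD('d). u i \<bullet> u j = (if i = j then 1 else 0))"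

context
  fixes u :: "nat \<Rightarrow> real ^ 'd"
  assumes u: "orthonormal_family u"
begin

lemma orthonormal_family_inj: "inj_on u {..<CARD('d)}"
  by (rule inj_onI) (metis u orthonormal_family_def lessThan_iff zero_neq_one)

lemma orthonormal_family_independent:
  assumes "J \<subseteq> {..<CARD('d)}"
  shows "independent (u ` J)"
proof (rule pairwise_orthogonal_independent)
  show "pairwise orthogonal (u ` J)"
    using u subsetD[OF assms] by (auto simp: pairwise_def orthogonal_def orthonormal_family_def)
  show "0 \<notin> u ` J"
    using u assms by (auto simp: orthonormal_family_def) (metis inner_zero_left lessThan_iff subsetD zero_neq_one)
qed

lemma orthonormal_family_span: "span (u ` {..<CARD('d)}) = UNIV"
proof -
  have "UNIV \<subseteq> span (u ` {..<CARD('d)})"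
    using orthonormal_family_independent[OF order_refl] orthonormal_family_inj
    by (intro card_ge_dim_independent) (auto simp: card_image)
  then show ?thesis by auto
qed

lemma orthonormal_family_expansion: "y = (\<Sum>i<CARD('d). (u i \<bullet> y) *\<^sub>R u i)"
proof -
  define z where "z = y - (\<Sum>i<CARD('d). (u i \<bullet> y) *\<^sub>R u i)"
  have "u j \<bullet> z = 0" if "j < CARD('d)" for j
  proof -
    have "u j \<bullet> (\<Sum>i<CARD('d). (u i \<bullet> y) *\<^sub>R u i) = (\<Sum>i<CARD('d). (u i \<bullet> y) * (if j = i then 1 else 0))"
      using u that by (simp add: inner_sum_right orthonormal_family_def)
    then show ?thesis using that
      by (simp add: z_def inner_diff_right if_distrib[of "\<lambda>x. _ * x"] cong: if_cong)
  qed
  then have "orthogonal z w" if "w \<in> u ` {..<CARD('d)}" for w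
    using that by (auto simp: orthogonal_def inner_commute)
  then have "orthogonal z z"
    using orthogonal_to_span[of z "u ` {..<CARD('d)}" z] orthonormal_family_span by auto
  then show ?thesis by (simp add: orthogonal_def z_def)
qed

lemma orthonormal_family_parseval: "(\<Sum>i<CARD('d). (u i \<bullet> y) * (u i \<bullet> z)) = y \<bullet> z"
  by (subst orthonormal_family_expansion[of y]) (simp add: inner_sum_left)

text \<open>Expanding an eigenvector for \<open>c\<close> in the basis kills all coordinates with
  \<open>a j \<noteq> c\<close>, so the eigenspace is spanned by the remaining basis
  vectors.\<close>

lemma matrix_eigenspace_dim:
  assumes eig: "\<And>i. i < CARD('d) \<Longrightarrow> A *v u i = a i *\<^sub>R u i"
  shows "dim (matrix_eigenspace A c) = card {i. i < CARD('d) \<and> a i = c}"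
proof -
  let ?J = "{i. i < CARD('d) \<and> a i = c}"
  have "matrix_eigenspace A c = span (u ` ?J)"
  proof (intro equalityI subsetI)
    fix v assume "v \<in> matrix_eigenspace A c"
    then have v: "A *v v = c *\<^sub>R v" by (simp add: matrix_eigenspace_def)
    have "A *v v = (\<Sum>i<CARD('d). (u i \<bullet> v) *\<^sub>R (a i *\<^sub>R u i))"
      by (subst orthonormal_family_expansion[of v])
        (simp add: linear_sum[OF matrix_vector_mul_linear] matrix_vector_mult_scaleR eig)
    then have "u j \<bullet> (A *v v) = (\<Sum>i<CARD('d). (u i \<bullet> v) * a i * (if j = i then 1 else 0))" if "j < CARD('d)" for j
      using u that by (simp add: inner_sum_right orthonormal_family_def)
    then have "u j \<bullet> (A *v v) = (u j \<bullet> v) * a j" if "j < CARD('d)" for j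
      using that by (simp add: if_distrib[of "\<lambda>x. _ * x"] cong: if_cong)
    then have z: "u j \<bullet> v = 0" if "j < CARD('d)" "a j \<noteq> c" for j
      using that v by (auto simp: mult.commute)
    have "v = (\<Sum>i\<in>?J. (u i \<bullet> v) *\<^sub>R u i)"
      by (rule trans[OF orthonormal_family_expansion sum.mono_neutral_right]) (use z in auto)
    then show "v \<in> span (u ` ?J)"
      by (metis (no_types, lifting) imageI span_base span_scale span_sum)
  next
    fix v assume "v \<in> span (u ` ?J)"
    moreover have "subspace (matrix_eigenspace A c)"
      by (auto simp: subspace_def matrix_eigenspace_def matrix_vector_right_distrib
          matrix_vector_mult_scaleR algebra_simps)
    moreover have "u ` ?J \<subseteq> matrix_eigenspace A c"
      using eig by (auto simp: matrix_eigenspace_def)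
    ultimately show "v \<in> matrix_eigenspace A c" using span_minimal by blast
  qed
  moreover have "dim (span (u ` ?J)) = card (u ` ?J)"
    using orthonormal_family_independent[of ?J] by (subst dim_span_eq_card_independent) auto
  moreover have "card (u ` ?J) = card ?J"
    by (rule card_image) (rule inj_on_subset[OF orthonormal_family_inj], auto)
  ultimately show ?thesis by simp
qed

text \<open>Sorting depends only on the multiset of eigenvalues, and the multiplicity of
  \<open>y\<close> is the number of positions with \<open>a i = y\<close>. Hence any diagonalisation
  in non-increasing order reads off the list that underlies \<open>singular_value\<close>.\<close>

lemma matrix_eigenvalue_list:
  assumes eig: "\<And>i. i < CARD('d) \<Longrightarrow> A *v u i = a i *\<^sub>R u i"
    and mono: "\<And>i j. i \<le> j \<Longrightarrow> j < CARD('d) \<Longrightarrow> a j \<le> a i"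
  shows "rev (sorted_eigenvalues {c. \<exists>v. v \<noteq> 0 \<and> v \<in> matrix_eigenspace A c}
           (\<lambda>c. dim (matrix_eigenspace A c))) = map a [0..<CARD('d)]"
proof -
  let ?xs = "map a [0..<CARD('d)]"
  have dim: "dim (matrix_eigenspace A c) = card {i. i < CARD('d) \<and> a i = c}" for c
    by (rule matrix_eigenspace_dim) (rule eig)
  have C: "{c. \<exists>v. v \<noteq> 0 \<and> v \<in> matrix_eigenspace A c} = a ` {..<CARD('d)}"
  proof (intro equalityI subsetI)
    fix c assume "c \<in> {c. \<exists>v. v \<noteq> 0 \<and> v \<in> matrix_eigenspace A c}"
    then obtain v where v: "v \<noteq> 0" "v \<in> matrix_eigenspace A c" by blast
    have "dim (matrix_eigenspace A c) \<noteq> 0" using v dim_eq_0[of "matrix_eigenspace A c"] by blast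
    then have "card {i. i < CARD('d) \<and> a i = c} \<noteq> 0" unfolding dim .
    then have "{i. i < CARD('d) \<and> a i = c} \<noteq> {}" by (metis card.empty)
    then show "c \<in> a ` {..<CARD('d)}" by auto
  next
    fix c assume "c \<in> a ` {..<CARD('d)}"
    then obtain i where i: "i < CARD('d)" "c = a i" by auto
    have "u i \<noteq> 0" using u i unfolding orthonormal_family_def by (metis inner_zero_left zero_neq_one)
    then show "c \<in> {c. \<exists>v. v \<noteq> 0 \<and> v \<in> matrix_eigenspace A c}"
      using eig i by (auto simp: matrix_eigenspace_def)
  qed
  have "(\<Sum>c\<in>a ` {..<CARD('d)}. replicate_mset (card {i. i < CARD('d) \<and> a i = c}) c) = mset ?xs"
  proof (rule multiset_eqI)
    fix y
    have "count (\<Sum>c\<in>a ` {..<CARD('d)}. replicate_mset (card {i. i < CARD('d) \<and> a i = c}) c) y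
        = (\<Sum>c\<in>a ` {..<CARD('d)}. if c = y then card {i. i < CARD('d) \<and> a i = c} else 0)"
      by (auto simp: count_sum intro!: sum.cong)
    also have "\<dots> = card {i. i < CARD('d) \<and> a i = y}"
      by (auto simp: card_eq_0_iff)
    also have "\<dots> = count (mset ?xs) y"
      unfolding count_mset count_list_eq_length_filter length_filter_conv_card by (intro arg_cong[where f = card]) auto
    finally show "count (\<Sum>c\<in>a ` {..<CARD('d)}. replicate_mset (card {i. i < CARD('d) \<and> a i = c}) c) y
        = count (mset ?xs) y" .
  qed
  then have "sorted_eigenvalues {c. \<exists>v. v \<noteq> 0 \<and> v \<in> matrix_eigenspace A c} (\<lambda>c. dim (matrix_eigenspace A c))
      = sort ?xs"
    unfolding sorted_eigenvalues_def C dim by (simp only: sorted_list_of_multiset_mset)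
  also have "\<dots> = rev ?xs"
  proof (rule properties_for_sort)
    show "sorted (rev ?xs)"
      unfolding sorted_wrt_rev by (auto simp: sorted_wrt_iff_nth_less intro!: mono)
  qed simp
  finally show ?thesis by simp
qed

end

section \<open>The Gram matrix of the data\<close>

definition gram :: "('n::finite \<Rightarrow> real ^ 'd) \<Rightarrow> real ^ 'd ^ 'd" where
  "gram x = data_matrix x ** transpose (data_matrix x)"

lemma gram_mult: "gram x *v v = (\<Sum>c\<in>UNIV. (x c \<bullet> v) *\<^sub>R x c)"
proof -
  have "(gram x *v v) $ i = (\<Sum>c\<in>UNIV. (x c \<bullet> v) *\<^sub>R x c) $ i" for i
  proof -
    have "(gram x *v v) $ i = (\<Sum>j\<in>UNIV. \<Sum>c\<in>UNIV. x c $ i * x c $ j * v $ j)"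
      by (simp add: gram_def matrix_vector_mult_def matrix_matrix_mult_def transpose_def data_matrix_def sum_distrib_right)
    also have "\<dots> = (\<Sum>c\<in>UNIV. \<Sum>j\<in>UNIV. x c $ i * x c $ j * v $ j)" by (rule sum.swap)
    finally show ?thesis by (simp add: inner_vec_def sum_distrib_left sum_distrib_right ac_simps)
  qed
  then show ?thesis by (simp add: vec_eq_iff)
qed

lemma inner_gram: "w \<bullet> (gram x *v v) = (\<Sum>c\<in>UNIV. (x c \<bullet> w) * (x c \<bullet> v))"
  unfolding gram_mult by (simp add: inner_sum_right inner_commute mult.commute)

text \<open>The values \<open>a i\<close> are nonnegative as quadratic forms of the Gram matrix, so
  squaring the square root in \<open>singular_value\<close> returns them.\<close>

lemma left_singular_basisI:
  fixes u :: "nat \<Rightarrow> real ^ 'd" and x :: "'n::finite \<Rightarrow> real ^ 'd"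
  assumes u: "orthonormal_family u" and eig: "\<And>i. i < CARD('d) \<Longrightarrow> gram x *v u i = a i *\<^sub>R u i"
    and mono: "\<And>i j. i \<le> j \<Longrightarrow> j < CARD('d) \<Longrightarrow> a j \<le> a i"
  shows "left_singular_basis (data_matrix x) u"
    and "\<And>i. i < CARD('d) \<Longrightarrow> (singular_value (data_matrix x) i)\<^sup>2 = a i"
proof -
  have nonneg: "0 \<le> a i" if "i < CARD('d)" for i
  proof -
    have "a i = u i \<bullet> (gram x *v u i)" using eig[OF that] u that by (simp add: orthonormal_family_def)
    also have "\<dots> \<ge> 0" unfolding inner_gram by (intro sum_nonneg) auto
    finally show ?thesis .
  qed
  have list: "rev (sorted_eigenvalues {c. \<exists>v. v \<noteq> 0 \<and> v \<in> matrix_eigenspace (gram x) c}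
           (\<lambda>c. dim (matrix_eigenspace (gram x) c))) = map a [0..<CARD('d)]"
    by (rule matrix_eigenvalue_list[OF u]) (use eig mono in auto)
  show s: "(singular_value (data_matrix x) i)\<^sup>2 = a i" if "i < CARD('d)" for i
    unfolding singular_value_def gram_def[symmetric] list using that nonneg by simp
  show "left_singular_basis (data_matrix x) u"
    using u eig orthonormal_family_span[OF u] s
    unfolding left_singular_basis_def gram_def[symmetric] by (auto simp: matrix_eigenspace_def orthonormal_family_def)
qed

lemma gram_eigenbasis:
  fixes x :: "'n::finite \<Rightarrow> real ^ 'd"
  obtains u :: "nat \<Rightarrow> real ^ 'd" and a where "orthonormal_family u" "\<And>i. i < CARD('d) \<Longrightarrow> gram x *v u i = a i *\<^sub>R u i"
    "\<And>i j. i \<le> j \<Longrightarrow> j < CARD('d) \<Longrightarrow> a j \<le> a i"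
proof -
  have sym: "gram x $ j $ k = gram x $ k $ j" for j k
    by (simp add: gram_def matrix_matrix_mult_def transpose_def mult.commute)
  obtain e l where "\<And>i k. i < CARD('d) \<Longrightarrow> k \<notin> UNIV \<Longrightarrow> e i k = 0"
    and e0: "\<And>i k. i < CARD('d) \<Longrightarrow> k \<in> UNIV \<Longrightarrow> (\<Sum>j\<in>UNIV. gram x $ k $ j * e i j) = l i * e i k"
    and e2:     "\<And>i j. i < CARD('d) \<Longrightarrow> j < CARD('d) \<Longrightarrow> (\<Sum>k\<in>UNIV. e i k * e j k) = (if i = j then 1 else 0)"
    by (rule symmetric_eigenbasis[of "UNIV :: 'd set" "\<lambda>j k. gram x $ j $ k"], rule finite, rule sym, rule that, assumption+)
  \<comment> \<open>Sorting by the negated eigenvalue yields the non-increasing order of singular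
    values.\<close>
  define xs where "xs = sort_key (\<lambda>i. - l i) [0..<CARD('d)]"
  have xs: "length xs = CARD('d)" "distinct xs" "set xs = {..<CARD('d)}" "sorted (map (\<lambda>i. - l i) xs)"
    by (auto simp: xs_def atLeast0LessThan)
  have lt: "xs ! i < CARD('d)" if "i < CARD('d)" for i using nth_mem[of i xs] xs that by auto
  show thesis
  proof (rule that[of "\<lambda>i. \<chi> k. e (xs ! i) k" "\<lambda>i. l (xs ! i)"])
    show "orthonormal_family (\<lambda>i. \<chi> k. e (xs ! i) k)"
      using e2 lt xs by (auto simp: orthonormal_family_def inner_vec_def nth_eq_iff_index_eq)
    show "gram x *v (\<chi> k. e (xs ! i) k) = l (xs ! i) *\<^sub>R (\<chi> k. e (xs ! i) k)" if "i < CARD('d)" for i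
      using e0[OF lt[OF that]] by (simp add: vec_eq_iff matrix_vector_mult_def)
    show "l (xs ! j) \<le> l (xs ! i)" if "i \<le> j" "j < CARD('d)" for i j
      using sorted_nth_mono[OF xs(4), of i j] that xs(1) by simp
  qed
qed

lemma left_singular_basis_exists:
  fixes x :: "'n::finite \<Rightarrow> real ^ 'd"
  shows "\<exists>u. left_singular_basis (data_matrix x) u"
  by (rule gram_eigenbasis[of x]) (rule exI, rule left_singular_basisI(1))

lemma left_singular_basisD:
  fixes u :: "nat \<Rightarrow> real ^ 'd" and x :: "'n::finite \<Rightarrow> real ^ 'd"
  assumes "left_singular_basis (data_matrix x) u"
  shows "orthonormal_family u"
    and "\<And>i. i < CARD('d) \<Longrightarrow> gram x *v u i = (singular_value (data_matrix x) i)\<^sup>2 *\<^sub>R u i"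
  using assms by (auto simp: left_singular_basis_def gram_def matrix_eigenspace_def orthonormal_family_def)

lemma singular_value_antimono:
  fixes x :: "'n::finite \<Rightarrow> real ^ 'd"
  assumes "i \<le> j" "j < CARD('d)"
  shows "(singular_value (data_matrix x) j)\<^sup>2 \<le> (singular_value (data_matrix x) i)\<^sup>2"
proof -
  obtain u :: "nat \<Rightarrow> real ^ 'd" and a where "orthonormal_family u" "\<And>i. i < CARD('d) \<Longrightarrow> gram x *v u i = a i *\<^sub>R u i"
    "\<And>i j. i \<le> j \<Longrightarrow> j < CARD('d) \<Longrightarrow> a j \<le> a i" using gram_eigenbasis by blast
  then show ?thesis using left_singular_basisI(2)[of u x a] assms by auto
qed

lemma left_singular_basis_gram:
  fixes u :: "nat \<Rightarrow> real ^ 'd" and x :: "'n::finite \<Rightarrow> real ^ 'd"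
  assumes "left_singular_basis (data_matrix x) u" "i < CARD('d)" "j < CARD('d)"
  shows "(\<Sum>c\<in>UNIV. (u i \<bullet> x c) * (u j \<bullet> x c)) = (if i = j then (singular_value (data_matrix x) i)\<^sup>2 else 0)"
proof -
  have "(\<Sum>c\<in>UNIV. (u i \<bullet> x c) * (u j \<bullet> x c)) = u i \<bullet> (gram x *v u j)"
    unfolding inner_gram by (simp add: inner_commute)
  then show ?thesis using left_singular_basisD[OF assms(1)] assms(2,3) by (simp add: orthonormal_family_def)
qed

text \<open>Summed over the data, the coordinates in a left singular basis are uncorrelated, so all
  cross terms vanish. This is what decouples the objective into one term per singular value.\<close>

lemma left_singular_basis_sum_squares:
  fixes u :: "nat \<Rightarrow> real ^ 'd" and x :: "'n::finite \<Rightarrow> real ^ 'd"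
  assumes u: "left_singular_basis (data_matrix x) u"
  shows "(\<Sum>c\<in>UNIV. (\<Sum>i<CARD('d). (u i \<bullet> x c) * w i)\<^sup>2) = (\<Sum>i<CARD('d). (singular_value (data_matrix x) i)\<^sup>2 * (w i)\<^sup>2)"
proof -
  let ?d = "CARD('d)"
  have "(\<Sum>c\<in>UNIV. (\<Sum>i<?d. (u i \<bullet> x c) * w i)\<^sup>2)
      = (\<Sum>c\<in>UNIV. \<Sum>i<?d. \<Sum>j<?d. (u i \<bullet> x c) * (u j \<bullet> x c) * (w i * w j))"
    by (simp add: power2_eq_square sum_product ac_simps)
  also have "\<dots> = (\<Sum>i<?d. \<Sum>j<?d. (\<Sum>c\<in>UNIV. (u i \<bullet> x c) * (u j \<bullet> x c)) * (w i * w j))"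
    unfolding sum_distrib_right by (subst sum.swap) (intro sum.cong refl sum.swap)
  also have "\<dots> = (\<Sum>i<?d. \<Sum>j<?d. (if i = j then (singular_value (data_matrix x) i)\<^sup>2 else 0) * (w i * w j))"
    by (intro sum.cong refl) (simp add: left_singular_basis_gram[OF u])
  also have "\<dots> = (\<Sum>i<?d. (singular_value (data_matrix x) i)\<^sup>2 * (w i)\<^sup>2)"
    by (simp add: if_distrib[of "\<lambda>x. x * _"] power2_eq_square cong: if_cong)
  finally show ?thesis .
qed

lemma span_eq_UNIV_of_full_rank:
  fixes x :: "'n::finite \<Rightarrow> real ^ 'd"
  assumes "rank (data_matrix x) = CARD('d)"
  shows "span (range x) = UNIV"
proof -
  have "columns (data_matrix x) = range x"
    by (auto simp: columns_def column_def data_matrix_def vec_lambda_eta)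
  then have "dim (range x) = DIM(real ^ 'd)"
    using assms by (simp add: column_rank_def)
  then show ?thesis using dim_eq_full by blast
qed

section \<open>The Hartley transform\<close>

definition ipL :: "(real \<Rightarrow> real) \<Rightarrow> (real \<Rightarrow> real) \<Rightarrow> real" where
  "ipL f g = (\<integral>t. f t * g t \<partial>unit_measure)"

lemma unit_measure_facts:
  "{0..1::real} \<in> sets lebesgue" "space unit_measure = {0..1}" "integrable unit_measure (\<lambda>_. c :: real)"
  "(\<integral>t. (c :: real) \<partial>unit_measure) = c"
  by (auto simp: measure_restrict_space finite_measure.integrable_const finite_measure_lebesgue_on)

lemma L2_mult_integrable:
  assumes "f \<in> L2" "g \<in> L2"
  shows "integrable unit_measure (\<lambda>t. f t * g t)"
proof (rule Bochner_Integration.integrable_bound)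
  show "integrable unit_measure (\<lambda>t. (f t)\<^sup>2 + (g t)\<^sup>2)"
    using assms by (intro Bochner_Integration.integrable_add) (auto simp: L2_def)
  show "(\<lambda>t. f t * g t) \<in> borel_measurable unit_measure"
    using assms by (intro borel_measurable_times) (auto simp: L2_def)
  show "AE t in unit_measure. norm (f t * g t) \<le> norm ((f t)\<^sup>2 + (g t)\<^sup>2)"
  proof (intro AE_I2)
    fix t
    have "0 \<le> (\<bar>f t\<bar> - \<bar>g t\<bar>)\<^sup>2" by simp
    then have "2 * \<bar>f t * g t\<bar> \<le> (f t)\<^sup>2 + (g t)\<^sup>2" by (simp add: power2_diff abs_mult)
    then show "norm (f t * g t) \<le> norm ((f t)\<^sup>2 + (g t)\<^sup>2)" by simp
  qed
qed

interpretation L2: ip_space L2 ipL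
proof
  show "(\<lambda>_. 0) \<in> L2" by (simp add: L2_def)
  show "(\<lambda>x. a * f x + g x) \<in> L2" if "f \<in> L2" "g \<in> L2" for f g a
  proof -
    have "integrable unit_measure (\<lambda>t. a\<^sup>2 * (f t)\<^sup>2 + (2 * a) * (f t * g t) + (g t)\<^sup>2)"
      using that L2_mult_integrable[OF that]
      by (intro Bochner_Integration.integrable_add integrable_mult_right) (auto simp: L2_def)
    moreover have "a\<^sup>2 * (f t)\<^sup>2 + (2 * a) * (f t * g t) + (g t)\<^sup>2 = (a * f t + g t)\<^sup>2" for t
      by (simp add: power2_eq_square algebra_simps)
    ultimately have "integrable unit_measure (\<lambda>t. (a * f t + g t)\<^sup>2)" by simp
    moreover have "(\<lambda>t. a * f t + g t) \<in> borel_measurable unit_measure"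
      using that by (intro borel_measurable_add borel_measurable_times) (auto simp: L2_def)
    ultimately show ?thesis by (simp add: L2_def)
  qed
  show "ipL (\<lambda>x. a * f x + g x) h = a * ipL f h + ipL g h" if "f \<in> L2" "g \<in> L2" "h \<in> L2" for f g h a
    using L2_mult_integrable[OF that(1,3)] L2_mult_integrable[OF that(2,3)]
    unfolding ipL_def by (simp add: distrib_right mult.assoc)
  show "ipL f g = ipL g f" for f g unfolding ipL_def by (simp add: mult.commute)
  show "0 \<le> ipL f f" for f unfolding ipL_def by (intro integral_nonneg_AE) simp
qed

lemma L2norm_eq: "L2norm f = sqrt (ipL f f)" "(L2norm f)\<^sup>2 = ipL f f"
  using L2.ip_nonneg[of f] by (simp_all add: L2norm_def ipL_def power2_eq_square)

lemma continuous_L2: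
  assumes "continuous_on {0..1} f"
  shows "f \<in> L2" "integrable unit_measure f"
proof -
  show "integrable unit_measure f" by (rule continuous_imp_integrable_real[OF assms])
  moreover have "integrable unit_measure (\<lambda>t. (f t)\<^sup>2)"
    by (intro continuous_imp_integrable_real continuous_intros assms)
  ultimately show "f \<in> L2" by (auto simp: L2_def)
qed

lemma bounded_L2:
  assumes "f \<in> borel_measurable unit_measure" "\<And>t. \<bar>f t\<bar> \<le> C"
  shows "f \<in> L2"
proof -
  have "integrable unit_measure (\<lambda>t. (f t)\<^sup>2)"
  proof (rule Bochner_Integration.integrable_bound[OF unit_measure_facts(3)[of "C\<^sup>2"]])
    show "(\<lambda>t. (f t)\<^sup>2) \<in> borel_measurable unit_measure" using assms(1) by measurable
    show "AE t in unit_measure. norm ((f t)\<^sup>2) \<le> norm (C\<^sup>2)"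
      using assms(2) by (intro AE_I2) (simp add: abs_le_square_iff[symmetric] order_trans[OF assms(2) abs_ge_self])
  qed
  then show ?thesis using assms(1) by (simp add: L2_def)
qed

lemma ipL_cong_AE:
  assumes "f \<in> L2" "f' \<in> L2" "g \<in> L2" "AE t in unit_measure. f t = f' t"
  shows "ipL f g = ipL f' g"
  unfolding ipL_def using assms by (intro integral_cong_AE borel_measurable_times) (auto simp: L2_def)

lemma L2_limit_bounded:
  assumes "\<And>n. f n \<in> borel_measurable unit_measure" "\<And>t. (\<lambda>n. f n t) \<longlonglongrightarrow> g t" "\<And>n t. \<bar>f n t\<bar> \<le> C"
  shows "g \<in> L2" "(\<lambda>n. ipL (\<lambda>t. f n t - g t) (\<lambda>t. f n t - g t)) \<longlonglongrightarrow> 0"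
proof -
  have m: "g \<in> borel_measurable unit_measure"
    using assms(2) by (intro borel_measurable_LIMSEQ_real[OF _ assms(1)]) auto
  have b: "\<bar>g t\<bar> \<le> C" for t
    using assms(3) by (intro tendsto_upperbound[OF tendsto_rabs[OF assms(2)]]) auto
  show "g \<in> L2" by (rule bounded_L2[OF m b])
  have "(\<lambda>n. \<integral>t. (f n t - g t) * (f n t - g t) \<partial>unit_measure) \<longlonglongrightarrow> (\<integral>t. 0 \<partial>unit_measure)"
  proof (rule integral_dominated_convergence[where w = "\<lambda>_. (2 * C) * (2 * C)"])
    show "AE t in unit_measure. (\<lambda>n. (f n t - g t) * (f n t - g t)) \<longlonglongrightarrow> 0"
      using tendsto_mult[OF LIM_zero[OF assms(2)] LIM_zero[OF assms(2)]] by (intro AE_I2) simp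
    show "AE t in unit_measure. norm ((f n t - g t) * (f n t - g t)) \<le> (2 * C) * (2 * C)" for n
    proof (intro AE_I2)
      fix t
      have "\<bar>f n t - g t\<bar> \<le> 2 * C" using assms(3)[of n t] b[of t] by linarith
      then show "norm ((f n t - g t) * (f n t - g t)) \<le> (2 * C) * (2 * C)"
        unfolding real_norm_def abs_mult by (intro mult_mono) auto
    qed
    show "(\<lambda>t. (f n t - g t) * (f n t - g t)) \<in> borel_measurable unit_measure" for n
      using m assms(1)[of n] by measurable
    show "integrable unit_measure (\<lambda>_. (2 * C) * (2 * C))" by (rule unit_measure_facts(3))
  qed simp
  then show "(\<lambda>n. ipL (\<lambda>t. f n t - g t) (\<lambda>t. f n t - g t)) \<longlonglongrightarrow> 0" by (simp add: ipL_def)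
qed

text \<open>
  The Hartley functions \<open>cas\<close> form a real orthonormal basis. Since \<open>cas k\<close> is the sum of the real
  part and the imaginary part of the conjugate exponential, the coefficient of a real function is
  \<open>Re + Im\<close> of its Fourier coefficient, so that all sequences below can be taken real.
\<close>

definition cas :: "int \<Rightarrow> real \<Rightarrow> real" where
  "cas k t = cos (2 * pi * of_int k * t) - sin (2 * pi * of_int k * t)"

definition hartley :: "(real \<Rightarrow> real) \<Rightarrow> int \<Rightarrow> real" where
  "hartley f k = ipL f (cas k)"

lemma abs_cas_le: "\<bar>cas k t\<bar> \<le> 2"
  unfolding cas_def
  by (rule order_trans[OF abs_triangle_ineq4]) (use abs_cos_le_one abs_sin_le_one in \<open>metis add_mono one_add_one\<close>)

lemma continuous_cas: "continuous_on S (cas k)"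
  unfolding cas_def by (intro continuous_intros)

lemma cas_L2: "cas k \<in> L2"
  by (rule continuous_L2[OF continuous_cas])

lemma cas_derivative: "(cas k has_real_derivative (- 2 * pi * of_int k) * cas (- k) t) (at t within S)"
  unfolding cas_def by (auto intro!: derivative_eq_intros simp: algebra_simps)

lemma integral_trig:
  fixes m :: int
  shows "(\<integral>t. cos (2 * pi * of_int m * t) \<partial>unit_measure) = (if m = 0 then 1 else 0)"
    "(\<integral>t. sin (2 * pi * of_int m * t) \<partial>unit_measure) = 0"
proof -
  have s: "sin (2 * pi * of_int m) = 0" "cos (2 * pi * of_int m) = 1"
    using sin_int_2pin[of m] cos_int_2pin[of m] by simp_all
  have I: "(\<integral>t. f t \<partial>unit_measure) = F 1 - F 0"
    if "\<And>t. (F has_real_derivative f t) (at t)" "continuous_on {0..1} f" for f F :: "real \<Rightarrow> real"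
  proof -
    have "(f has_integral F 1 - F 0) {0..1}"
      using that(1) by (intro fundamental_theorem_of_calculus)
        (auto simp flip: has_real_derivative_iff_has_vector_derivative intro: has_field_derivative_at_within)
    then show ?thesis
      using lebesgue_integral_eq_integral[OF continuous_L2(2)[OF that(2)] unit_measure_facts(1)] by (simp add: integral_unique)
  qed
  show "(\<integral>t. cos (2 * pi * of_int m * t) \<partial>unit_measure) = (if m = 0 then 1 else 0)"
  proof (cases "m = 0")
    case False
    have "(\<integral>t. cos (2 * pi * of_int m * t) \<partial>unit_measure)
        = sin (2 * pi * of_int m * 1) / (2 * pi * of_int m) - sin (2 * pi * of_int m * 0) / (2 * pi * of_int m)"
      using False by (intro I) (auto intro!: derivative_eq_intros continuous_intros)
    then show ?thesis using s False by simp
  qed (use unit_measure_facts(4)[of 1] in simp)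
  show "(\<integral>t. sin (2 * pi * of_int m * t) \<partial>unit_measure) = 0"
  proof (cases "m = 0")
    case False
    have "(\<integral>t. sin (2 * pi * of_int m * t) \<partial>unit_measure)
        = - cos (2 * pi * of_int m * 1) / (2 * pi * of_int m) - (- cos (2 * pi * of_int m * 0) / (2 * pi * of_int m))"
      using False by (intro I) (auto intro!: derivative_eq_intros continuous_intros)
    then show ?thesis using s by simp
  qed simp
qed

lemma cas_orthonormal: "ipL (cas j) (cas k) = (if j = k then 1 else 0)"
proof -
  have "cas j t * cas k t = cos (2 * pi * of_int (j - k) * t) - sin (2 * pi * of_int (j + k) * t)" for t
  proof -
    define x where "x = 2 * pi * of_int j * t"
    define y where "y = 2 * pi * of_int k * t"
    have eq: "2 * pi * of_int (j - k) * t = x - y" "2 * pi * of_int (j + k) * t = x + y"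
      by (simp_all add: x_def y_def algebra_simps)
    show ?thesis
      unfolding eq cas_def x_def[symmetric] y_def[symmetric] cos_diff sin_add by (simp add: algebra_simps)
  qed
  moreover have "integrable unit_measure (\<lambda>t. cos (2 * pi * of_int (j - k) * t))"
    "integrable unit_measure (\<lambda>t. sin (2 * pi * of_int (j + k) * t))"
    by (intro continuous_L2(2) continuous_intros)+
  ultimately have "ipL (cas j) (cas k) = (\<integral>t. cos (2 * pi * of_int (j - k) * t) \<partial>unit_measure)
      - (\<integral>t. sin (2 * pi * of_int (j + k) * t) \<partial>unit_measure)"
    unfolding ipL_def by simp
  then show ?thesis unfolding integral_trig by simp
qed

lemma cas_orthonormal_on: "L2.orthonormal_on J cas"
  using cas_orthonormal cas_L2 by (auto simp: L2.orthonormal_on_def)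

lemma hartley_bessel:
  assumes "f \<in> L2"
  shows "hartley f \<in> l2" "ip2 (hartley f) (hartley f) \<le> ipL f f"
proof -
  have b: "(\<Sum>k\<in>F. (hartley f k)\<^sup>2) \<le> ipL f f" if "finite F" for F
    using L2.bessel_inequality[OF that cas_orthonormal_on assms] by (simp add: hartley_def)
  have s: "(\<lambda>k. (hartley f k)\<^sup>2) summable_on UNIV"
    using b by (intro nonneg_bdd_above_summable_on bdd_aboveI2) auto
  then show "hartley f \<in> l2" by (simp add: l2_def)
  have "infsum (\<lambda>k. (hartley f k)\<^sup>2) UNIV \<le> ipL f f" using b s by (intro infsum_le_finite_sums) auto
  then show "ip2 (hartley f) (hartley f) \<le> ipL f f" by (simp add: ip2_def power2_eq_square)
qed

lemma hartley_sum:
  assumes "\<And>i. i \<in> I \<Longrightarrow> f i \<in> L2"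
  shows "hartley (\<lambda>t. \<Sum>i\<in>I. c i * f i t) = (\<lambda>k. \<Sum>i\<in>I. c i * hartley (f i) k)"
  using assms by (auto simp: hartley_def L2.ip_sum_left cas_L2)

lemma hartley_lincomb:
  "f \<in> L2 \<Longrightarrow> g \<in> L2 \<Longrightarrow> hartley (\<lambda>t. c * f t + g t) = (\<lambda>k. c * hartley f k + hartley g k)"
  by (auto simp: hartley_def L2.ip_lincomb_left cas_L2)

lemma hartley_diff:
  "f \<in> L2 \<Longrightarrow> g \<in> L2 \<Longrightarrow> hartley (\<lambda>t. f t - g t) = (\<lambda>k. hartley f k - hartley g k)"
  by (auto simp: hartley_def L2.ip_diff_left cas_L2)

lemma hartley_cong_AE:
  "f \<in> L2 \<Longrightarrow> g \<in> L2 \<Longrightarrow> AE t in unit_measure. f t = g t \<Longrightarrow> hartley f = hartley g"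
  unfolding hartley_def by (intro ext ipL_cong_AE cas_L2)

text \<open>With \<open>C\<close> and \<open>S\<close> the cosine and sine integrals, the Fourier
  coefficient is \<open>C - i S\<close>, while the Hartley coefficients at \<open>k\<close> and
  \<open>-k\<close> are \<open>C - S\<close> and \<open>C + S\<close>.\<close>

lemma fourier_hartley:
  assumes "f \<in> L2"
  shows "fourier f k = Complex ((hartley f k + hartley f (- k)) / 2) ((hartley f k - hartley f (- k)) / 2)"
proof -
  define C where "C = (\<lambda>t. f t * cos (2 * pi * of_int k * t))"
  define S where "S = (\<lambda>t. f t * sin (2 * pi * of_int k * t))"
  have i: "integrable unit_measure C" "integrable unit_measure S"
    unfolding C_def S_def
    by (intro L2_mult_integrable assms continuous_L2(1)[of "\<lambda>t. cos (_ * t)"] continuous_intros,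
        intro L2_mult_integrable assms continuous_L2(1)[of "\<lambda>t. sin (_ * t)"] continuous_intros)
  have e: "exp (- 2 * of_real pi * \<i> * of_int k * of_real t) = cis (- (2 * pi * of_int k * t))" for t
    by (simp add: cis_conv_exp ac_simps)
  have "complex_of_real (f t) * exp (- 2 * of_real pi * \<i> * of_int k * of_real t)
      = of_real (C t) - \<i> * of_real (S t)" for t
    unfolding e by (simp add: C_def S_def complex_eq_iff)
  then have "fourier f k = (\<integral>t. of_real (C t) - \<i> * of_real (S t) \<partial>unit_measure)"
    by (simp add: fourier_def)
  also have "\<dots> = of_real (\<integral>t. C t \<partial>unit_measure) - \<i> * of_real (\<integral>t. S t \<partial>unit_measure)"
    using i by (simp add: integral_complex_of_real)
  finally have F: "fourier f k = of_real (\<integral>t. C t \<partial>unit_measure) - \<i> * of_real (\<integral>t. S t \<partial>unit_measure)" .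
  have "hartley f k = (\<integral>t. C t \<partial>unit_measure) - (\<integral>t. S t \<partial>unit_measure)"
    unfolding hartley_def ipL_def cas_def using i by (simp add: C_def S_def right_diff_distrib)
  moreover have "hartley f (- k) = (\<integral>t. C t \<partial>unit_measure) + (\<integral>t. S t \<partial>unit_measure)"
    unfolding hartley_def ipL_def cas_def using i by (simp add: C_def S_def distrib_left)
  ultimately show ?thesis by (simp add: F complex_eq_iff)
qed

text \<open>Real and imaginary part are half the sum and half the difference of two Hartley
  increments, so the squared modulus is the mean of their squares. The reflection of the step from
  \<open>k\<close> to \<open>k + 1\<close> is the step from \<open>-k - 1\<close> to
  \<open>-k\<close>, whence the index \<open>- k - 1\<close>; reindexing merges the two
  halves.\<close>

lemma fourier_difference_sum:
  assumes "f \<in> L2"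
  shows "(\<Sum>\<^sub>\<infinity>k. (cmod (fourier f (k + 1) - fourier f k))\<^sup>2) = (\<Sum>\<^sub>\<infinity>k. (hartley f (k + 1) - hartley f k)\<^sup>2)"
proof -
  let ?h = "hartley f"
  define D where "D = (\<lambda>k. (?h (k + 1) - ?h k)\<^sup>2)"
  have D: "D summable_on UNIV"
    using shift_diff_l2[OF hartley_bessel(1)[OF assms]] by (simp add: D_def l2_def)
  have bij: "bij (\<lambda>k::int. - k - 1)" by (rule bijI') (auto intro: exI[of _ "- _ - 1"])
  have D': "(\<lambda>k. D (- k - 1)) summable_on UNIV" "(\<Sum>\<^sub>\<infinity>k. D (- k - 1)) = (\<Sum>\<^sub>\<infinity>k. D k)"
    using summable_on_reindex_bij_betw[OF bij, of D] infsum_reindex_bij_betw[OF bij, of D] D by simp_all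
  have eq: "(cmod (fourier f (k + 1) - fourier f k))\<^sup>2 = 1 / 2 * (D k + D (- k - 1))" for k
  proof -
    have "- k - 1 + 1 = - k" "- (k + 1) = - k - 1" by simp_all
    then show ?thesis
      unfolding fourier_hartley[OF assms] cmod_power2 D_def
      by (simp only: minus_complex.simps complex.sel) (simp add: power2_eq_square field_simps)
  qed
  show ?thesis
    unfolding eq infsum_cmult_right' infsum_add[OF D D'(1)] D'(2) by (simp add: D_def)
qed

text \<open>The real part is the mean of the Hartley products at \<open>k\<close> and
  \<open>-k\<close>; the imaginary part is antisymmetric under reflection and sums to zero.\<close>

lemma l2Z_inner_fourier:
  assumes "f \<in> L2" "g \<in> L2"
  shows "l2Z_inner (fourier f) (fourier g) = of_real (ip2 (hartley f) (hartley g))"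
proof -
  let ?h = "hartley f" and ?g = "hartley g"
  let ?h' = "\<lambda>k. hartley f (- k)" and ?g' = "\<lambda>k. hartley g (- k)"
  have m: "?h \<in> l2" "?g \<in> l2" "?h' \<in> l2" "?g' \<in> l2"
    using hartley_bessel(1) assms l2_reindex[OF _ bij_int_uminus] by auto
  define R where "R = (\<lambda>k. 1 / 2 * (?h k * ?g k) + 1 / 2 * (?h' k * ?g' k))"
  define J where "J = (\<lambda>k. 1 / 2 * (?h' k * ?g k) + (- 1 / 2) * (?h k * ?g' k))"
  have s': "(\<lambda>k. 1 / 2 * (?h k * ?g k)) summable_on UNIV" "(\<lambda>k. 1 / 2 * (?h' k * ?g' k)) summable_on UNIV"
    "(\<lambda>k. 1 / 2 * (?h' k * ?g k)) summable_on UNIV" "(\<lambda>k. (- 1 / 2) * (?h k * ?g' k)) summable_on UNIV"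
    by (intro summable_on_cmult_right l2_mult_summable m)+
  have s: "R summable_on UNIV" "J summable_on UNIV"
    unfolding R_def J_def by (intro summable_on_add s')+
  have R: "infsum R UNIV = ip2 ?h ?g"
    using ip2_reindex[OF bij_int_uminus, of ?h ?g]
    unfolding R_def infsum_add[OF s'(1,2)] infsum_cmult_right' ip2_def[symmetric] by simp
  have J: "infsum J UNIV = 0"
    using ip2_reindex[OF bij_int_uminus, of ?h' ?g]
    unfolding J_def infsum_add[OF s'(3,4)] infsum_cmult_right' ip2_def[symmetric] by simp
  have "cnj (fourier f k) * fourier g k = of_real (R k) + \<i> * of_real (J k)" for k
    unfolding fourier_hartley[OF assms(1)] fourier_hartley[OF assms(2)]
    by (simp add: complex_eq_iff R_def J_def field_simps)
  then have "l2Z_inner (fourier f) (fourier g) = (\<Sum>\<^sub>\<infinity>k. of_real (R k) + \<i> * of_real (J k))"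
    by (simp add: l2Z_inner_def)
  also have "\<dots> = of_real (infsum R UNIV) + \<i> * of_real (infsum J UNIV)"
    by (intro infsumI has_sum_add has_sum_cmult_right has_sum_of_real has_sum_infsum s)
  finally show ?thesis using R J by simp
qed

text \<open>The real and imaginary parts of the Fourier coefficients are the even and odd parts of
  the Hartley sequence, and their sum gives it back. The matrix commutes with reflection, so both
  parts stay in the eigenspace.\<close>

lemma fourier_eigen_iff:
  assumes "f \<in> L2" "c \<noteq> 0"
  shows "fourier f \<in> B_eigenspace \<alpha> N c \<longleftrightarrow> jacobi_eigen \<alpha> N c (hartley f)"
proof -
  let ?h = "hartley f"
  have ReIm: "(\<lambda>k. Re (fourier f k)) = (\<lambda>k. 1 / 2 * ?h k + 1 / 2 * ?h (- k))"
    "(\<lambda>k. Im (fourier f k)) = (\<lambda>k. 1 / 2 * ?h k + (- 1 / 2) * ?h (- k))"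
    by (auto simp: fourier_hartley[OF assms(1)] field_simps)
  show ?thesis
    unfolding B_eigenspace_iff[OF assms(2)]
  proof
    assume "jacobi_eigen \<alpha> N c ?h"
    then show "jacobi_eigen \<alpha> N c (\<lambda>k. Re (fourier f k)) \<and> jacobi_eigen \<alpha> N c (\<lambda>k. Im (fourier f k))"
      unfolding ReIm by (intro conjI jacobi_eigen_lincomb jacobi_eigen_uminus)
  next
    assume "jacobi_eigen \<alpha> N c (\<lambda>k. Re (fourier f k)) \<and> jacobi_eigen \<alpha> N c (\<lambda>k. Im (fourier f k))"
    then have "jacobi_eigen \<alpha> N c (\<lambda>k. 1 * Re (fourier f k) + 1 * Im (fourier f k))"
      by (intro jacobi_eigen_lincomb) auto
    then show "jacobi_eigen \<alpha> N c ?h" by (simp add: fourier_hartley[OF assms(1)] field_simps)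
  qed
qed

section \<open>Uniqueness of Hartley coefficients\<close>

text \<open>Arbitrary phases are covered because a shifted cosine is a combination of
  \<open>cas k\<close> and \<open>cas (- k)\<close>; the product formula in the next lemma shifts
  phases.\<close>

lemma ipL_shifted_cos:
  assumes h: "h \<in> L2" "hartley h = (\<lambda>_. 0)"
  shows "ipL h (\<lambda>t. cos (2 * pi * of_int k * t + b)) = 0"
proof -
  define A where "A = (cos b + sin b) / 2"
  define B where "B = (cos b - sin b) / 2"
  have "cos (2 * pi * of_int k * t + b) = A * cas k t + B * cas (- k) t" for t
    by (simp add: A_def B_def cas_def cos_add field_simps)
  then have "ipL h (\<lambda>t. cos (2 * pi * of_int k * t + b)) = ipL h (\<lambda>t. A * cas k t + B * cas (- k) t)"
    by simp
  also have "\<dots> = A * hartley h k + ipL h (\<lambda>t. B * cas (- k) t)"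
    using L2.ip_lincomb_right[OF cas_L2 L2.scale_mem[OF cas_L2] h(1)] by (simp add: hartley_def)
  also have "ipL h (\<lambda>t. B * cas (- k) t) = B * hartley h (- k)"
    using L2.ip_scale_right[OF cas_L2 h(1)] by (simp add: hartley_def)
  finally show ?thesis using h(2) by simp
qed

text \<open>Each factor \<open>cos (2 * pi * t - a)\<close> is absorbed by the product-to-sum
  formula, which moves the frequency by one and the phase by \<open>a\<close>; hence the induction
  over all \<open>k\<close> and \<open>b\<close>.\<close>

lemma ipL_cos_power:
  assumes h: "h \<in> L2" "hartley h = (\<lambda>_. 0)"
  shows "ipL h (\<lambda>t. cos (2 * pi * t - a) ^ n * cos (2 * pi * of_int k * t + b)) = 0"
proof (induction n arbitrary: k b)
  case 0
  then show ?case using ipL_shifted_cos[OF h] by simp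
next
  case (Suc n)
  define F where "F = (\<lambda>k b t. cos (2 * pi * t - a) ^ n * cos (2 * pi * of_int k * t + b))"
  have F: "F k b \<in> L2" for k :: int and b unfolding F_def by (intro continuous_L2 continuous_intros)
  have "cos (2 * pi * t - a) ^ Suc n * cos (2 * pi * of_int k * t + b)
      = 1 / 2 * F (k + 1) (b - a) t + 1 / 2 * F (k - 1) (b + a) t" for t
  proof -
    define x where "x = 2 * pi * t - a"
    define y where "y = 2 * pi * of_int k * t + b"
    have eq: "2 * pi * of_int (k + 1) * t + (b - a) = y + x" "2 * pi * of_int (k - 1) * t + (b + a) = y - x"
      by (simp_all add: x_def y_def algebra_simps)
    show ?thesis
      unfolding F_def eq x_def[symmetric] y_def[symmetric] cos_add[of y x] cos_diff[of y x] by (simp add: algebra_simps)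
  qed
  then have "ipL h (\<lambda>t. cos (2 * pi * t - a) ^ Suc n * cos (2 * pi * of_int k * t + b))
      = ipL h (\<lambda>t. 1 / 2 * F (k + 1) (b - a) t + 1 / 2 * F (k - 1) (b + a) t)"
    by presburger
  also have "\<dots> = 1 / 2 * ipL h (F (k + 1) (b - a)) + ipL h (\<lambda>t. 1 / 2 * F (k - 1) (b + a) t)"
    by (rule L2.ip_lincomb_right[OF F L2.scale_mem[OF F] h(1)])
  also have "ipL h (\<lambda>t. 1 / 2 * F (k - 1) (b + a) t) = 1 / 2 * ipL h (F (k - 1) (b + a))"
    by (rule L2.ip_scale_right[OF F h(1)])
  finally show ?case using Suc.IH[of "k + 1" "b - a"] Suc.IH[of "k - 1" "b + a"] by (simp add: F_def)
qed

text \<open>Annihilating all powers, \<open>h\<close> annihilates polynomials in the shifted cosine,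
  and by the Weierstrass theorem on \<open>[-1, 1]\<close> all continuous functions of it.\<close>

lemma ipL_continuous_cos:
  assumes h: "h \<in> L2" "hartley h = (\<lambda>_. 0)" and f: "continuous_on {-1..1} f"
  shows "ipL h (\<lambda>t. f (cos (2 * pi * t - a))) = 0"
proof -
  have cf: "(\<lambda>t. f (cos (2 * pi * t - a))) \<in> L2"
    by (intro continuous_L2 continuous_on_compose2[OF f] continuous_intros) auto
  have one: "(\<lambda>_. 1) \<in> L2" by (intro continuous_L2 continuous_intros)
  have h1: "integrable unit_measure (\<lambda>t. \<bar>h t\<bar>)" using L2_mult_integrable[OF h(1) one] by simp
  define K where "K = (\<integral>t. \<bar>h t\<bar> \<partial>unit_measure)"
  have K: "K \<ge> 0" unfolding K_def by simp
  have le: "\<bar>ipL h (\<lambda>t. f (cos (2 * pi * t - a)))\<bar> \<le> e * K" if e: "e > 0" for e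
  proof -
    obtain g where g: "real_polynomial_function g" "\<And>x. x \<in> {-1..1} \<Longrightarrow> \<bar>f x - g x\<bar> < e"
      using Stone_Weierstrass_real_polynomial_function[OF compact_Icc f e] by blast
    then obtain c n where gc: "g = (\<lambda>x. \<Sum>i\<le>n. c i * x ^ i)" by (auto simp: real_polynomial_function_iff_sum)
    have pw: "(\<lambda>t. cos (2 * pi * t - a) ^ i) \<in> L2" for i by (intro continuous_L2 continuous_intros)
    have "ipL h (\<lambda>t. cos (2 * pi * t - a) ^ i) = 0" for i using ipL_cos_power[OF h, of a i 0 0] by simp
    then have "ipL h (\<lambda>t. g (cos (2 * pi * t - a))) = 0"
      unfolding gc using L2.ip_sum_right[OF pw h(1)] by simp
    moreover have cg: "(\<lambda>t. g (cos (2 * pi * t - a))) \<in> L2"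
      unfolding gc by (intro continuous_L2 continuous_intros)
    ultimately have "ipL h (\<lambda>t. f (cos (2 * pi * t - a))) = ipL h (\<lambda>t. f (cos (2 * pi * t - a)) - g (cos (2 * pi * t - a)))"
      using L2.ip_diff_right[OF cf cg h(1)] by simp
    also have "\<bar>\<dots>\<bar> \<le> (\<integral>t. e * \<bar>h t\<bar> \<partial>unit_measure)"
      unfolding ipL_def
    proof (rule order_trans[OF integral_abs_bound integral_mono])
      show "integrable unit_measure (\<lambda>t. \<bar>h t * (f (cos (2 * pi * t - a)) - g (cos (2 * pi * t - a)))\<bar>)"
        by (intro integrable_abs L2_mult_integrable h L2.diff_mem cf cg)
      show "integrable unit_measure (\<lambda>t. e * \<bar>h t\<bar>)" using h1 by simp
      show "\<bar>h t * (f (cos (2 * pi * t - a)) - g (cos (2 * pi * t - a)))\<bar> \<le> e * \<bar>h t\<bar>" for t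
        unfolding abs_mult using g(2)[of "cos (2 * pi * t - a)"]
        by (subst mult.commute) (intro mult_right_mono, auto)
    qed
    finally show ?thesis by (simp add: K_def)
  qed
  have "\<bar>ipL h (\<lambda>t. f (cos (2 * pi * t - a)))\<bar> \<le> 0"
  proof (rule field_le_epsilon)
    fix e :: real assume e: "e > 0"
    \<comment> \<open>The added 1 covers \<open>K = 0\<close>.\<close>
    have "e / (K + 1) * K \<le> e" using e K by (simp add: field_simps)
    then show "\<bar>ipL h (\<lambda>t. f (cos (2 * pi * t - a)))\<bar> \<le> 0 + e"
      using le[of "e / (K + 1)"] e K by simp
  qed
  then show ?thesis by simp
qed

text \<open>Superlevel sets of a cosine on the circle are arcs. Centring it at \<open>b / 2\<close>
  with threshold \<open>cos (pi * b)\<close> gives the arc from 0 to \<open>b\<close>, so indicators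
  of intervals become functions of a single shifted cosine and approximation in one variable
  suffices.\<close>

lemma cos_gt_iff_interval:
  assumes "0 < b" "b \<le> 1" "t \<in> {0..1}"
  shows "cos (2 * pi * t - pi * b) > cos (pi * b) \<longleftrightarrow> 0 < t \<and> t < b"
proof -
  define \<theta> where "\<theta> = 2 * pi * t - pi * b"
  have b: "0 < pi * b" "pi * b \<le> pi" using assms by auto
  have t: "0 \<le> 2 * pi * t" "2 * pi * t \<le> 2 * pi" using assms by auto
  have eq: "0 < t \<longleftrightarrow> - (pi * b) < \<theta>" "t < b \<longleftrightarrow> \<theta> < pi * b"
  proof -
    have "0 < 2 * pi * t \<longleftrightarrow> 0 < t" "2 * pi * t < 2 * pi * b \<longleftrightarrow> t < b" by (simp_all add: zero_less_mult_iff)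
    then show "0 < t \<longleftrightarrow> - (pi * b) < \<theta>" "t < b \<longleftrightarrow> \<theta> < pi * b" unfolding \<theta>_def by linarith+
  qed
  have lower: "- (pi * b) \<le> \<theta>" "\<theta> \<le> 2 * pi - pi * b" using t by (auto simp: \<theta>_def)
  show ?thesis
    unfolding \<theta>_def[symmetric] eq
  proof
    assume "- (pi * b) < \<theta> \<and> \<theta> < pi * b"
    then have "\<bar>\<theta>\<bar> < pi * b" by auto
    then have "cos (pi * b) < cos \<bar>\<theta>\<bar>" using b by (intro cos_monotone_0_pi) auto
    then show "cos (pi * b) < cos \<theta>" by simp
  next
    assume gt: "cos (pi * b) < cos \<theta>"
    have "\<theta> < pi * b"
    proof (rule ccontr)
      assume n: "\<not> \<theta> < pi * b"
      show False
      proof (cases "\<theta> \<le> pi")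
        case True
        then have "cos \<theta> \<le> cos (pi * b)" using n b by (intro cos_monotone_0_pi_le) auto
        then show False using gt by simp
      next
        case False
        then have "cos (2 * pi - \<theta>) \<le> cos (pi * b)" using lower b by (intro cos_monotone_0_pi_le) auto
        then show False using gt by (simp add: cos_diff)
      qed
    qed
    moreover have "\<theta> \<noteq> - (pi * b)" using gt by auto
    ultimately show "- (pi * b) < \<theta> \<and> \<theta> < pi * b" using lower by auto
  qed
qed

lemma integral_initial_interval:
  assumes h: "h \<in> L2" "hartley h = (\<lambda>_. 0)"
  shows "(\<integral>t. indicator {..<b} t * h t \<partial>unit_measure) = 0"
proof -
  have one: "(\<lambda>_. 1) \<in> L2" by (intro continuous_L2 continuous_intros)
  have hm: "h \<in> borel_measurable unit_measure" using h by (simp add: L2_def)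
  have h1: "integrable unit_measure (\<lambda>t. \<bar>h t\<bar>)" using L2_mult_integrable[OF h(1) one] by simp
  have im: "indicat_real A \<in> borel_measurable unit_measure" if "A \<in> sets borel" for A
    using that by (intro measurable_restrict_space1 borel_measurable_indicator) simp
  \<comment> \<open>The half-lines \<open>{..<b}\<close> and the open intervals differ on the unit
    interval at most in these endpoints.\<close>
  have zero_one: "AE t in unit_measure. t \<noteq> 0 \<and> t \<noteq> 1"
  proof -
    have "AE t in lebesgue. t \<notin> {0, 1 :: real}"
      by (rule AE_not_in) (auto simp: negligible_iff_null_sets[symmetric])
    then show ?thesis by (subst AE_restrict_space_iff) auto
  qed
  have main: "(\<integral>t. indicator {0<..<b} t * h t \<partial>unit_measure) = 0" if b: "0 < b" "b \<le> 1" for b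
  proof -
    define \<delta> where "\<delta> = cos (pi * b)"
    \<comment> \<open>Continuous ramps of slope \<open>n\<close> starting at the threshold; their
      pointwise limit is the indicator of \<open>x > \<delta>\<close>, reached by dominated
      convergence.\<close>
    define F where "F = (\<lambda>n x. min 1 (max 0 (real n * (x - \<delta>))))"
    have cF: "continuous_on S (F n)" for n S unfolding F_def by (intro continuous_intros)
    have lim: "(\<lambda>n. F n x) \<longlonglongrightarrow> (if x > \<delta> then 1 else 0)" for x
    proof (cases "x > \<delta>")
      case True
      have "\<forall>\<^sub>F n in sequentially. F n x = 1"
        using eventually_ge_at_top[of "nat \<lceil>1 / (x - \<delta>)\<rceil>"]
      proof eventually_elim
        case (elim n)
        then have "1 / (x - \<delta>) \<le> real n" by linarith
        then show ?case using True by (simp add: F_def field_simps)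
      qed
      then show ?thesis using True by (simp add: tendsto_eventually)
    next
      case False
      then have "real n * (x - \<delta>) \<le> 0" for n by (simp add: mult_le_0_iff)
      then have "F n x = 0" for n by (simp add: F_def max_absorb1)
      then show ?thesis using False by simp
    qed
    let ?c = "\<lambda>t. cos (2 * pi * t - pi * b)"
    have "(\<lambda>n. \<integral>t. h t * F n (?c t) \<partial>unit_measure) \<longlonglongrightarrow> (\<integral>t. h t * (if ?c t > \<delta> then 1 else 0) \<partial>unit_measure)"
    proof (rule integral_dominated_convergence[where w = "\<lambda>t. \<bar>h t\<bar>"])
      have c: "(\<lambda>t. F n (?c t)) \<in> L2" for n
        by (intro continuous_L2 continuous_on_compose2[OF cF[of UNIV]] continuous_intros) auto
      then show m: "(\<lambda>t. h t * F n (?c t)) \<in> borel_measurable unit_measure" for n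
        using hm c[of n] by (intro borel_measurable_times) (auto simp: L2_def)
      show "(\<lambda>t. h t * (if ?c t > \<delta> then 1 else 0)) \<in> borel_measurable unit_measure"
        by (rule borel_measurable_LIMSEQ_real[where u = "\<lambda>n t. h t * F n (?c t)", OF _ m])
          (intro tendsto_mult tendsto_const lim)
      show "AE t in unit_measure. (\<lambda>n. h t * F n (?c t)) \<longlonglongrightarrow> h t * (if ?c t > \<delta> then 1 else 0)"
        by (rule AE_I2) (rule tendsto_mult[OF tendsto_const lim])
      show "AE t in unit_measure. norm (h t * F n (?c t)) \<le> \<bar>h t\<bar>" for n
      proof (intro AE_I2)
        fix t
        have "\<bar>F n (?c t)\<bar> \<le> 1" by (auto simp: F_def)
        then show "norm (h t * F n (?c t)) \<le> \<bar>h t\<bar>"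
          unfolding real_norm_def abs_mult using mult_left_mono[of "\<bar>F n (?c t)\<bar>" 1 "\<bar>h t\<bar>"] by simp
      qed
    qed (rule h1)
    moreover have "(\<integral>t. h t * F n (?c t) \<partial>unit_measure) = 0" for n
      using ipL_continuous_cos[OF h cF, of n "pi * b"] by (simp add: ipL_def)
    ultimately have "(\<integral>t. h t * (if ?c t > \<delta> then 1 else 0) \<partial>unit_measure) = 0"
      by (simp add: LIMSEQ_const_iff)
    moreover have "(\<integral>t. h t * (if ?c t > \<delta> then 1 else 0) \<partial>unit_measure) = (\<integral>t. indicator {0<..<b} t * h t \<partial>unit_measure)"
      using cos_gt_iff_interval[OF b] by (intro Bochner_Integration.integral_cong) (auto simp: \<delta>_def indicator_def)
    ultimately show ?thesis by simp
  qed
  consider "b \<le> 0" | "0 < b" "b \<le> 1" | "b > 1" by linarith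
  then show ?thesis
  proof cases
    case 1
    then have "(\<integral>t. indicator {..<b} t * h t \<partial>unit_measure) = (\<integral>t. 0 \<partial>unit_measure)"
      by (intro Bochner_Integration.integral_cong) (auto simp: indicator_def)
    then show ?thesis by simp
  next
    case 2
    have "(\<integral>t. indicator {..<b} t * h t \<partial>unit_measure) = (\<integral>t. indicator {0<..<b} t * h t \<partial>unit_measure)"
    proof (rule integral_cong_AE)
      show "AE t in unit_measure. indicator {..<b} t * h t = indicator {0<..<b} t * h t"
        using zero_one AE_space by eventually_elim (auto simp: indicator_def)
    qed (intro borel_measurable_times im hm; simp)+
    then show ?thesis using main[OF 2] by simp
  next
    case 3
    have "(\<integral>t. indicator {..<b} t * h t \<partial>unit_measure) = (\<integral>t. indicator {0<..<1} t * h t \<partial>unit_measure)"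
    proof (rule integral_cong_AE)
      show "AE t in unit_measure. indicator {..<b} t * h t = indicator {0<..<1} t * h t"
        using zero_one AE_space by eventually_elim (use 3 in \<open>auto simp: indicator_def\<close>)
    qed (intro borel_measurable_times im hm; simp)+
    then show ?thesis using main[of 1] by simp
  qed
qed

text \<open>Half-lines are stable under intersection and generate the Borel sets, so the vanishing
  of the integral of \<open>h\<close> spreads from them to all Borel sets, then to Lebesgue sets
  modulo null sets. A density all of whose set integrals vanish is zero almost everywhere.\<close>

lemma hartley_zero_imp_AE_zero:
  assumes h: "h \<in> L2" "hartley h = (\<lambda>_. 0)"
  shows "AE t in unit_measure. h t = 0"
proof -
  define h0 where "h0 = (\<lambda>t. indicator {0..1} t *\<^sub>R h t)"
  have one: "(\<lambda>_. 1) \<in> L2" by (intro continuous_L2 continuous_intros)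
  have "integrable unit_measure h" using L2_mult_integrable[OF h(1) one] by simp
  from this have h0: "integrable lebesgue h0"
    unfolding h0_def by (subst (asm) integrable_restrict_space) auto
  have si: "set_integrable lebesgue A h0" if "A \<in> sets lebesgue" for A
    unfolding set_integrable_def by (rule integrable_mult_indicator[OF that h0])
  have basic: "set_lebesgue_integral lebesgue {..<b} h0 = 0" for b
  proof -
    have "set_lebesgue_integral lebesgue {..<b} h0 = (\<integral>t. indicator {..<b} t * h t \<partial>unit_measure)"
      unfolding set_lebesgue_integral_def h0_def
      by (subst integral_restrict_space) (auto intro!: Bochner_Integration.integral_cong)
    then show ?thesis using integral_initial_interval[OF h] by simp
  qed
  have total: "integral\<^sup>L lebesgue h0 = 0"
  proof -
    \<comment> \<open>Any bound above 1 would do: the half-line has to contain the whole support of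
      \<open>h0\<close>. The total is used for complements.\<close>
    have "integral\<^sup>L lebesgue h0 = set_lebesgue_integral lebesgue {..<2} h0"
      unfolding set_lebesgue_integral_def h0_def by (auto intro!: Bochner_Integration.integral_cong simp: indicator_def)
    then show ?thesis using basic by simp
  qed
  have borel: "set_lebesgue_integral lebesgue A h0 = 0" if A: "A \<in> sets borel" for A
  proof -
    let ?G = "range (\<lambda>a::real. {..<a})"
    have sets: "sigma_sets UNIV ?G = sets borel" by (subst borel_Iio) simp
    have bl: "A \<in> sets lebesgue" if "A \<in> sigma_sets UNIV ?G" for A
      using that unfolding sets by (metis sets_completionI_sets sets_lborel)
    have "{..<a} \<inter> {..<b} = {..<min a b}" for a b :: real by auto
    then have "Int_stable ?G" by (auto simp: Int_stable_def)
    moreover have "?G \<subseteq> Pow UNIV" by simp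
    moreover have "A \<in> sigma_sets UNIV ?G" using A sets by simp
    ultimately show ?thesis
    proof (induction rule: sigma_sets_induct_disjoint)
      case (basic A)
      then show ?case using \<open>\<And>b. set_lebesgue_integral lebesgue {..<b} h0 = 0\<close> by auto
    next
      case empty
      show ?case by (simp add: set_lebesgue_integral_def)
    next
      case (compl A)
      have "set_lebesgue_integral lebesgue (UNIV - A) h0 = (\<integral>t. h0 t - indicator A t *\<^sub>R h0 t \<partial>lebesgue)"
        unfolding set_lebesgue_integral_def
        by (intro Bochner_Integration.integral_cong) (auto simp: indicator_def)
      also have "\<dots> = integral\<^sup>L lebesgue h0 - set_lebesgue_integral lebesgue A h0"
        using h0 si[OF bl[OF compl(1)]] unfolding set_lebesgue_integral_def set_integrable_def by simp
      finally show ?case using total compl(2) by simp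
    next
      case (union A)
      have "set_lebesgue_integral lebesgue (\<Union>i. A i) h0 = (\<Sum>i. set_lebesgue_integral lebesgue (A i) h0)"
      proof (rule lebesgue_integral_countable_add)
        show "A i \<in> sets lebesgue" for i using union(2) bl by auto
        then show "set_integrable lebesgue (\<Union>i. A i) h0" by (intro si sets.countable_UN) auto
        show "A i \<inter> A j = {}" if "i \<noteq> j" for i j using union(1) that by (auto simp: disjoint_family_on_def)
      qed
      then show ?case using union(3) by simp
    qed
  qed
  have all: "set_lebesgue_integral lebesgue A h0 = 0" if A: "A \<in> sets lebesgue" for A
  proof -
    from A obtain S N N' where S: "A = S \<union> N" "N \<subseteq> N'" "N' \<in> null_sets lborel" "S \<in> sets lborel"
      by (rule sets_completionE)
    have N': "AE t in lebesgue. t \<notin> N'"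
      using S(3) by (intro AE_completion AE_not_in)
    have "set_lebesgue_integral lebesgue A h0 = set_lebesgue_integral lebesgue S h0"
      unfolding set_lebesgue_integral_def
    proof (rule integral_cong_AE)
      show "AE t in lebesgue. indicator A t *\<^sub>R h0 t = indicator S t *\<^sub>R h0 t"
        using N' by eventually_elim (use S in \<open>auto simp: indicator_def\<close>)
      have "S \<in> sets lebesgue" using S(4) by auto
      then show "(\<lambda>t. indicator S t *\<^sub>R h0 t) \<in> borel_measurable lebesgue"
        using si unfolding set_integrable_def by blast
      show "(\<lambda>t. indicator A t *\<^sub>R h0 t) \<in> borel_measurable lebesgue"
        using si[OF A] unfolding set_integrable_def by blast
    qed
    then show ?thesis using borel[of S] S(4) by simp
  qed
  show ?thesis
  proof (rule sigma_finite_measure.density_zero[OF finite_measure.axioms(1)])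
    show "finite_measure unit_measure" by (rule finite_measure_lebesgue_on) simp
    show "integrable unit_measure h" by fact
    fix A assume "A \<in> sets unit_measure"
    then have "A \<in> sets lebesgue" by (simp add: sets_restrict_space_iff)
    moreover have "set_lebesgue_integral unit_measure A h = set_lebesgue_integral lebesgue A h0"
      unfolding set_lebesgue_integral_def h0_def
      by (subst integral_restrict_space) (auto intro!: Bochner_Integration.integral_cong)
    ultimately show "set_lebesgue_integral unit_measure A h = 0" using all by simp
  qed
qed

lemma hartley_inject_AE:
  assumes "f \<in> L2" "g \<in> L2" "hartley f = hartley g"
  shows "AE t in unit_measure. f t = g t"
proof -
  have "AE t in unit_measure. f t - g t = 0"
    using assms by (intro hartley_zero_imp_AE_zero L2.diff_mem) (auto simp: hartley_diff)
  then show ?thesis by simp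
qed

section \<open>Weak derivatives\<close>

lemma summable_on_int_iff:
  fixes f :: "int \<Rightarrow> real"
  assumes "summable (\<lambda>n. f (int n))" "summable (\<lambda>n. f (- int n - 1))" "\<And>k. f k \<ge> 0"
  shows "f summable_on UNIV"
proof -
  have "f summable_on range int"
    using assms(1,3) by (subst summable_on_reindex) (auto intro!: summable_nonneg_imp_summable_on simp: o_def)
  moreover have "f summable_on range (\<lambda>n. - int n - 1)"
    using assms(2,3) by (subst summable_on_reindex) (auto intro!: summable_nonneg_imp_summable_on inj_onI simp: o_def)
  ultimately have "f summable_on (range int \<union> range (\<lambda>n. - int n - 1))"
    by (rule summable_on_union)
  moreover have "range int \<union> range (\<lambda>n. - int n - 1) = (UNIV :: int set)"
  proof -
    have "k \<in> range int \<union> range (\<lambda>n. - int n - 1)" for k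
    proof (cases "k \<ge> 0")
      case True
      then show ?thesis by (auto intro!: image_eqI[of _ _ "nat k"])
    next
      case False
      then show ?thesis by (auto intro!: image_eqI[of _ _ "nat (- k - 1)"])
    qed
    then show ?thesis by blast
  qed
  ultimately show ?thesis by simp
qed

text \<open>Write \<open>w k\<close> as the product of the square-summable weight
  \<open>1 / (1 + |k|)\<close> with \<open>(1 + |k|) * w k\<close>, which is square-summable for
  \<open>w\<close> in \<open>H1\<close>.\<close>

lemma H1_abs_summable:
  assumes "w \<in> H1"
  shows "(\<lambda>k. \<bar>w k\<bar>) summable_on UNIV"
proof -
  define c where "c = (\<lambda>k::int. 1 / (1 + \<bar>real_of_int k\<bar>))"
  have "summable (\<lambda>n. inverse (real (n + 1) ^ 2))" "summable (\<lambda>n. inverse (real (n + 2) ^ 2))"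
    using summable_ignore_initial_segment[OF inverse_power_summable[of 2, where 'a = real], of 1]
      summable_ignore_initial_segment[OF inverse_power_summable[of 2, where 'a = real], of 2]
    by (simp_all add: add.commute)
  then have "c \<in> l2"
    unfolding l2_def c_def by (intro CollectI summable_on_int_iff) (auto simp: power_divide field_simps)
  moreover have "(\<lambda>k. 1 * \<bar>w k\<bar> + \<bar>of_int k * w k\<bar>) \<in> l2"
    using assms by (intro l2_add) (auto simp: H1_def l2_def)
  ultimately have "(\<lambda>k. c k * (1 * \<bar>w k\<bar> + \<bar>of_int k * w k\<bar>)) summable_on UNIV"
    by (rule l2_mult_summable)
  moreover have "c k * (1 * \<bar>w k\<bar> + \<bar>of_int k * w k\<bar>) = \<bar>w k\<bar>" for k
  proof -
    have "1 * \<bar>w k\<bar> + \<bar>of_int k * w k\<bar> = (1 + \<bar>real_of_int k\<bar>) * \<bar>w k\<bar>" by (simp add: abs_mult algebra_simps)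
    moreover have "1 + \<bar>real_of_int k\<bar> \<noteq> 0" by linarith
    ultimately show ?thesis by (simp add: c_def)
  qed
  ultimately show ?thesis by simp
qed

text \<open>Represents a function when \<open>w\<close> lies in \<open>H1\<close>, where the series
  converges absolutely and uniformly; for other \<open>w\<close> the sum may take the default value
  0 of \<open>infsum\<close>.\<close>

definition synth :: "(int \<Rightarrow> real) \<Rightarrow> real \<Rightarrow> real" where
  "synth w t = (\<Sum>\<^sub>\<infinity>k. w k * cas k t)"

definition synth_partial :: "(int \<Rightarrow> real) \<Rightarrow> nat \<Rightarrow> real \<Rightarrow> real" where
  "synth_partial w N t = (\<Sum>k\<in>{- int N..int N}. w k * cas k t)"

lemma synth_partial_L2: "synth_partial w N \<in> L2"
  unfolding synth_partial_def by (intro L2.sum_mem cas_L2)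

lemma synth_limit:
  assumes "w \<in> H1"
  shows "synth w \<in> L2"
    "(\<lambda>N. ipL (\<lambda>t. synth_partial w N t - synth w t) (\<lambda>t. synth_partial w N t - synth w t)) \<longlonglongrightarrow> 0"
proof -
  have abs: "(\<lambda>k. 2 * \<bar>w k\<bar>) summable_on UNIV"
    by (intro summable_on_cmult_right H1_abs_summable assms)
  have le: "\<bar>w k * cas k t\<bar> \<le> 2 * \<bar>w k\<bar>" for k t
    unfolding abs_mult using mult_left_mono[OF abs_cas_le[of k t], of "\<bar>w k\<bar>"] by simp
  have lim: "(\<lambda>N. synth_partial w N t) \<longlonglongrightarrow> synth w t" for t
  proof -
    have "(\<lambda>k. norm (w k * cas k t)) summable_on UNIV"
      by (rule summable_on_comparison_test[OF abs]) (use le in auto)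
    from sum_symmetric_intervals_tendsto[OF abs_summable_summable[OF this], of 0]
    show ?thesis by (simp add: synth_def synth_partial_def)
  qed
  have bound: "\<bar>synth_partial w N t\<bar> \<le> (\<Sum>\<^sub>\<infinity>k. 2 * \<bar>w k\<bar>)" for N t
  proof -
    have "\<bar>synth_partial w N t\<bar> \<le> (\<Sum>k\<in>{- int N..int N}. 2 * \<bar>w k\<bar>)"
      unfolding synth_partial_def by (rule order_trans[OF sum_abs sum_mono]) (rule le)
    also have "\<dots> \<le> (\<Sum>\<^sub>\<infinity>k. 2 * \<bar>w k\<bar>)" by (intro finite_sum_le_infsum abs) auto
    finally show ?thesis .
  qed
  have m: "synth_partial w N \<in> borel_measurable unit_measure" for N
    using synth_partial_L2[of w N] by (simp add: L2_def)
  show "synth w \<in> L2"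
    "(\<lambda>N. ipL (\<lambda>t. synth_partial w N t - synth w t) (\<lambda>t. synth_partial w N t - synth w t)) \<longlonglongrightarrow> 0"
    using L2_limit_bounded[OF m lim bound] by auto
qed

lemma ipL_synth_limit:
  assumes "w \<in> H1" "g \<in> L2"
  shows "(\<lambda>N. ipL (synth_partial w N) g) \<longlonglongrightarrow> ipL (synth w) g"
proof (rule L2.ip_tendsto)
  have "ipL (\<lambda>x. 0) (\<lambda>x. 0) = 0" by (simp add: ipL_def)
  then show "(\<lambda>n. ipL (\<lambda>x. g x - g x) (\<lambda>x. g x - g x)) \<longlonglongrightarrow> 0" by simp
qed (use assms synth_partial_L2 synth_limit in auto)

lemma hartley_synth:
  assumes "w \<in> H1"
  shows "hartley (synth w) = w"
proof
  fix k
  have "(\<lambda>N. ipL (synth_partial w N) (cas k)) \<longlonglongrightarrow> ipL (synth w) (cas k)"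
    by (rule ipL_synth_limit[OF assms cas_L2])
  moreover have "\<forall>\<^sub>F N in sequentially. ipL (synth_partial w N) (cas k) = w k"
    using eventually_ge_at_top[of "nat \<bar>k\<bar>"]
  proof eventually_elim
    case (elim N)
    have "ipL (synth_partial w N) (cas k) = (\<Sum>j\<in>{- int N..int N}. w j * ipL (cas j) (cas k))"
      unfolding synth_partial_def by (rule L2.ip_sum_left) (auto simp: cas_L2)
    also have "\<dots> = (\<Sum>j\<in>{- int N..int N}. if j = k then w j else 0)"
      by (intro sum.cong) (auto simp: cas_orthonormal)
    also have "\<dots> = w k" using elim by auto
    finally show ?case .
  qed
  ultimately show "hartley (synth w) k = w k"
    unfolding hartley_def by (metis LIMSEQ_unique tendsto_eventually)
qed

lemma synth_norm:
  assumes "w \<in> H1"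
  shows "ipL (synth w) (synth w) = ip2 w w"
proof (rule LIMSEQ_unique)
  show "(\<lambda>N. ipL (synth_partial w N) (synth w)) \<longlonglongrightarrow> ipL (synth w) (synth w)"
    by (rule ipL_synth_limit[OF assms synth_limit(1)[OF assms]])
  have "ipL (synth_partial w N) (synth w) = (\<Sum>k\<in>{- int N..int N - 0}. w k * w k)" for N
  proof -
    have "ipL (synth_partial w N) (synth w) = (\<Sum>k\<in>{- int N..int N}. w k * ipL (cas k) (synth w))"
      unfolding synth_partial_def by (rule L2.ip_sum_left) (auto simp: cas_L2 synth_limit assms)
    also have "\<dots> = (\<Sum>k\<in>{- int N..int N}. w k * hartley (synth w) k)"
      by (simp add: hartley_def L2.ip_commute[of "cas _" "synth w"])
    finally show ?thesis by (simp add: hartley_synth[OF assms])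
  qed
  then show "(\<lambda>N. ipL (synth_partial w N) (synth w)) \<longlonglongrightarrow> ip2 w w"
    unfolding ip2_def using assms
    by (simp only:) (intro sum_symmetric_intervals_tendsto l2_mult_summable, auto simp: H1_def)
qed

text \<open>A function and the series built from its coefficients have the same Hartley transform,
  so they agree almost everywhere; the norm of the series is the limit over its partial
  sums.\<close>

lemma H1_parseval:
  assumes "f \<in> L2" "hartley f \<in> H1"
  shows "AE t in unit_measure. f t = synth (hartley f) t" "ipL f f = ip2 (hartley f) (hartley f)"
proof -
  let ?s = "synth (hartley f)"
  have s: "?s \<in> L2" "hartley ?s = hartley f" using synth_limit hartley_synth assms by auto
  show ae: "AE t in unit_measure. f t = ?s t" by (rule hartley_inject_AE) (use assms s in auto)
  have "ipL f f = ipL ?s f" by (rule ipL_cong_AE[OF assms(1) s(1) assms(1) ae])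
  also have "\<dots> = ipL f ?s" by (rule L2.ip_commute)
  also have "\<dots> = ipL ?s ?s" by (rule ipL_cong_AE[OF assms(1) s(1) s(1) ae])
  finally show "ipL f f = ip2 (hartley f) (hartley f)" by (simp add: synth_norm assms)
qed

section \<open>Differentiation in coefficients\<close>

lemma periodic_test_function_cas: "periodic_test_function (cas k)"
proof -
  have d: "deriv (\<lambda>t. c * cas k t) = (\<lambda>t. (c * (- 2 * pi * of_int k)) * cas (- k) t)" for c k
    by (rule ext, rule DERIV_imp_deriv) (rule derivative_eq_intros cas_derivative refl | simp)+
  have "\<exists>c j. (deriv ^^ m) (cas k) = (\<lambda>t. c * cas j t)" for m
  proof (induction m)
    case 0
    show ?case by (intro exI[of _ 1] exI[of _ k]) simp
  next
    case (Suc m)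
    then obtain c j where "(deriv ^^ m) (cas k) = (\<lambda>t. c * cas j t)" by blast
    then have "(deriv ^^ Suc m) (cas k) = (\<lambda>t. (c * (- 2 * pi * of_int j)) * cas (- j) t)" using d by simp
    then show ?case by blast
  qed
  moreover have "(\<lambda>t. c * cas j t) differentiable_on UNIV" for c j
    by (intro differentiable_on_mult differentiable_on_const)
      (auto simp: differentiable_on_def intro: differentiableI has_field_derivative_imp_has_derivative[OF cas_derivative])
  moreover have "cas k (t + 1) = cas k t" for t
  proof -
    have "2 * pi * of_int k * (t + 1) = 2 * pi * of_int k * t + 2 * pi * of_int k" by (simp add: algebra_simps)
    then show ?thesis
      unfolding cas_def by (simp only: cos_add sin_add) (use sin_int_2pin[of k] cos_int_2pin[of k] in simp)
  qed
  ultimately show ?thesis unfolding periodic_test_function_def by metis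
qed

text \<open>Test against \<open>cas k\<close>. Its derivative is a multiple of
  \<open>cas (- k)\<close>, which explains the reflected index.\<close>

lemma hartley_weak_deriv:
  assumes "has_weak_deriv f g"
  shows "hartley g k = 2 * pi * of_int k * hartley f (- k)"
proof -
  have f: "f \<in> L2" and g: "g \<in> L2" using assms by (auto simp: has_weak_deriv_def)
  have d: "deriv (cas k) = (\<lambda>t. (- 2 * pi * of_int k) * cas (- k) t)"
    using DERIV_imp_deriv[OF cas_derivative] by blast
  have "ipL f (deriv (cas k)) = - ipL g (cas k)"
    using assms periodic_test_function_cas by (auto simp: has_weak_deriv_def ipL_def)
  then have "(- 2 * pi * of_int k) * ipL f (cas (- k)) = - ipL g (cas k)"
    unfolding d L2.ip_scale_right[OF cas_L2 f] .
  then show ?thesis by (simp add: hartley_def)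
qed

text \<open>Both factors have period 1, so the boundary terms cancel.\<close>

lemma cas_integration_by_parts:
  assumes "periodic_test_function \<psi>"
  shows "ipL (cas k) (deriv \<psi>) = 2 * pi * of_int k * ipL (cas (- k)) \<psi>" "\<psi> \<in> L2" "deriv \<psi> \<in> L2"
proof -
  have "(deriv ^^ 0) \<psi> differentiable_on UNIV" "(deriv ^^ 1) \<psi> differentiable_on UNIV"
    using assms unfolding periodic_test_function_def by blast+
  then have dif: "\<psi> differentiable_on UNIV" "deriv \<psi> differentiable_on UNIV" by simp_all
  have c: "continuous_on {0..1} \<psi>" "continuous_on {0..1} (deriv \<psi>)"
    using dif[THEN differentiable_imp_continuous_on] continuous_on_subset by blast+
  show L2: "\<psi> \<in> L2" "deriv \<psi> \<in> L2" using continuous_L2(1)[OF c(1)] continuous_L2(1)[OF c(2)] by auto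
  have D: "(\<psi> has_real_derivative deriv \<psi> t) (at t)" for t
    using dif(1) by (simp add: DERIV_deriv_iff_real_differentiable differentiable_on_def)
  let ?F = "\<lambda>t. cas k t * deriv \<psi> t + (- 2 * pi * of_int k) * (cas (- k) t * \<psi> t)"
  have "(?F has_integral (cas k 1 * \<psi> 1 - cas k 0 * \<psi> 0)) {0..1}"
  proof (rule fundamental_theorem_of_calculus)
    fix t :: real
    have "((\<lambda>t. cas k t * \<psi> t) has_real_derivative ?F t) (at t within {0..1})"
      by (rule derivative_eq_intros cas_derivative has_field_derivative_at_within[OF D] refl | simp)+
    then show "((\<lambda>t. cas k t * \<psi> t) has_vector_derivative ?F t) (at t within {0..1})"
      by (simp add: has_real_derivative_iff_has_vector_derivative)
  qed simp
  moreover have "\<psi> 1 = \<psi> 0" using assms unfolding periodic_test_function_def by (metis add_0)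
  moreover have "cas k 1 = cas k 0"
    using periodic_test_function_cas[of k] unfolding periodic_test_function_def by (metis add_0)
  ultimately have "integral {0..1} ?F = 0" by (simp add: integral_unique)
  moreover have "integrable unit_measure ?F"
    by (intro continuous_L2(2) continuous_intros continuous_cas c)
  ultimately have "(\<integral>t. ?F t \<partial>unit_measure) = 0"
    using lebesgue_integral_eq_integral[of "{0..1}" ?F] by simp
  moreover have "(\<integral>t. ?F t \<partial>unit_measure) = ipL (cas k) (deriv \<psi>) + (- 2 * pi * of_int k) * ipL (cas (- k)) \<psi>"
    unfolding ipL_def using L2_mult_integrable[OF cas_L2 L2(1), of "- k"] L2_mult_integrable[OF cas_L2 L2(2), of k] by simp
  ultimately show "ipL (cas k) (deriv \<psi>) = 2 * pi * of_int k * ipL (cas (- k)) \<psi>" by simp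
qed

text \<open>The Hartley form of multiplying Fourier coefficients by \<open>2 pi i k\<close>: the
  imaginary unit becomes a reflection of the index.\<close>

definition derivative_coeffs :: "(int \<Rightarrow> real) \<Rightarrow> int \<Rightarrow> real" where
  "derivative_coeffs w k = 2 * pi * of_int k * w (- k)"

lemma derivative_coeffs_facts:
  assumes "w \<in> H1"
  shows "derivative_coeffs w \<in> l2"
    "ip2 (derivative_coeffs w) (derivative_coeffs w) = 4 * pi\<^sup>2 * ip2 (\<lambda>k. of_int k * w k) (\<lambda>k. of_int k * w k)"
proof -
  let ?v = "\<lambda>k. of_int k * w k"
  have v: "?v \<in> l2" using assms by (simp add: H1_def)
  have eq: "derivative_coeffs w = (\<lambda>k. (- 2 * pi) * ?v (- k))"
    by (auto simp: derivative_coeffs_def)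
  have v': "(\<lambda>k. ?v (- k)) \<in> l2" by (rule l2_reindex[OF v bij_int_uminus])
  then show "derivative_coeffs w \<in> l2" unfolding eq by (rule l2.scale_mem)
  have "ip2 (derivative_coeffs w) (derivative_coeffs w) = (- 2 * pi) * ((- 2 * pi) * ip2 (\<lambda>k. ?v (- k)) (\<lambda>k. ?v (- k)))"
    unfolding eq using v' l2.scale_mem[OF v'] by (simp only: l2.ip_scale_left l2.ip_scale_right)
  then show "ip2 (derivative_coeffs w) (derivative_coeffs w) = 4 * pi\<^sup>2 * ip2 ?v ?v"
    unfolding ip2_reindex[OF bij_int_uminus, of ?v ?v] by (simp add: power2_eq_square)
qed

text \<open>The condition places the differentiated coefficients in \<open>H1\<close>, so that the
  derivative is itself an absolutely convergent series.\<close>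

definition H2 :: "(int \<Rightarrow> real) set" where
  "H2 = {v \<in> H1. (\<lambda>k. (of_int k)\<^sup>2 * v k) \<in> l2}"

lemma derivative_coeffs_H1:
  assumes "w \<in> H2"
  shows "derivative_coeffs w \<in> H1"
proof -
  have "(\<lambda>k. (2 * pi) * ((\<lambda>k. (of_int k)\<^sup>2 * w k) (- k))) \<in> l2"
    using assms by (intro l2.scale_mem l2_reindex[OF _ bij_int_uminus]) (simp add: H2_def)
  moreover have "(2 * pi) * ((\<lambda>k. (of_int k)\<^sup>2 * w k) (- k)) = of_int k * derivative_coeffs w k" for k
    by (simp add: derivative_coeffs_def power2_eq_square)
  ultimately show ?thesis using derivative_coeffs_facts(1)[of w] assms by (simp add: H1_def H2_def)
qed

text \<open>Partial sums are integrated by parts term by term against the test function; both sides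
  converge because the coefficient sequence and its derivative sequence lie in
  \<open>H1\<close>.\<close>

lemma H2_has_weak_deriv:
  assumes f: "f \<in> L2" "hartley f \<in> H2"
  shows "has_weak_deriv f (synth (derivative_coeffs (hartley f)))"
  unfolding has_weak_deriv_def
proof (intro conjI allI impI f(1))
  let ?w = "hartley f"
  let ?w' = "derivative_coeffs ?w"
  have H: "?w \<in> H1" "?w' \<in> H1" using f derivative_coeffs_H1 by (auto simp: H2_def)
  show "synth ?w' \<in> L2" by (rule synth_limit(1)[OF H(2)])
  fix \<psi> assume \<psi>: "periodic_test_function \<psi>"
  note parts = cas_integration_by_parts[OF \<psi>]
  have "ipL (synth_partial ?w N) (deriv \<psi>) = - ipL (synth_partial ?w' N) \<psi>" for N
  proof -
    have "ipL (synth_partial ?w N) (deriv \<psi>) = (\<Sum>k\<in>{- int N..int N}. ?w k * ipL (cas k) (deriv \<psi>))"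
      unfolding synth_partial_def by (rule L2.ip_sum_left) (auto simp: cas_L2 parts)
    \<comment> \<open>Differentiation moves the index \<open>k\<close> to \<open>- k\<close>;
      reflecting the symmetric interval undoes this.\<close>
    also have "\<dots> = (\<Sum>k\<in>{- int N..int N}. - (?w' (- k) * ipL (cas (- k)) \<psi>))"
      by (intro sum.cong) (auto simp: parts derivative_coeffs_def)
    also have "\<dots> = (\<Sum>k\<in>{- int N..int N}. - (?w' k * ipL (cas k) \<psi>))"
      by (rule sum.reindex_bij_witness[of _ uminus uminus]) auto
    also have "\<dots> = - ipL (synth_partial ?w' N) \<psi>"
      unfolding synth_partial_def by (subst L2.ip_sum_left) (auto simp: cas_L2 parts sum_negf)
    finally show ?thesis .
  qed
  then have "(\<lambda>N. - ipL (synth_partial ?w' N) \<psi>) \<longlonglongrightarrow> ipL (synth ?w) (deriv \<psi>)"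
    using ipL_synth_limit[OF H(1) parts(3)] by simp
  moreover have "(\<lambda>N. - ipL (synth_partial ?w' N) \<psi>) \<longlonglongrightarrow> - ipL (synth ?w') \<psi>"
    by (intro tendsto_minus ipL_synth_limit H parts)
  ultimately have "ipL (synth ?w) (deriv \<psi>) = - ipL (synth ?w') \<psi>" by (rule LIMSEQ_unique)
  moreover have "ipL f (deriv \<psi>) = ipL (synth ?w) (deriv \<psi>)"
    by (rule ipL_cong_AE[OF f(1) synth_limit(1)[OF H(1)] parts(3) H1_parseval(1)[OF f(1) H(1)]])
  ultimately show "(\<integral>t. f t * deriv \<psi> t \<partial>unit_measure) = - (\<integral>t. synth ?w' t * \<psi> t \<partial>unit_measure)"
    by (simp add: ipL_def)
qed

lemma sobolev_weak_deriv:
  assumes "f \<in> sobolev"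
  shows "has_weak_deriv f (weak_deriv f)" "f \<in> L2"
  using assms someI_ex[of "has_weak_deriv f"] by (auto simp: sobolev_def weak_deriv_def)

lemma hartley_weak_deriv_eq: "has_weak_deriv f g \<Longrightarrow> hartley g = derivative_coeffs (hartley f)"
  using hartley_weak_deriv by (auto simp: derivative_coeffs_def)

lemma sobolev_hartley_H1:
  assumes "f \<in> sobolev"
  shows "hartley f \<in> H1"
proof -
  note d = sobolev_weak_deriv[OF assms]
  have "hartley (weak_deriv f) \<in> l2" using d(1) by (intro hartley_bessel) (simp add: has_weak_deriv_def)
  then have "(\<lambda>k. (- 1 / (2 * pi)) * derivative_coeffs (hartley f) (- k)) \<in> l2"
    unfolding hartley_weak_deriv_eq[OF d(1)] by (intro l2.scale_mem l2_reindex[OF _ bij_int_uminus])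
  moreover have "(- 1 / (2 * pi)) * derivative_coeffs (hartley f) (- k) = of_int k * hartley f k" for k
    by (simp add: derivative_coeffs_def)
  ultimately show ?thesis using hartley_bessel(1)[OF d(2)] by (simp add: H1_def)
qed

definition spectral_variation :: "real \<Rightarrow> (real \<Rightarrow> real) \<Rightarrow> real" where
  "spectral_variation \<alpha> f = \<alpha> / (4 * pi\<^sup>2) * (L2norm (weak_deriv f))\<^sup>2 +
     (\<Sum>\<^sub>\<infinity>k. (cmod (fourier f (k + 1) - fourier f k))\<^sup>2)"

lemma energy_split:
  assumes "v \<in> H1"
  shows "energy \<alpha> v = \<alpha> * ip2 (\<lambda>k. of_int k * v k) (\<lambda>k. of_int k * v k) + (\<Sum>\<^sub>\<infinity>k. (v (k + 1) - v k)\<^sup>2)"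
proof -
  have "(\<Sum>\<^sub>\<infinity>k. \<alpha> * (of_int k * v k)\<^sup>2) = \<alpha> * ip2 (\<lambda>k. of_int k * v k) (\<lambda>k. of_int k * v k)"
    unfolding ip2_def infsum_cmult_right' by (simp add: power2_eq_square)
  then show ?thesis
    unfolding energy_def infsum_add[OF energy_summable(1,2)[OF assms]] by simp
qed

text \<open>Bessel's inequality for the weak derivative goes in the direction required for
  competitors in a minimisation; the difference part is an exact identity.\<close>

lemma spectral_variation_ge:
  assumes "f \<in> sobolev" "\<alpha> > 0"
  shows "energy \<alpha> (hartley f) \<le> spectral_variation \<alpha> f"
proof -
  note d = sobolev_weak_deriv[OF assms(1)] and H = sobolev_hartley_H1[OF assms(1)]
  have "ip2 (hartley (weak_deriv f)) (hartley (weak_deriv f)) \<le> ipL (weak_deriv f) (weak_deriv f)"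
    using d(1) by (intro hartley_bessel) (simp add: has_weak_deriv_def)
  then have "\<alpha> / (4 * pi\<^sup>2) * (4 * pi\<^sup>2 * ip2 (\<lambda>k. of_int k * hartley f k) (\<lambda>k. of_int k * hartley f k))
      \<le> \<alpha> / (4 * pi\<^sup>2) * (L2norm (weak_deriv f))\<^sup>2"
    using assms(2) unfolding hartley_weak_deriv_eq[OF d(1)] derivative_coeffs_facts(2)[OF H] L2norm_eq(2)
    by (intro mult_left_mono) auto
  then show ?thesis
    unfolding spectral_variation_def energy_split[OF H] fourier_difference_sum[OF d(2)] by simp
qed

text \<open>\<open>weak_deriv\<close> picks some weak derivative, but its coefficients are
  determined and lie in \<open>H1\<close>, so Parseval's identity holds for it and the bound becomes
  an equality.\<close>

lemma H2_spectral_variation: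
  assumes f: "f \<in> L2" "hartley f \<in> H2"
  shows "f \<in> sobolev" "spectral_variation \<alpha> f = energy \<alpha> (hartley f)"
proof -
  have H: "hartley f \<in> H1" using f by (simp add: H2_def)
  show s: "f \<in> sobolev"
    using H2_has_weak_deriv[OF f] f(1) by (auto simp: sobolev_def has_weak_deriv_def)
  note d = sobolev_weak_deriv(1)[OF s]
  have "ipL (weak_deriv f) (weak_deriv f) = ip2 (hartley (weak_deriv f)) (hartley (weak_deriv f))"
  proof (rule H1_parseval(2))
    show "weak_deriv f \<in> L2" using d by (simp add: has_weak_deriv_def)
    show "hartley (weak_deriv f) \<in> H1"
      unfolding hartley_weak_deriv_eq[OF d] by (rule derivative_coeffs_H1[OF f(2)])
  qed
  then have "(L2norm (weak_deriv f))\<^sup>2 = 4 * pi\<^sup>2 * ip2 (\<lambda>k. of_int k * hartley f k) (\<lambda>k. of_int k * hartley f k)"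
    unfolding L2norm_eq(2) hartley_weak_deriv_eq[OF d] derivative_coeffs_facts(2)[OF H] .
  then show "spectral_variation \<alpha> f = energy \<alpha> (hartley f)"
    unfolding spectral_variation_def energy_split[OF H] fourier_difference_sum[OF f(1)] by simp
qed

section \<open>Isometries in coefficients\<close>

lemma has_sum_finite_sum:
  fixes f :: "'c \<Rightarrow> 'k \<Rightarrow> real"
  assumes "finite C" "\<And>c. c \<in> C \<Longrightarrow> (f c has_sum a c) A"
  shows "((\<lambda>k. \<Sum>c\<in>C. f c k) has_sum (\<Sum>c\<in>C. a c)) A"
  using assms by (induction C rule: finite_induct) (auto intro: has_sum_add)

lemma H1_sum: "(\<And>i. i \<in> I \<Longrightarrow> w i \<in> H1) \<Longrightarrow> (\<lambda>k. \<Sum>i\<in>I. c i * w i k) \<in> H1"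
  using l2.sum_mem[of I w c] l2.sum_mem[of I "\<lambda>i k. of_int k * w i k" c]
  by (simp add: H1_def sum_distrib_left mult.left_commute)

lemma H2_sum: "(\<And>i. i \<in> I \<Longrightarrow> w i \<in> H2) \<Longrightarrow> (\<lambda>k. \<Sum>i\<in>I. c i * w i k) \<in> H2"
  using H1_sum[of I w c] l2.sum_mem[of I "\<lambda>i k. (of_int k)\<^sup>2 * w i k" c]
  by (simp add: H2_def sum_distrib_left mult.left_commute)

lemma finite_support_H2: "finite S \<Longrightarrow> (\<And>k. k \<notin> S \<Longrightarrow> f k = 0) \<Longrightarrow> f \<in> H2"
  using finite_support_H1[of S f] finite_support_l2[of S "\<lambda>k. (of_int k)\<^sup>2 * f k"] by (auto simp: H2_def)

lemma sum_by_parts: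
  fixes s c :: "nat \<Rightarrow> real"
  shows "(\<Sum>i<n. s i * c i) = (\<Sum>i<n. (s i - s (Suc i)) * (\<Sum>j<Suc i. c j)) + s n * (\<Sum>j<n. c j)"
  by (induction n) (simp_all add: algebra_simps)

context
  fixes x :: "'n::finite \<Rightarrow> real ^ 'd"
begin

abbreviation sv :: "nat \<Rightarrow> real" where
  "sv i \<equiv> (singular_value (data_matrix x) i)\<^sup>2"

lemma MSSQV_eq: "MSSQV \<alpha> x \<Phi> = 1 / real CARD('n) * (\<Sum>i\<in>UNIV. spectral_variation \<alpha> (\<Phi> (x i)))"
  by (simp add: MSSQV_def spectral_variation_def)

text \<open>For each \<open>k\<close> the energy density is a weighted sum of squares of linear
  functionals of the sequence, so the diagonalisation over the data applies before summing over
  \<open>k\<close>.\<close>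

lemma sum_energy_data:
  assumes u: "left_singular_basis (data_matrix x) u" and w: "\<And>i. i < CARD('d) \<Longrightarrow> w i \<in> H1"
  shows "(\<Sum>c\<in>UNIV. energy \<alpha> (\<lambda>k. \<Sum>i<CARD('d). (u i \<bullet> x c) * w i k)) = (\<Sum>i<CARD('d). sv i * energy \<alpha> (w i))"
proof -
  let ?v = "\<lambda>c k. \<Sum>i<CARD('d). (u i \<bullet> x c) * w i k"
  let ?g = "\<lambda>v k. \<alpha> * (of_int k * v k)\<^sup>2 + (v (k + 1) - v k)\<^sup>2 :: real"
  have s: "(?g v has_sum energy \<alpha> v) UNIV" if "v \<in> H1" for v
    unfolding energy_def by (intro has_sum_infsum energy_summable that)
  have "((\<lambda>k. \<Sum>c\<in>UNIV. ?g (?v c) k) has_sum (\<Sum>c\<in>UNIV. energy \<alpha> (?v c))) UNIV"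
    using w by (intro has_sum_finite_sum s H1_sum) auto
  moreover have "((\<lambda>k. \<Sum>i<CARD('d). sv i * ?g (w i) k) has_sum (\<Sum>i<CARD('d). sv i * energy \<alpha> (w i))) UNIV"
    using w by (intro has_sum_finite_sum has_sum_cmult_right s) auto
  moreover have "(\<Sum>c\<in>UNIV. ?g (?v c) k) = (\<Sum>i<CARD('d). sv i * ?g (w i) k)" for k
  proof -
    have "(\<Sum>c\<in>UNIV. ?g (?v c) k) = \<alpha> * (\<Sum>c\<in>UNIV. (\<Sum>i<CARD('d). (u i \<bullet> x c) * (of_int k * w i k))\<^sup>2)
        + (\<Sum>c\<in>UNIV. (\<Sum>i<CARD('d). (u i \<bullet> x c) * (w i (k + 1) - w i k))\<^sup>2)"
      by (simp add: sum.distrib sum_distrib_left right_diff_distrib sum_subtractf mult.left_commute)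
    also have "\<dots> = (\<Sum>i<CARD('d). sv i * ?g (w i) k)"
      unfolding left_singular_basis_sum_squares[OF u]
      by (simp add: sum_distrib_left sum.distrib[symmetric] distrib_left mult.left_commute)
    finally show ?thesis .
  qed
  ultimately show ?thesis by (simp add: has_sum_unique)
qed

text \<open>An isometry is linear only up to null sets depending on the arguments; its Hartley
  coefficients are linear without exception. Parseval on the Sobolev space and polarisation then
  give an orthonormal family.\<close>

lemma isometry_coefficients:
  assumes \<Phi>: "\<Phi> \<in> isometries" and u: "orthonormal_family (u :: nat \<Rightarrow> real ^ 'd)"
  shows "hartley (\<Phi> y) \<in> H1"
    "hartley (\<Phi> y) = (\<lambda>k. \<Sum>i<CARD('d). (u i \<bullet> y) * hartley (\<Phi> (u i)) k)"
    "l2.orthonormal_on {..<CARD('d)} (\<lambda>i. hartley (\<Phi> (u i)))"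
proof -
  have sob: "\<Phi> y \<in> sobolev" for y using \<Phi> by (simp add: isometries_def)
  then have L2: "\<Phi> y \<in> L2" for y by (simp add: sobolev_def)
  show H1: "hartley (\<Phi> y) \<in> H1" for y using sobolev_hartley_H1[OF sob] .
  then have l2: "hartley (\<Phi> y) \<in> l2" for y by (simp add: H1_def)
  have add: "hartley (\<Phi> (y + z)) = (\<lambda>k. 1 * hartley (\<Phi> y) k + hartley (\<Phi> z) k)" for y z
  proof -
    have "hartley (\<Phi> (y + z)) = hartley (\<lambda>t. 1 * \<Phi> y t + \<Phi> z t)"
      using \<Phi> by (intro hartley_cong_AE L2 L2.lincomb_mem) (simp add: isometries_def)
    then show ?thesis by (simp only: hartley_lincomb L2)
  qed
  have scale: "hartley (\<Phi> (c *\<^sub>R y)) = (\<lambda>k. c * hartley (\<Phi> y) k)" for c y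
  proof -
    have "hartley (\<Phi> (c *\<^sub>R y)) = hartley (\<lambda>t. c * \<Phi> y t)"
      using \<Phi> by (intro hartley_cong_AE L2 L2.scale_mem) (simp add: isometries_def)
    then show ?thesis unfolding hartley_def by (simp add: L2.ip_scale_left L2 cas_L2)
  qed
  have lin: "linear (\<lambda>y. hartley (\<Phi> y) k)" for k
    by (rule linearI) (simp_all add: add scale)
  have "hartley (\<Phi> y) k = (\<Sum>i<CARD('d). (u i \<bullet> y) * hartley (\<Phi> (u i)) k)" for k
    by (subst orthonormal_family_expansion[OF u, of y]) (simp add: linear_sum[OF lin] scale)
  then show "hartley (\<Phi> y) = (\<lambda>k. \<Sum>i<CARD('d). (u i \<bullet> y) * hartley (\<Phi> (u i)) k)" by auto
  have norm: "ip2 (hartley (\<Phi> y)) (hartley (\<Phi> y)) = y \<bullet> y" for y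
  proof -
    have "L2norm (\<Phi> y) = norm y" using \<Phi> by (simp add: isometries_def)
    then have "ipL (\<Phi> y) (\<Phi> y) = y \<bullet> y" using L2norm_eq(2)[of "\<Phi> y"] by (simp add: power2_norm_eq_inner)
    then show ?thesis using H1_parseval(2)[OF L2 H1] by simp
  qed
  have "ip2 (hartley (\<Phi> y)) (hartley (\<Phi> z)) = y \<bullet> z" for y z
  proof -
    have "ip2 (hartley (\<Phi> (y + z))) (hartley (\<Phi> (y + z)))
        = y \<bullet> y + 2 * ip2 (hartley (\<Phi> y)) (hartley (\<Phi> z)) + z \<bullet> z"
      unfolding add using l2 l2.lincomb_mem[OF l2 l2, of 1 y z] norm
      by (simp only: l2.ip_lincomb_left l2.ip_lincomb_right l2.ip_commute[of "hartley (\<Phi> z)" "hartley (\<Phi> y)"]) simp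
    then show ?thesis unfolding norm by (simp add: inner_add_left inner_add_right inner_commute)
  qed
  then show "l2.orthonormal_on {..<CARD('d)} (\<lambda>i. hartley (\<Phi> (u i)))"
    using l2 u by (auto simp: l2.orthonormal_on_def orthonormal_family_def)
qed

lemma isometry_MSSQV_ge:
  assumes \<Phi>: "\<Phi> \<in> isometries" and u: "left_singular_basis (data_matrix x) u" and \<alpha>: "\<alpha> > 0"
  shows "1 / real CARD('n) * (\<Sum>i<CARD('d). sv i * energy \<alpha> (hartley (\<Phi> (u i)))) \<le> MSSQV \<alpha> x \<Phi>"
proof -
  note co = isometry_coefficients[OF \<Phi> left_singular_basisD(1)[OF u]]
  have co': "hartley (\<Phi> (x c)) = (\<lambda>k. \<Sum>i<CARD('d). (u i \<bullet> x c) * hartley (\<Phi> (u i)) k)" for c by (rule co(2))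
  have "(\<Sum>i<CARD('d). sv i * energy \<alpha> (hartley (\<Phi> (u i)))) = (\<Sum>c\<in>UNIV. energy \<alpha> (hartley (\<Phi> (x c))))"
    unfolding co' by (rule sum_energy_data[OF u co(1), symmetric])
  also have "\<dots> \<le> (\<Sum>c\<in>UNIV. spectral_variation \<alpha> (\<Phi> (x c)))"
    using \<Phi> \<alpha> by (intro sum_mono spectral_variation_ge) (auto simp: isometries_def)
  finally show ?thesis unfolding MSSQV_eq by (intro mult_left_mono) auto
qed

text \<open>Only the coefficients of \<Phi> are prescribed, so the lemma covers truncated isometries
  as well as limits that are known merely up to null sets.\<close>

lemma isometry_from_coefficients:
  assumes u: "orthonormal_family (u :: nat \<Rightarrow> real ^ 'd)" and w: "\<And>i. i < CARD('d) \<Longrightarrow> w i \<in> H2"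
    and orth: "l2.orthonormal_on {..<CARD('d)} w" and L2: "\<And>y. \<Phi> y \<in> L2"
    and co: "\<And>y. hartley (\<Phi> y) = (\<lambda>k. \<Sum>i<CARD('d). (u i \<bullet> y) * w i k)"
  shows "\<Phi> \<in> isometries"
    and "left_singular_basis (data_matrix x) u \<Longrightarrow>
      MSSQV \<alpha> x \<Phi> = 1 / real CARD('n) * (\<Sum>i<CARD('d). sv i * energy \<alpha> (w i))"
proof -
  have H2: "hartley (\<Phi> y) \<in> H2" for y unfolding co by (rule H2_sum) (use w in auto)
  then have H1: "hartley (\<Phi> y) \<in> H1" for y by (simp add: H2_def)
  show "\<Phi> \<in> isometries"
    unfolding isometries_def
  proof (intro CollectI conjI allI)
    show "\<Phi> y \<in> sobolev" for y by (rule H2_spectral_variation(1)[OF L2 H2])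
    show "AE t in unit_measure. \<Phi> (y + z) t = \<Phi> y t + \<Phi> z t" for y z
    proof -
      have "hartley (\<lambda>t. 1 * \<Phi> y t + \<Phi> z t) = hartley (\<Phi> (y + z))"
        unfolding hartley_lincomb[OF L2 L2] co by (simp add: inner_add_right distrib_right sum.distrib)
      then have "AE t in unit_measure. \<Phi> (y + z) t = 1 * \<Phi> y t + \<Phi> z t"
        by (intro hartley_inject_AE L2 L2.lincomb_mem) simp
      then show ?thesis by simp
    qed
    show "AE t in unit_measure. \<Phi> (c *\<^sub>R y) t = c * \<Phi> y t" for c y
    proof (intro hartley_inject_AE L2 L2.scale_mem)
      have "hartley (\<lambda>t. c * \<Phi> y t) = (\<lambda>k. c * hartley (\<Phi> y) k)"
        unfolding hartley_def by (simp add: L2.ip_scale_left L2 cas_L2)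
      then show "hartley (\<Phi> (c *\<^sub>R y)) = hartley (\<lambda>t. c * \<Phi> y t)"
        unfolding co by (simp add: sum_distrib_left mult.assoc)
    qed
    show "L2norm (\<Phi> y) = norm y" for y
    proof -
      have "ipL (\<Phi> y) (\<Phi> y) = y \<bullet> y"
        unfolding H1_parseval(2)[OF L2 H1] co l2.orthonormal_combination[OF finite_lessThan orth]
        by (rule orthonormal_family_parseval[OF u])
      then show ?thesis by (simp add: L2norm_eq(1) norm_eq_sqrt_inner)
    qed
  qed
  assume lu: "left_singular_basis (data_matrix x) u"
  have "(\<Sum>c\<in>UNIV. spectral_variation \<alpha> (\<Phi> (x c))) = (\<Sum>c\<in>UNIV. energy \<alpha> (hartley (\<Phi> (x c))))"
    by (intro sum.cong refl H2_spectral_variation(2) L2 H2)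
  also have "\<dots> = (\<Sum>i<CARD('d). sv i * energy \<alpha> (w i))"
    unfolding co using w by (intro sum_energy_data[OF lu]) (simp add: H2_def)
  finally show "MSSQV \<alpha> x \<Phi> = 1 / real CARD('n) * (\<Sum>i<CARD('d). sv i * energy \<alpha> (w i))"
    unfolding MSSQV_eq by simp
qed

end

section \<open>Coefficients of the truncated isometries\<close>

context limiting_eigenbasis
begin

lemma limit_in_H2: "\<psi> i \<in> H2"
  using limit_H1 limit_H2 by (simp add: H2_def)

lemma ev_facts:
  assumes "i < 2 * N + 1"
  shows "ev N i \<in> H1" "ev N i \<in> l2" "ev N i \<in> H2" "energy \<alpha> (ev N i) = lam \<alpha> N i"
    "jacobi_eigen \<alpha> N (lam \<alpha> N i) (ev N i)" "ip2 (ev N i) (ev N i) = 1" "lam \<alpha> N i \<noteq> 0"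
  using eigenbasis_mem[OF alpha_pos eigenbasis assms] eigenbasis_energy[OF alpha_pos eigenbasis assms]
    eigenbasis[of N] assms lam_pos[OF alpha_pos assms]
    finite_support_H2[of "{- int N..int N}" "ev N i"] eigenbasis_outside[OF alpha_pos eigenbasis assms]
  by (auto simp: eigenbasis_def)

lemma ev_tendsto_shifted:
  "(\<lambda>N. ip2 (\<lambda>k. ev (N + m) i k - \<psi> i k) (\<lambda>k. ev (N + m) i k - \<psi> i k)) \<longlonglongrightarrow> 0"
  using LIMSEQ_ignore_initial_segment[OF ev_tendsto] .

lemma ev_pointwise: "(\<lambda>N. ev N i k) \<longlonglongrightarrow> \<psi> i k"
proof -
  have "(\<lambda>N. (ev (N + i) i k - \<psi> i k)\<^sup>2) \<longlonglongrightarrow> 0"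
  proof (rule tendsto_sandwich[OF _ _ tendsto_const ev_tendsto_shifted[of i i]])
    show "\<forall>\<^sub>F N in sequentially. (ev (N + i) i k - \<psi> i k)\<^sup>2
        \<le> ip2 (\<lambda>k. ev (N + i) i k - \<psi> i k) (\<lambda>k. ev (N + i) i k - \<psi> i k)"
    proof (intro always_eventually allI)
      fix N
      have "(\<lambda>k. ev (N + i) i k - \<psi> i k) \<in> l2" by (intro l2.diff_mem ev_facts limit_l2) simp
      from l2_square_le_ip2[OF this, of k]
      show "(ev (N + i) i k - \<psi> i k)\<^sup>2 \<le> ip2 (\<lambda>k. ev (N + i) i k - \<psi> i k) (\<lambda>k. ev (N + i) i k - \<psi> i k)" .
    qed
  qed simp
  then have "(\<lambda>N. ev (N + i) i k - \<psi> i k) \<longlonglongrightarrow> 0" by simp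
  then have "(\<lambda>N. ev (N + i) i k) \<longlonglongrightarrow> \<psi> i k" by (rule LIM_zero_cancel)
  then show ?thesis by (rule LIMSEQ_offset)
qed

text \<open>The eigenspaces are one-dimensional, and normalisation reduces the real factor to a
  sign. The signs may vary with \<open>N\<close>.\<close>

lemma B_eigenfamily_hartley:
  assumes \<phi>: "B_eigenfamily \<alpha> d \<phi>" and N: "N \<ge> d"
  obtains s where "\<And>i. i < d \<Longrightarrow> s i * s i = (1::real)" "\<And>i. i < d \<Longrightarrow> hartley (\<phi> N i) = (\<lambda>k. s i * ev N i k)"
proof -
  have "\<exists>s. s * s = 1 \<and> hartley (\<phi> N i) = (\<lambda>k. s * ev N i k)" if i: "i < d" for i
  proof -
    have i': "i < 2 * N + 1" using i N by simp
    have L2: "\<phi> N i \<in> L2" and eig: "fourier (\<phi> N i) \<in> B_eigenspace \<alpha> N (lam \<alpha> N i)"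
      and inner: "l2Z_inner (fourier (\<phi> N i)) (fourier (\<phi> N i)) = 1"
      using \<phi> N i by (auto simp: B_eigenfamily_def)
    have "jacobi_eigen \<alpha> N (lam \<alpha> N i) (hartley (\<phi> N i))"
      using eig fourier_eigen_iff[OF L2 ev_facts(7)[OF i']] by simp
    moreover have "ev N i \<noteq> (\<lambda>_. 0)" using ev_facts(6)[OF i'] by (auto simp: ip2_def)
    ultimately obtain s where s: "hartley (\<phi> N i) = (\<lambda>k. s * ev N i k)"
      using jacobi_eigen_proportional[OF ev_facts(5)[OF i']] by blast
    have "ip2 (hartley (\<phi> N i)) (hartley (\<phi> N i)) = 1"
      using inner l2Z_inner_fourier[OF L2 L2] by simp
    then have "s * s = 1"
      unfolding s using ev_facts(2,6)[OF i'] by (simp add: l2.ip_scale_left l2.ip_scale_right l2.scale_mem)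
    then show ?thesis using s by blast
  qed
  then show thesis using that by metis
qed

lemma B_eigenfamilyI:
  assumes \<phi>: "\<And>N i. i < d \<Longrightarrow> N \<ge> d \<Longrightarrow> \<phi> N i \<in> L2 \<and> hartley (\<phi> N i) = ev N i"
  shows "B_eigenfamily \<alpha> d \<phi>"
  unfolding B_eigenfamily_def
proof (intro allI impI conjI)
  fix N i assume N: "d \<le> N" and i: "i < d"
  then have i': "i < 2 * N + 1" by simp
  show "\<phi> N i \<in> L2" using \<phi> N i by blast
  show "fourier (\<phi> N i) \<in> B_eigenspace \<alpha> N (lam \<alpha> N i)"
    using fourier_eigen_iff[OF _ ev_facts(7)[OF i'], of "\<phi> N i" \<alpha> N] \<phi>[OF i N] ev_facts(5)[OF i'] by simp
  fix j assume j: "j < d"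
  show "l2Z_inner (fourier (\<phi> N i)) (fourier (\<phi> N j)) = (if i = j then 1 else 0)"
    using l2Z_inner_fourier[of "\<phi> N i" "\<phi> N j"] \<phi>[OF i N] \<phi>[OF j N] eigenbasis[of N] N i j
    by (auto simp: eigenbasis_def)
qed

text \<open>The unknown signs disappear from the objective because the energy is quadratic.\<close>

lemma truncated_isometry_facts:
  fixes x :: "'n::finite \<Rightarrow> real ^ 'd"
  assumes u: "left_singular_basis (data_matrix x) u" and \<phi>: "B_eigenfamily \<alpha> CARD('d) \<phi>" and N: "N \<ge> CARD('d)"
  shows "truncated_isometry u \<phi> N \<in> isometries"
    "MSSQV \<alpha> x (truncated_isometry u \<phi> N) = 1 / real CARD('n) * (\<Sum>i<CARD('d). sv x i * lam \<alpha> N i)"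
    "truncated_isometry u \<phi> N y \<in> L2"
    "hartley (truncated_isometry u \<phi> N y) = (\<lambda>k. \<Sum>i<CARD('d). (u i \<bullet> y) * hartley (\<phi> N i) k)"
proof -
  obtain s where s: "\<And>i. i < CARD('d) \<Longrightarrow> s i * s i = (1::real)"
    "\<And>i. i < CARD('d) \<Longrightarrow> hartley (\<phi> N i) = (\<lambda>k. s i * ev N i k)"
    using B_eigenfamily_hartley[OF \<phi> N] by blast
  have L2: "\<phi> N i \<in> L2" if "i < CARD('d)" for i using \<phi> N that by (auto simp: B_eigenfamily_def)
  have w: "(\<lambda>k. s i * ev N i k) \<in> H2" if "i < CARD('d)" for i
    using H2_sum[of "{()}" "\<lambda>_. ev N i" "\<lambda>_. s i"] ev_facts(3)[of i N] N that by simp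
  have "l2.orthonormal_on {..<CARD('d)} (ev N)"
    using N by (intro eigenbasis_orthonormal[OF alpha_pos eigenbasis]) simp
  then have orth: "l2.orthonormal_on {..<CARD('d)} (\<lambda>i k. s i * ev N i k)"
    by (rule l2.orthonormal_on_sign) (use s in auto)
  show L2t: "truncated_isometry u \<phi> N y \<in> L2" for y
    unfolding truncated_isometry_def using L2 by (intro L2.sum_mem) auto
  show co: "hartley (truncated_isometry u \<phi> N y) = (\<lambda>k. \<Sum>i<CARD('d). (u i \<bullet> y) * hartley (\<phi> N i) k)" for y
    unfolding truncated_isometry_def using L2 by (intro hartley_sum) auto
  have co': "hartley (truncated_isometry u \<phi> N y) = (\<lambda>k. \<Sum>i<CARD('d). (u i \<bullet> y) * (\<lambda>k. s i * ev N i k) k)" for y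
    unfolding co using s(2) by simp
  show "truncated_isometry u \<phi> N \<in> isometries"
    by (rule isometry_from_coefficients(1)[OF left_singular_basisD(1)[OF u] w orth L2t co'])
  have "MSSQV \<alpha> x (truncated_isometry u \<phi> N)
      = 1 / real CARD('n) * (\<Sum>i<CARD('d). sv x i * energy \<alpha> (\<lambda>k. s i * ev N i k))"
    by (rule isometry_from_coefficients(2)[OF left_singular_basisD(1)[OF u] w orth L2t co' u])
  also have "(\<Sum>i<CARD('d). sv x i * energy \<alpha> (\<lambda>k. s i * ev N i k)) = (\<Sum>i<CARD('d). sv x i * lam \<alpha> N i)"
    using s(1) N by (intro sum.cong refl) (simp add: energy_scale power2_eq_square ev_facts(4))
  finally show "MSSQV \<alpha> x (truncated_isometry u \<phi> N) = 1 / real CARD('n) * (\<Sum>i<CARD('d). sv x i * lam \<alpha> N i)" .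
qed

end

section \<open>Solutions of the program\<close>

text \<open>Extends the squared singular values by zero, so that the boundary term of the summation
  by parts vanishes and a positive last singular value also counts as a drop.\<close>

definition weight :: "('n::finite \<Rightarrow> real ^ 'd) \<Rightarrow> nat \<Rightarrow> real" where
  "weight x i = (if i < CARD('d) then (singular_value (data_matrix x) i)\<^sup>2 else 0)"

lemma weight_facts:
  fixes x :: "'n::finite \<Rightarrow> real ^ 'd"
  shows "weight x i \<ge> 0" "i \<le> j \<Longrightarrow> weight x j \<le> weight x i" "weight x CARD('d) = 0"
  using singular_value_antimono[of i j x] by (auto simp: weight_def)

text \<open>Take the first index where the weight falls below \<open>weight x i\<close>; its
  predecessor still carries that weight.\<close>

lemma weight_break:
  fixes x :: "'n::finite \<Rightarrow> real ^ 'd"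
  assumes "weight x j < weight x i" "i < j"
  obtains m where "i \<le> m" "m < j" "weight x (Suc m) < weight x m" "weight x m = weight x i"
proof -
  let ?P = "\<lambda>k. i < k \<and> weight x k < weight x i"
  define k where "k = (LEAST k. ?P k)"
  have j: "?P j" using assms by simp
  have k: "?P k" unfolding k_def by (rule LeastI[of ?P, OF j])
  have kj: "k \<le> j" unfolding k_def by (rule Least_le[of ?P, OF j])
  obtain m where m: "k = Suc m" "i \<le> m" using k by (cases k) auto
  have "\<not> ?P m" using not_less_Least[of m ?P] m(1) by (simp add: k_def)
  then have "weight x m = weight x i" using m(2) weight_facts(2)[of i m x] by (cases "i = m") auto
  then show thesis using that[of m] k kj m by auto
qed

context limiting_eigenbasis
begin

context
  fixes x :: "'n::finite \<Rightarrow> real ^ 'd"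
begin

abbreviation optimum :: real where
  "optimum \<equiv> 1 / real CARD('n) * (\<Sum>i<CARD('d). sv x i * L i)"

text \<open>Abel summation: the excess becomes a combination of the Ky Fan excesses of all leading
  families, with nonnegative weights.\<close>

lemma weighted_energy_by_parts:
  "(\<Sum>i<CARD('d). sv x i * energy \<alpha> (v i)) - (\<Sum>i<CARD('d). sv x i * L i)
    = (\<Sum>m<CARD('d). (weight x m - weight x (Suc m)) * ((\<Sum>i<Suc m. energy \<alpha> (v i)) - (\<Sum>i<Suc m. L i)))"
proof -
  have "(\<Sum>i<CARD('d). sv x i * energy \<alpha> (v i)) - (\<Sum>i<CARD('d). sv x i * L i)
      = (\<Sum>i<CARD('d). weight x i * (energy \<alpha> (v i) - L i))"
    by (simp add: sum_subtractf[symmetric] right_diff_distrib weight_def)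
  then show ?thesis
    using sum_by_parts[of "weight x" "\<lambda>i. energy \<alpha> (v i) - L i" "CARD('d)"]
    by (simp add: weight_facts(3) sum_subtractf del: sum.lessThan_Suc)
qed

context
  fixes v :: "nat \<Rightarrow> int \<Rightarrow> real"
  assumes orth: "l2.orthonormal_on {..<CARD('d)} v" and H1: "\<And>j. j < CARD('d) \<Longrightarrow> v j \<in> H1"
begin

lemma partial_energy_ge:
  assumes "m \<le> CARD('d)"
  shows "(\<Sum>i<m. L i) \<le> (\<Sum>i<m. energy \<alpha> (v i))"
  using assms orth H1 by (intro sum_limit_eigenvalues_le) (auto simp: l2.orthonormal_on_def)

lemma weighted_energy_ge:
  "(\<Sum>i<CARD('d). sv x i * L i) \<le> (\<Sum>i<CARD('d). sv x i * energy \<alpha> (v i))"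
proof -
  have "0 \<le> (weight x m - weight x (Suc m)) * ((\<Sum>i<Suc m. energy \<alpha> (v i)) - (\<Sum>i<Suc m. L i))"
    if "m < CARD('d)" for m
    using partial_energy_ge[of "Suc m"] weight_facts(2)[of m "Suc m" x] that
    by (intro mult_nonneg_nonneg) auto
  then have "0 \<le> (\<Sum>m<CARD('d). (weight x m - weight x (Suc m)) * ((\<Sum>i<Suc m. energy \<alpha> (v i)) - (\<Sum>i<Suc m. L i)))"
    by (intro sum_nonneg) auto
  then show ?thesis using weighted_energy_by_parts[of v] by simp
qed

context
  assumes minimal: "(\<Sum>i<CARD('d). sv x i * energy \<alpha> (v i)) = (\<Sum>i<CARD('d). sv x i * L i)"
begin

text \<open>A vanishing sum of nonnegative terms vanishes term by term; where the weight drops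
  strictly, the factor can be divided out.\<close>

lemma partial_energy_minimal:
  assumes m: "m < CARD('d)" "weight x (Suc m) < weight x m"
  shows "(\<Sum>i<Suc m. energy \<alpha> (v i)) = (\<Sum>i<Suc m. L i)"
proof -
  let ?t = "\<lambda>m. (weight x m - weight x (Suc m)) * ((\<Sum>i<Suc m. energy \<alpha> (v i)) - (\<Sum>i<Suc m. L i))"
  have nonneg: "0 \<le> ?t m" if "m < CARD('d)" for m
    using partial_energy_ge[of "Suc m"] weight_facts(2)[of m "Suc m" x] that
    by (intro mult_nonneg_nonneg) auto
  have "(\<Sum>m<CARD('d). ?t m) = 0" using weighted_energy_by_parts[of v] minimal by simp
  then have "\<forall>m\<in>{..<CARD('d)}. ?t m = 0"
    using nonneg by (subst (asm) sum_nonneg_eq_0_iff) auto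
  then have "?t m = 0" using m(1) by blast
  then show ?thesis using m(2) by simp
qed

abbreviation coupling :: "nat \<Rightarrow> nat \<Rightarrow> real" where
  "coupling i j \<equiv> ip2 (\<psi> i) (v j)"

lemma v_l2: "j < CARD('d) \<Longrightarrow> v j \<in> l2"
  using H1 by (auto simp: H1_def)

lemma coupling_row_le:
  assumes "J \<subseteq> {..<CARD('d)}"
  shows "(\<Sum>j\<in>J. (coupling i j)\<^sup>2) \<le> 1"
proof -
  have "l2.orthonormal_on J v" using orth subsetD[OF assms] by (auto simp: l2.orthonormal_on_def)
  then show ?thesis
    using l2.bessel_inequality[of J v "\<psi> i"] finite_subset[OF assms] limit_l2 limit_orthonormal[of i i] by simp
qed

lemma coupling_column_le:
  assumes "j < CARD('d)" "finite I"
  shows "(\<Sum>i\<in>I. (coupling i j)\<^sup>2) \<le> 1"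
proof -
  have "(\<Sum>i\<in>I. (ip2 (v j) (\<psi> i))\<^sup>2) \<le> ip2 (v j) (v j)"
    by (rule l2.bessel_inequality[OF assms(2) limit_orthonormal_on v_l2[OF assms(1)]])
  then show ?thesis using orth assms(1) by (simp add: l2.orthonormal_on_def l2.ip_commute[of "v j" "\<psi> _"])
qed

text \<open>
  Where the singular values drop, the first \<open>Suc m\<close> vectors \<open>v\<close> and \<open>\<psi>\<close> span the same space, so
  the coupling matrix is block diagonal with orthogonal blocks.
\<close>

context
  fixes m assumes m: "m < CARD('d)" "weight x (Suc m) < weight x m"
begin

lemma coupling_column:
  assumes "j \<le> m"
  shows "(\<Sum>i<Suc m. (coupling i j)\<^sup>2) = 1"
  using assms m orth H1 partial_energy_minimal[OF m]
  by (intro minimizers_in_limit_span) (auto simp: l2.orthonormal_on_def)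

lemma coupling_below:
  assumes "j \<le> m" "m < i"
  shows "coupling i j = 0"
proof -
  have "(\<Sum>i\<in>insert i {..<Suc m}. (coupling i j)\<^sup>2) \<le> 1"
    using assms m by (intro coupling_column_le) auto
  then have "(coupling i j)\<^sup>2 \<le> 0"
    using assms coupling_column[of j] by (simp del: sum.lessThan_Suc)
  then show ?thesis by simp
qed

text \<open>Double counting in the square block: its columns have unit length, so the total weight
  is \<open>Suc m\<close>; since its rows have length at most 1, they too must be of unit
  length.\<close>

lemma coupling_row:
  assumes "i \<le> m"
  shows "(\<Sum>j<Suc m. (coupling i j)\<^sup>2) = 1"
proof -
  have "(\<Sum>i<Suc m. 1 - (\<Sum>j<Suc m. (coupling i j)\<^sup>2)) = real (Suc m) - (\<Sum>i<Suc m. \<Sum>j<Suc m. (coupling i j)\<^sup>2)"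
    by (simp only: sum_subtractf) simp
  also have "(\<Sum>i<Suc m. \<Sum>j<Suc m. (coupling i j)\<^sup>2) = (\<Sum>j<Suc m. \<Sum>i<Suc m. (coupling i j)\<^sup>2)"
    by (rule sum.swap)
  also have "\<dots> = (\<Sum>j<Suc m. 1)" by (intro sum.cong refl coupling_column) simp
  finally have "(\<Sum>i<Suc m. 1 - (\<Sum>j<Suc m. (coupling i j)\<^sup>2)) = 0" by simp
  moreover have "0 \<le> 1 - (\<Sum>j<Suc m. (coupling i j)\<^sup>2)" for i
    using coupling_row_le[of "{..<Suc m}" i] m by (auto simp del: sum.lessThan_Suc)
  ultimately have "\<forall>i\<in>{..<Suc m}. 1 - (\<Sum>j<Suc m. (coupling i j)\<^sup>2) = 0"
    by (subst (asm) sum_nonneg_eq_0_iff) (auto simp del: sum.lessThan_Suc)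
  then show ?thesis using assms by (auto simp del: sum.lessThan_Suc)
qed

lemma coupling_above:
  assumes "i \<le> m" "m < j" "j < CARD('d)"
  shows "coupling i j = 0"
proof -
  have "(\<Sum>j\<in>insert j {..<Suc m}. (coupling i j)\<^sup>2) \<le> 1"
    using assms m by (intro coupling_row_le) auto
  then have "(coupling i j)\<^sup>2 \<le> 0"
    using assms coupling_row[of i] by (simp del: sum.lessThan_Suc)
  then show ?thesis by simp
qed

end

text \<open>Unequal singular values are separated by a drop, and no coupling crosses a drop in
  either direction.\<close>

lemma coupling_zero:
  assumes ij: "i < CARD('d)" "j < CARD('d)" and ne: "sv x i \<noteq> sv x j"
  shows "coupling i j = 0"
proof -
  have w: "weight x i \<noteq> weight x j" using ij ne by (simp add: weight_def)
  show ?thesis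
  proof (cases "i < j")
    case True
    then have "weight x j < weight x i" using w weight_facts(2)[of i j x] by simp
    then obtain m where "i \<le> m" "m < j" "weight x (Suc m) < weight x m" using weight_break True by metis
    then show ?thesis using coupling_above[of m i j] ij by simp
  next
    case False
    then have "j < i" using w by (cases "i = j") auto
    moreover have "weight x i < weight x j" using w weight_facts(2)[of j i x] False by simp
    ultimately obtain m where "j \<le> m" "m < i" "weight x (Suc m) < weight x m" using weight_break by metis
    then show ?thesis using coupling_below[of m j i] ij by simp
  qed
qed

text \<open>A positive singular value lies at or before some drop, because the weight is 0 at
  \<open>CARD('d)\<close>. Its row of the coupling has weight 1, so the Bessel defect of
  \<open>\<psi> i\<close> is zero.\<close>

lemma limit_expansion:
  assumes i: "i < CARD('d)" and pos: "sv x i \<noteq> 0"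
  shows "\<psi> i = (\<lambda>k. \<Sum>j<CARD('d). coupling i j * v j k)"
proof -
  have "weight x CARD('d) < weight x i" using i pos by (simp add: weight_def)
  then obtain m where m: "i \<le> m" "m < CARD('d)" "weight x (Suc m) < weight x m"
    using weight_break[of x "CARD('d)" i] i by metis
  have "1 = (\<Sum>j<Suc m. (coupling i j)\<^sup>2)" using coupling_row[OF m(2,3,1)] by simp
  also have "\<dots> \<le> (\<Sum>j<CARD('d). (coupling i j)\<^sup>2)" using m by (intro sum_mono2) auto
  finally have one: "(\<Sum>j<CARD('d). (coupling i j)\<^sup>2) = 1"
    using coupling_row_le[of "{..<CARD('d)}" i] by simp
  let ?g = "\<lambda>k. \<psi> i k - (\<Sum>j<CARD('d). coupling i j * v j k)"
  have "ip2 ?g ?g = 0"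
    using l2.bessel_defect[OF finite_lessThan orth limit_l2[of i]] one limit_orthonormal[of i i] by simp
  moreover have "?g \<in> l2" by (intro l2.diff_mem limit_l2 l2.sum_mem v_l2) simp
  ultimately have "?g = (\<lambda>_. 0)" by (rule ip2_self_zero[rotated])
  then show ?thesis by (auto simp: fun_eq_iff)
qed

text \<open>The coupling mixes only basis vectors with the same singular value, so the rotated
  vectors remain eigenvectors. They are orthonormal because the \<psi> with positive singular value
  lie in the span of \<open>v\<close>. For singular value 0 that may fail, and the old vectors are
  kept.\<close>

lemma rotated_singular_basis:
  assumes u0: "left_singular_basis (data_matrix x) u0"
  defines "u \<equiv> \<lambda>i. if sv x i \<noteq> 0 then (\<Sum>j<CARD('d). coupling i j *\<^sub>R u0 j) else u0 i"
  shows "left_singular_basis (data_matrix x) u"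
proof (rule left_singular_basisI(1))
  note o = left_singular_basisD(1)[OF u0]
  have inner_u0: "u0 i \<bullet> u0 j = (if i = j then 1 else 0)" if "i < CARD('d)" "j < CARD('d)" for i j
    using o that by (simp add: orthonormal_family_def)
  have c1: "(\<Sum>j<CARD('d). coupling i j *\<^sub>R u0 j) \<bullet> u0 l = coupling i l" if "l < CARD('d)" for i l
  proof -
    have "(\<Sum>j<CARD('d). coupling i j *\<^sub>R u0 j) \<bullet> u0 l = (\<Sum>j<CARD('d). if j = l then coupling i j else 0)"
      unfolding inner_sum_left inner_scaleR_left using that by (intro sum.cong) (auto simp: inner_u0)
    then show ?thesis using that by simp
  qed
  have c2: "(\<Sum>j<CARD('d). coupling i j *\<^sub>R u0 j) \<bullet> (\<Sum>j<CARD('d). coupling l j *\<^sub>R u0 j)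
      = (\<Sum>j<CARD('d). coupling i j * coupling l j)" for i l
    by (subst inner_sum_right) (auto simp: c1 mult.commute intro!: sum.cong)
  have c3: "(\<Sum>j<CARD('d). coupling i j * coupling l j) = (if i = l then 1 else 0)"
    if "i < CARD('d)" "l < CARD('d)" "sv x i \<noteq> 0" "sv x l \<noteq> 0" for i l
  proof -
    have "(\<Sum>j<CARD('d). coupling i j * coupling l j) = ip2 (\<psi> i) (\<psi> l)"
      using l2.orthonormal_combination[OF finite_lessThan orth, of "coupling i" "coupling l"]
        limit_expansion[OF that(1,3)] limit_expansion[OF that(2,4)] by simp
    then show ?thesis by (simp add: limit_orthonormal)
  qed
  show "orthonormal_family u"
    unfolding orthonormal_family_def
  proof (intro allI impI)
    fix i l assume il: "i < CARD('d)" "l < CARD('d)"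
    consider "sv x i \<noteq> 0" "sv x l \<noteq> 0" | "sv x i \<noteq> 0" "sv x l = 0" | "sv x i = 0" "sv x l \<noteq> 0" | "sv x i = 0" "sv x l = 0"
      by blast
    then show "u i \<bullet> u l = (if i = l then 1 else 0)"
    proof cases
      case 1
      then show ?thesis using c2[of i l] c3[OF il] by (simp add: u_def)
    next
      case 2
      then have "coupling i l = 0" "i \<noteq> l" using coupling_zero[OF il] by auto
      then show ?thesis using 2 c1[OF il(2), of i] by (simp add: u_def)
    next
      case 3
      then have "coupling l i = 0" "i \<noteq> l" using coupling_zero[OF il(2,1)] by auto
      then show ?thesis using 3 c1[OF il(1), of l] by (simp add: u_def inner_commute)
    next
      case 4
      then show ?thesis using inner_u0[OF il] by (simp add: u_def)
    qed
  qed
  show "gram x *v u i = sv x i *\<^sub>R u i" if i: "i < CARD('d)" for i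
  proof (cases "sv x i = 0")
    case True
    then show ?thesis using left_singular_basisD(2)[OF u0 i] by (simp add: u_def)
  next
    case False
    have "gram x *v u i = (\<Sum>j<CARD('d). coupling i j *\<^sub>R (sv x j *\<^sub>R u0 j))"
      using False left_singular_basisD(2)[OF u0]
      by (simp add: u_def linear_sum[OF matrix_vector_mul_linear] matrix_vector_mult_scaleR)
    also have "\<dots> = (\<Sum>j<CARD('d). coupling i j *\<^sub>R (sv x i *\<^sub>R u0 j))"
    proof (intro sum.cong refl)
      fix j assume "j \<in> {..<CARD('d)}"
      then show "coupling i j *\<^sub>R (sv x j *\<^sub>R u0 j) = coupling i j *\<^sub>R (sv x i *\<^sub>R u0 j)"
        using coupling_zero[OF i, of j] by (cases "sv x i = sv x j") auto
    qed
    also have "\<dots> = sv x i *\<^sub>R u i" using False by (simp add: u_def scaleR_sum_right mult.commute)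
    finally show ?thesis .
  qed
qed (rule singular_value_antimono)

end

end

section \<open>Optimal value and convergence of the truncated isometries\<close>

definition limit_isometry :: "(nat \<Rightarrow> real ^ 'd) \<Rightarrow> real ^ 'd \<Rightarrow> real \<Rightarrow> real" where
  "limit_isometry u y = (\<lambda>t. \<Sum>i<CARD('d). (u i \<bullet> y) * synth (\<psi> i) t)"

lemma limit_isometry_facts:
  "limit_isometry u y \<in> L2" "hartley (limit_isometry u y) = (\<lambda>k. \<Sum>i<CARD('d). (u i \<bullet> y) * \<psi> i k)"
proof -
  have s: "synth (\<psi> i) \<in> L2" for i by (rule synth_limit(1)[OF limit_H1])
  then show "limit_isometry u y \<in> L2" unfolding limit_isometry_def by (intro L2.sum_mem)
  show "hartley (limit_isometry u y) = (\<lambda>k. \<Sum>i<CARD('d). (u i \<bullet> y) * \<psi> i k)"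
    unfolding limit_isometry_def using hartley_sum[of "{..<CARD('d)}" "\<lambda>i. synth (\<psi> i)", OF s]
    by (simp add: hartley_synth limit_H1)
qed

lemma isometry_MSSQV_ge_optimum:
  assumes "\<Phi> \<in> isometries"
  shows "optimum \<le> MSSQV \<alpha> x \<Phi>"
proof -
  obtain u where u: "left_singular_basis (data_matrix x) u" using left_singular_basis_exists by blast
  note co = isometry_coefficients[OF assms left_singular_basisD(1)[OF u]]
  have "optimum \<le> 1 / real CARD('n) * (\<Sum>i<CARD('d). sv x i * energy \<alpha> (hartley (\<Phi> (u i))))"
    by (intro mult_left_mono weighted_energy_ge co) auto
  also have "\<dots> \<le> MSSQV \<alpha> x \<Phi>" by (rule isometry_MSSQV_ge[OF assms u alpha_pos])
  finally show ?thesis .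
qed

lemma signed_limit_is_solution:
  assumes u: "left_singular_basis (data_matrix x) u" and s: "\<And>i. i < CARD('d) \<Longrightarrow> s i * s i = (1::real)"
    and L2: "\<And>y. \<Phi> y \<in> L2" and co: "\<And>y. hartley (\<Phi> y) = (\<lambda>k. \<Sum>i<CARD('d). (u i \<bullet> y) * (s i * \<psi> i k))"
  shows "\<Phi> \<in> isometries" "MSSQV \<alpha> x \<Phi> = optimum" "is_solution \<alpha> x \<Phi>"
proof -
  have w: "(\<lambda>k. s i * \<psi> i k) \<in> H2" for i
    using H2_sum[of "{()}" "\<lambda>_. \<psi> i" "\<lambda>_. s i"] limit_in_H2 by simp
  have orth: "l2.orthonormal_on {..<CARD('d)} (\<lambda>i k. s i * \<psi> i k)"
    by (rule l2.orthonormal_on_sign[OF limit_orthonormal_on]) (use s in auto)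
  show iso: "\<Phi> \<in> isometries"
    by (rule isometry_from_coefficients(1)[OF left_singular_basisD(1)[OF u] w orth L2 co])
  have "MSSQV \<alpha> x \<Phi> = 1 / real CARD('n) * (\<Sum>i<CARD('d). sv x i * energy \<alpha> (\<lambda>k. s i * \<psi> i k))"
    by (rule isometry_from_coefficients(2)[OF left_singular_basisD(1)[OF u] w orth L2 co u])
  also have "(\<Sum>i<CARD('d). sv x i * energy \<alpha> (\<lambda>k. s i * \<psi> i k)) = (\<Sum>i<CARD('d). sv x i * L i)"
    using s by (intro sum.cong refl) (simp add: energy_scale power2_eq_square limit_energy)
  finally show "MSSQV \<alpha> x \<Phi> = optimum" .
  then show "is_solution \<alpha> x \<Phi>"
    using iso isometry_MSSQV_ge_optimum by (simp add: is_solution_def)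
qed

lemma limit_isometry_is_solution:
  assumes u: "left_singular_basis (data_matrix x) u"
  shows "limit_isometry u \<in> isometries" "MSSQV \<alpha> x (limit_isometry u) = optimum" "is_solution \<alpha> x (limit_isometry u)"
  using signed_limit_is_solution[OF u, of "\<lambda>_. 1" "limit_isometry u"] limit_isometry_facts by simp_all

lemma solution_exists: "\<exists>\<Phi>. is_solution \<alpha> x \<Phi> \<and> \<Phi> \<in> isometries \<and> MSSQV \<alpha> x \<Phi> = optimum"
proof -
  obtain u where "left_singular_basis (data_matrix x) u" using left_singular_basis_exists by blast
  then show ?thesis using limit_isometry_is_solution by blast
qed

lemma truncated_MSSQV_tendsto:
  assumes u: "left_singular_basis (data_matrix x) u" and \<phi>: "B_eigenfamily \<alpha> CARD('d) \<phi>"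
  shows "(\<lambda>N. MSSQV \<alpha> x (truncated_isometry u \<phi> N)) \<longlonglongrightarrow>
          (INF \<Psi>\<in>(isometries :: (real ^ 'd \<Rightarrow> real \<Rightarrow> real) set). MSSQV \<alpha> x \<Psi>)"
proof -
  have "(INF \<Psi>\<in>(isometries :: (real ^ 'd \<Rightarrow> real \<Rightarrow> real) set). MSSQV \<alpha> x \<Psi>) = optimum"
  proof (rule cInf_eq_minimum)
    show "optimum \<in> MSSQV \<alpha> x ` isometries" using solution_exists by (metis image_eqI)
  qed (use isometry_MSSQV_ge_optimum in auto)
  moreover have "(\<lambda>N. 1 / real CARD('n) * (\<Sum>i<CARD('d). sv x i * lam \<alpha> N i)) \<longlonglongrightarrow> optimum"
    by (intro tendsto_mult tendsto_sum tendsto_const lam_tendsto)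
  moreover have "\<forall>\<^sub>F N in sequentially. MSSQV \<alpha> x (truncated_isometry u \<phi> N)
      = 1 / real CARD('n) * (\<Sum>i<CARD('d). sv x i * lam \<alpha> N i)"
    using eventually_ge_at_top[of "CARD('d)"] by eventually_elim (rule truncated_isometry_facts(2)[OF u \<phi>])
  ultimately show ?thesis by (simp add: tendsto_cong)
qed

text \<open>The signs of the given eigenvectors could oscillate with \<open>N\<close>; convergence
  is assumed for the isometry alone. Products of two coordinates of one eigenvector are free of
  signs, so the limit coordinates satisfy \<open>w i k * w i l = \<psi> i k * \<psi> i l\<close>,
  which determines \<open>w i\<close> up to one sign.\<close>

lemma limit_is_solution:
  assumes u: "left_singular_basis (data_matrix x) u" and \<phi>: "B_eigenfamily \<alpha> CARD('d) \<phi>"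
    and lim: "is_limit (truncated_isometry u \<phi>) \<Phi>"
  shows "is_solution \<alpha> x \<Phi>"
proof -
  let ?T = "truncated_isometry u \<phi>"
  have L2: "\<Phi> y \<in> L2" for y using lim by (simp add: is_limit_def)
  have coeff: "(\<lambda>N. hartley (?T N y) k) \<longlonglongrightarrow> hartley (\<Phi> y) k" for y k
  proof -
    have lim0: "(\<lambda>N. L2norm (\<lambda>t. ?T N y t - \<Phi> y t)) \<longlonglongrightarrow> 0" using lim by (simp add: is_limit_def)
    have "(\<lambda>N. \<bar>hartley (?T N y) k - hartley (\<Phi> y) k\<bar>) \<longlonglongrightarrow> 0"
    proof (rule tendsto_sandwich[OF _ _ tendsto_const lim0])
      show "\<forall>\<^sub>F N in sequentially. \<bar>hartley (?T N y) k - hartley (\<Phi> y) k\<bar> \<le> L2norm (\<lambda>t. ?T N y t - \<Phi> y t)"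
        using eventually_ge_at_top[of "CARD('d)"]
      proof eventually_elim
        case (elim N)
        let ?g = "\<lambda>t. ?T N y t - \<Phi> y t"
        note T = truncated_isometry_facts(3)[OF u \<phi> elim, of y]
        have g: "?g \<in> L2" by (rule L2.diff_mem[OF T L2])
        have "(hartley ?g k)\<^sup>2 \<le> (L2norm ?g)\<^sup>2"
          using l2_square_le_ip2[OF hartley_bessel(1)[OF g], of k] hartley_bessel(2)[OF g]
          by (simp add: L2norm_eq(2))
        moreover have "0 \<le> L2norm ?g" using L2.ip_nonneg by (simp add: L2norm_eq(1))
        ultimately have "\<bar>hartley ?g k\<bar> \<le> L2norm ?g" 
          using abs_le_square_iff[of "hartley ?g k" "L2norm ?g"] by simp
        then show ?case by (simp add: hartley_diff[OF T L2])
      qed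
    qed simp
    then show ?thesis by (simp add: tendsto_rabs_zero_iff LIM_zero_iff)
  qed
  define s where "s = (\<lambda>N. SOME s. \<forall>i<CARD('d). s i * s i = (1::real) \<and> hartley (\<phi> N i) = (\<lambda>k. s i * ev N i k))"
  have s: "s N i * s N i = 1" "hartley (\<phi> N i) = (\<lambda>k. s N i * ev N i k)" if "N \<ge> CARD('d)" "i < CARD('d)" for N i
  proof -
    have "\<exists>s. \<forall>i<CARD('d). s i * s i = (1::real) \<and> hartley (\<phi> N i) = (\<lambda>k. s i * ev N i k)"
      by (rule B_eigenfamily_hartley[OF \<phi> that(1)]) blast
    from someI_ex[OF this]
    have "\<forall>i<CARD('d). s N i * s N i = 1 \<and> hartley (\<phi> N i) = (\<lambda>k. s N i * ev N i k)"
      unfolding s_def .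
    then show "s N i * s N i = 1" "hartley (\<phi> N i) = (\<lambda>k. s N i * ev N i k)"
      using that(2) by blast+
  qed
  have co: "(\<lambda>N. \<Sum>i<CARD('d). (u i \<bullet> y) * (s N i * ev N i k)) \<longlonglongrightarrow> hartley (\<Phi> y) k" for y k
  proof -
    have "\<forall>\<^sub>F N in sequentially. hartley (?T N y) k = (\<Sum>i<CARD('d). (u i \<bullet> y) * (s N i * ev N i k))"
      using eventually_ge_at_top[of "CARD('d)"]
      by eventually_elim (simp add: truncated_isometry_facts(4)[OF u \<phi>] s)
    then show ?thesis using coeff[of y k] by (simp add: tendsto_cong)
  qed
  define w where "w = (\<lambda>i. hartley (\<Phi> (u i)))"
  have w: "(\<lambda>N. s N i * ev N i k) \<longlonglongrightarrow> w i k" if i: "i < CARD('d)" for i k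
  proof -
    \<comment> \<open>At \<open>y = u i\<close> orthonormality isolates a single
      eigenvector.\<close>
    have "(\<Sum>j<CARD('d). (u j \<bullet> u i) * (s N j * ev N j k)) = (\<Sum>j<CARD('d). if j = i then s N j * ev N j k else 0)" for N
      using left_singular_basisD(1)[OF u] i by (intro sum.cong) (auto simp: orthonormal_family_def)
    then show ?thesis using co[of "u i" k] i by (simp add: w_def)
  qed
  have "\<exists>e. e * e = 1 \<and> w i = (\<lambda>k. e * \<psi> i k)" if i: "i < CARD('d)" for i
  proof -
    have prod: "w i k * w i l = \<psi> i k * \<psi> i l" for k l
    proof (rule LIMSEQ_unique)
      show "(\<lambda>N. (s N i * ev N i k) * (s N i * ev N i l)) \<longlonglongrightarrow> w i k * w i l" by (intro tendsto_mult w i)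
      have evt: "\<forall>\<^sub>F N in sequentially. (s N i * ev N i k) * (s N i * ev N i l) = ev N i k * ev N i l"
        using eventually_ge_at_top[of "CARD('d)"]
      proof eventually_elim
        case (elim N)
        have "(s N i * ev N i k) * (s N i * ev N i l) = (s N i * s N i) * (ev N i k * ev N i l)" by (simp only: ac_simps)
        then show ?case using s(1)[OF elim i] by simp
      qed
      show "(\<lambda>N. (s N i * ev N i k) * (s N i * ev N i l)) \<longlonglongrightarrow> \<psi> i k * \<psi> i l"
        unfolding tendsto_cong[OF evt] by (intro tendsto_mult ev_pointwise)
    qed
    have "\<psi> i \<noteq> (\<lambda>_. 0)" using limit_orthonormal[of i i] by (auto simp: ip2_def)
    then obtain l where l: "\<psi> i l \<noteq> 0" by blast
    \<comment> \<open>The sign is read off at an index \<open>l\<close> where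
      \<open>\<psi> i\<close> is nonzero.\<close>
    define e where "e = w i l / \<psi> i l"
    have e: "e * e = 1" using prod[of l l] l by (simp add: e_def)
    have "w i k = e * \<psi> i k" for k
    proof -
      have "w i l \<noteq> 0" using prod[of l l] l by auto
      have "\<psi> i l * (w i k * w i l) = \<psi> i k * (w i l * w i l)" unfolding prod by (simp only: ac_simps)
      then have "w i l * (\<psi> i l * w i k) = w i l * (w i l * \<psi> i k)" by (simp only: ac_simps)
      then have "\<psi> i l * w i k = w i l * \<psi> i k" using \<open>w i l \<noteq> 0\<close> by simp
      then show ?thesis using l by (simp add: e_def field_simps)
    qed
    then show ?thesis using e by blast
  qed
  then obtain e where e: "\<And>i. i < CARD('d) \<Longrightarrow> e i * e i = 1" "\<And>i. i < CARD('d) \<Longrightarrow> w i = (\<lambda>k. e i * \<psi> i k)"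
    by metis
  have "hartley (\<Phi> y) k = (\<Sum>i<CARD('d). (u i \<bullet> y) * w i k)" for y k
    by (rule LIMSEQ_unique[OF co]) (intro tendsto_sum tendsto_mult tendsto_const w, simp)
  then have H: "hartley (\<Phi> y) = (\<lambda>k. \<Sum>i<CARD('d). (u i \<bullet> y) * (e i * \<psi> i k))" for y
    using e(2) by (auto simp: fun_eq_iff)
  show ?thesis by (rule signed_limit_is_solution(3)[OF u e(1) L2 H])
qed

lemma limit_isometry_is_limit:
  assumes u: "left_singular_basis (data_matrix x) u"
  shows "is_limit (truncated_isometry u (\<lambda>N i. synth (ev N i))) (limit_isometry u)"
  unfolding is_limit_def
proof (intro allI conjI limit_isometry_facts)
  fix y
  let ?D = "\<lambda>N t. truncated_isometry u (\<lambda>N i. synth (ev N i)) N y t - limit_isometry u y t"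
  have L2: "synth (ev N i) \<in> L2" "synth (\<psi> i) \<in> L2" if "i < CARD('d)" "N \<ge> CARD('d)" for N i
    using that ev_facts(1)[of i N] limit_H1 by (auto intro: synth_limit)
  have g: "ipL (\<lambda>t. synth (ev N i) t - synth (\<psi> i) t) (\<lambda>t. synth (ev N i) t - synth (\<psi> i) t)
      = ip2 (\<lambda>k. ev N i k - \<psi> i k) (\<lambda>k. ev N i k - \<psi> i k)" if "i < CARD('d)" "N \<ge> CARD('d)" for N i
  proof -
    have H: "ev N i \<in> H1" using that by (intro ev_facts) simp
    have h: "hartley (\<lambda>t. synth (ev N i) t - synth (\<psi> i) t) = (\<lambda>k. ev N i k - \<psi> i k)"
      unfolding hartley_diff[OF L2[OF that]] by (simp add: hartley_synth H limit_H1)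
    have "(\<lambda>k. ev N i k - \<psi> i k) \<in> H1"
      using H1_sum[of "{True, False}" "\<lambda>b. if b then ev N i else \<psi> i" "\<lambda>b. if b then 1 else - 1"] H limit_H1 by simp
    then show ?thesis
      using H1_parseval(2)[OF L2.diff_mem[OF L2[OF that]]] unfolding h by simp
  qed
  have D: "?D N = (\<lambda>t. \<Sum>i<CARD('d). (u i \<bullet> y) * (synth (ev N i) t - synth (\<psi> i) t))" for N
    by (simp add: truncated_isometry_def limit_isometry_def sum_subtractf right_diff_distrib)
  \<comment> \<open>The shift guarantees that every \<open>ev\<close> involved is a genuine
    eigenvector with finite support, so that \<open>synth\<close> represents it.\<close>
  have "(\<lambda>N. ipL (?D (N + CARD('d))) (?D (N + CARD('d)))) \<longlonglongrightarrow> 0"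
    unfolding D
  proof (rule L2.ip_sum_tendsto_zero)
    show "(\<lambda>t. synth (ev (N + CARD('d)) i) t - synth (\<psi> i) t) \<in> L2" if "i \<in> {..<CARD('d)}" for N i
      using that by (intro L2.diff_mem L2) auto
    show "(\<lambda>N. ipL (\<lambda>t. synth (ev (N + CARD('d)) i) t - synth (\<psi> i) t) (\<lambda>t. synth (ev (N + CARD('d)) i) t - synth (\<psi> i) t))
        \<longlonglongrightarrow> 0" if "i \<in> {..<CARD('d)}" for i
      using ev_tendsto_shifted[of "CARD('d)" i] that by (simp add: g)
  qed
  then have "(\<lambda>N. L2norm (?D (N + CARD('d)))) \<longlonglongrightarrow> sqrt 0"
    unfolding L2norm_eq(1) by (intro tendsto_real_sqrt)
  then have "(\<lambda>N. L2norm (?D (N + CARD('d)))) \<longlonglongrightarrow> 0" by simp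
  then show "(\<lambda>N. L2norm (?D N)) \<longlonglongrightarrow> 0" by (rule LIMSEQ_offset)
qed

text \<open>A solution attains the lower bound, so its coefficients along a left singular basis
  minimise the weighted energy. In the rotated basis it sends \<open>u i\<close> to
  \<open>\<psi> i\<close> wherever the singular value is positive; the other \<open>u i\<close> are
  orthogonal to the data, which limits the agreement to their span.\<close>

lemma solution_is_limit:
  assumes sol: "is_solution \<alpha> x \<Phi>"
  shows "\<exists>u \<phi> \<Psi>. left_singular_basis (data_matrix x) u \<and> B_eigenfamily \<alpha> CARD('d) \<phi> \<and>
           is_limit (truncated_isometry u \<phi>) \<Psi> \<and>
           (\<forall>y \<in> span (range x). AE t in unit_measure. \<Phi> y t = \<Psi> y t)"
proof -
  obtain u0 where u0: "left_singular_basis (data_matrix x) u0" using left_singular_basis_exists by blast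
  have iso: "\<Phi> \<in> isometries" using sol by (simp add: is_solution_def)
  then have L2: "\<Phi> y \<in> L2" for y by (simp add: isometries_def sobolev_def)
  define v where "v = (\<lambda>j. hartley (\<Phi> (u0 j)))"
  note co = isometry_coefficients[OF iso left_singular_basisD(1)[OF u0]]
  have orth: "l2.orthonormal_on {..<CARD('d)} v" unfolding v_def by (rule co(3))
  have H1: "v j \<in> H1" for j unfolding v_def by (rule co(1))
  have "MSSQV \<alpha> x \<Phi> \<le> optimum"
    using sol solution_exists by (metis is_solution_def)
  moreover have "1 / real CARD('n) * (\<Sum>i<CARD('d). sv x i * energy \<alpha> (v i)) \<le> MSSQV \<alpha> x \<Phi>"
    unfolding v_def by (rule isometry_MSSQV_ge[OF iso u0 alpha_pos])
  ultimately have "1 / real CARD('n) * (\<Sum>i<CARD('d). sv x i * energy \<alpha> (v i)) \<le> optimum" by linarith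
  then have "(\<Sum>i<CARD('d). sv x i * energy \<alpha> (v i)) \<le> (\<Sum>i<CARD('d). sv x i * L i)"
    by (simp add: divide_le_cancel)
  then have minimal: "(\<Sum>i<CARD('d). sv x i * energy \<alpha> (v i)) = (\<Sum>i<CARD('d). sv x i * L i)"
    using weighted_energy_ge[OF orth H1] by (intro antisym) auto
  define u where "u = (\<lambda>i. if sv x i \<noteq> 0 then (\<Sum>j<CARD('d). ip2 (\<psi> i) (v j) *\<^sub>R u0 j) else u0 i)"
  have u: "left_singular_basis (data_matrix x) u"
    unfolding u_def by (rule rotated_singular_basis[OF orth H1 minimal u0])
  have co_u: "hartley (\<Phi> (u i)) = \<psi> i" if i: "i < CARD('d)" "sv x i \<noteq> 0" for i
  proof -
    have "u0 j \<bullet> u i = ip2 (\<psi> i) (v j)" if j: "j < CARD('d)" for j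
    proof -
      have "u0 j \<bullet> u i = (\<Sum>l<CARD('d). if l = j then ip2 (\<psi> i) (v l) else 0)"
        unfolding u_def if_P[OF i(2)] inner_sum_right inner_scaleR_right
        using left_singular_basisD(1)[OF u0] j by (intro sum.cong) (auto simp: orthonormal_family_def)
      then show ?thesis using j by simp
    qed
    then have "hartley (\<Phi> (u i)) = (\<lambda>k. \<Sum>j<CARD('d). ip2 (\<psi> i) (v j) * v j k)"
      using co(2)[of "u i"] by (simp add: v_def)
    then show ?thesis using limit_expansion[OF orth H1 minimal i] by simp
  qed
  \<comment> \<open>A zero singular value means that the squared products of \<open>u i\<close> with
    all data points sum to zero.\<close>
  have kernel: "u i \<bullet> y = 0" if i: "i < CARD('d)" "sv x i = 0" and y: "y \<in> span (range x)" for i y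
  proof -
    have "(\<Sum>c\<in>UNIV. (u i \<bullet> x c) * (u i \<bullet> x c)) = 0"
      using left_singular_basis_gram[OF u i(1) i(1)] i(2) by simp
    then have "u i \<bullet> x c = 0" for c by (subst (asm) sum_nonneg_eq_0_iff) auto
    then have "orthogonal (u i) y" using y by (intro orthogonal_to_span[of y "range x" "u i"]) (auto simp: orthogonal_def)
    then show ?thesis by (simp add: orthogonal_def)
  qed
  have "AE t in unit_measure. \<Phi> y t = limit_isometry u y t" if y: "y \<in> span (range x)" for y
  proof (rule hartley_inject_AE[OF L2 limit_isometry_facts(1)])
    have eq: "(u i \<bullet> y) * hartley (\<Phi> (u i)) k = (u i \<bullet> y) * \<psi> i k" if "i < CARD('d)" for i k
      using co_u[OF that] kernel[OF that _ y] by (cases "sv x i = 0") auto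
    show "hartley (\<Phi> y) = hartley (limit_isometry u y)"
      unfolding isometry_coefficients(2)[OF iso left_singular_basisD(1)[OF u], of y] limit_isometry_facts(2)
      by (intro ext sum.cong refl eq) simp
  qed
  moreover have "B_eigenfamily \<alpha> CARD('d) (\<lambda>N i. synth (ev N i))"
  proof (rule B_eigenfamilyI)
    fix N i assume "i < CARD('d)" "CARD('d) \<le> N"
    then have "ev N i \<in> H1" by (intro ev_facts) simp
    then show "synth (ev N i) \<in> L2 \<and> hartley (synth (ev N i)) = ev N i"
      using synth_limit(1) hartley_synth by blast
  qed
  ultimately show ?thesis using u limit_isometry_is_limit[OF u] by blast
qed

end

end

text \<open>The objective sees an isometry only on the span of the data, so with rank-deficient data
  a solution may be completed in ways that are no such limits. The converse is therefore stated
  twice: in full for data of full rank, and in general as agreement on the span.\<close>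

theorem theorem2:
  fixes \<alpha> :: real and x :: "'n::finite \<Rightarrow> real ^ 'd"
  assumes "\<alpha> > 0"
  shows
    "(\<exists>\<Phi>. is_solution \<alpha> x \<Phi>) \<and>
     (\<forall>u \<phi> \<Phi>. left_singular_basis (data_matrix x) u \<and> B_eigenfamily \<alpha> CARD('d) \<phi> \<and>
        is_limit (truncated_isometry u \<phi>) \<Phi> \<longrightarrow> is_solution \<alpha> x \<Phi>) \<and>
     (rank (data_matrix x) = CARD('d) \<longrightarrow>
        (\<forall>\<Phi>. is_solution \<alpha> x \<Phi> \<longrightarrow>
           (\<exists>u \<phi>. left_singular_basis (data_matrix x) u \<and> B_eigenfamily \<alpha> CARD('d) \<phi> \<and>
              is_limit (truncated_isometry u \<phi>) \<Phi>))) \<and>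
     (\<forall>\<Phi>. is_solution \<alpha> x \<Phi> \<longrightarrow>
        (\<exists>u \<phi> \<Psi>. left_singular_basis (data_matrix x) u \<and> B_eigenfamily \<alpha> CARD('d) \<phi> \<and>
           is_limit (truncated_isometry u \<phi>) \<Psi> \<and>
           (\<forall>y \<in> span (range x). AE t in unit_measure. \<Phi> y t = \<Psi> y t))) \<and>
     (\<forall>u \<phi>. left_singular_basis (data_matrix x) u \<and> B_eigenfamily \<alpha> CARD('d) \<phi> \<longrightarrow>
        (\<forall>N\<ge>CARD('d). truncated_isometry u \<phi> N \<in> isometries) \<and>
        (\<lambda>N. MSSQV \<alpha> x (truncated_isometry u \<phi> N)) \<longlonglongrightarrow>
          (INF \<Psi>\<in>(isometries :: (real ^ 'd \<Rightarrow> real \<Rightarrow> real) set). MSSQV \<alpha> x \<Psi>))"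
proof -
  obtain L \<psi> ev where "limiting_eigenbasis \<alpha> L \<psi> ev" using limiting_eigenbasis_exists[OF assms] by blast
  then interpret limiting_eigenbasis \<alpha> L \<psi> ev .
  \<comment> \<open>For full rank the agreement holds for every \<open>y\<close>, and changing a
    limit on null sets leaves the distances \<open>L2norm\<close> unchanged.\<close>
  have full_rank: "\<exists>u \<phi>. left_singular_basis (data_matrix x) u \<and> B_eigenfamily \<alpha> CARD('d) \<phi> \<and>
      is_limit (truncated_isometry u \<phi>) \<Phi>"
    if rank: "rank (data_matrix x) = CARD('d)" and sol: "is_solution \<alpha> x \<Phi>" for \<Phi>
  proof -
    obtain u \<phi> \<Psi> where u: "left_singular_basis (data_matrix x) u" "B_eigenfamily \<alpha> CARD('d) \<phi>"
      and lim: "is_limit (truncated_isometry u \<phi>) \<Psi>"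
      and eq: "\<forall>y \<in> span (range x). AE t in unit_measure. \<Phi> y t = \<Psi> y t"
      using solution_is_limit[OF sol] by blast
    have "is_limit (truncated_isometry u \<phi>) \<Phi>"
      unfolding is_limit_def
    proof (intro allI conjI)
      fix y
      have \<Phi>: "\<Phi> y \<in> L2" using sol by (simp add: is_solution_def isometries_def sobolev_def)
      then show "\<Phi> y \<in> L2" .
      have \<Psi>: "\<Psi> y \<in> L2" using lim by (simp add: is_limit_def)
      have ae: "AE t in unit_measure. \<Phi> y t = \<Psi> y t" using eq span_eq_UNIV_of_full_rank[OF rank] by simp
      have "\<forall>\<^sub>F N in sequentially. L2norm (\<lambda>t. truncated_isometry u \<phi> N y t - \<Phi> y t)
          = L2norm (\<lambda>t. truncated_isometry u \<phi> N y t - \<Psi> y t)"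
        using eventually_ge_at_top[of "CARD('d)"]
      proof eventually_elim
        case (elim N)
        note T = truncated_isometry_facts(3)[OF u elim, of y]
        show ?case
          unfolding L2norm_def using ae L2.diff_mem[OF T \<Phi>] L2.diff_mem[OF T \<Psi>]
          by (intro arg_cong[where f = sqrt] integral_cong_AE) (auto simp: L2_def elim!: eventually_mono)
      qed
      then show "(\<lambda>N. L2norm (\<lambda>t. truncated_isometry u \<phi> N y t - \<Phi> y t)) \<longlonglongrightarrow> 0"
        using lim by (simp add: tendsto_cong is_limit_def)
    qed
    then show ?thesis using u by blast
  qed
  show ?thesis
  proof (intro conjI allI impI)
    show "\<exists>\<Phi>. is_solution \<alpha> x \<Phi>" using solution_exists[of x] by blast
  next
    fix u \<phi> \<Phi>
    assume "left_singular_basis (data_matrix x) u \<and> B_eigenfamily \<alpha> CARD('d) \<phi> \<and> is_limit (truncated_isometry u \<phi>) \<Phi>"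
    then show "is_solution \<alpha> x \<Phi>" using limit_is_solution by blast
  next
    fix u \<phi> N
    assume "left_singular_basis (data_matrix x) u \<and> B_eigenfamily \<alpha> CARD('d) \<phi>" "CARD('d) \<le> N"
    then show "truncated_isometry u \<phi> N \<in> isometries" using truncated_isometry_facts(1) by blast
  next
    fix u \<phi>
    assume "left_singular_basis (data_matrix x) u \<and> B_eigenfamily \<alpha> CARD('d) \<phi>"
    then show "(\<lambda>N. MSSQV \<alpha> x (truncated_isometry u \<phi> N)) \<longlonglongrightarrow>
          (INF \<Psi>\<in>(isometries :: (real ^ 'd \<Rightarrow> real \<Rightarrow> real) set). MSSQV \<alpha> x \<Psi>)"
      using truncated_MSSQV_tendsto by blast
  qed (use full_rank solution_is_limit in \<open>blast+\<close>)
qed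

end
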